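(* Let $n\geq 2$ and let $I_n$ be the partial inner automorphism group of the free group $F_n$ (defined in the context). For every integer $k\geq 1$, $$\mathcal{I}_n(k):=\mathcal{A}_n(k)\cap I_n=\Gamma_k(I_n),$$ where $\Gamma_k(I_n)$ is the $k$-th term of the lower central series of $I_n$.
   Context: $F_n$ is the free group on $x_1,\dots,x_n$. For a group $G$, the lower central series is $\Gamma_1(G)=G$, $\Gamma_{k+1}(G)=(\Gamma_k(G),G)$, where $(a,b)=a^{-1}b^{-1}ab$; write $\Gamma_n(k)=\Gamma_k(F_n)$. The Andreadakis filtration is $\mathcal{A}_n(k)=\{\phi\in \mathrm{Aut}(F_n)\;:\; g^{-1}\phi(g)\in\Gamma_n(k+1)\ \text{for all } g\in F_n\}$ for $k\geq1$ (so $\mathcal{A}_n(1)=IA_n$ is the group of automorphisms acting trivially on the abelianization). For $2\leq p\leq n$ and $1\leq i\leq p$, let $\nu_{pi}\in\mathrm{Aut}(F_n)$ be the automorphism with $\nu_{pi}(x_k)=x_i^{-1}x_kx_i$ for $1\leq k\leq p$ and $\nu_{pi}(x_k)=x_k$ for $p<k\leq n$ (equivalently $\nu_{pi}=\xi_{1,i}\xi_{2,i}\cdots\xi_{p,i}$ where $\xi_{l,i}$ conjugates $x_l$ by $x_i$ and fixes the other generators, $\xi_{i,i}$ being the identity). The partial inner automorphism group $I_n$ is the subgroup of $\mathrm{Aut}(F_n)$ generated by all $\nu_{pi}$, $2\leq p\leq n$, $1\leq i\leq p$. *)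

theory Defs
  imports "HOL-Algebra.Bij" "HOL-Algebra.Generated_Groups"
begin

text \<open>A letter (k, True) stands for x_k, a letter (k, False) for x_k inverse.\<close>

type_synonym fletter = "nat \<times> bool"

definition cancels :: "fletter \<Rightarrow> fletter \<Rightarrow> bool" where
  "cancels a b \<longleftrightarrow> fst a = fst b \<and> snd a \<noteq> snd b"

fun reduced :: "fletter list \<Rightarrow> bool" where
  "reduced (a # b # w) = (\<not> cancels a b \<and> reduced (b # w))"
| "reduced _ = True"

fun push_letter :: "fletter \<Rightarrow> fletter list \<Rightarrow> fletter list" where
  "push_letter a [] = [a]"
| "push_letter a (b # w) = (if cancels a b then w else a # b # w)"

definition normalize :: "fletter list \<Rightarrow> fletter list" where
  "normalize w = foldr push_letter w []"

definition free_group :: "nat \<Rightarrow> fletter list monoid" where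
  "free_group n = \<lparr> carrier = {w. set w \<subseteq> {1..n} \<times> UNIV \<and> reduced w},
                    mult = (\<lambda>u v. normalize (u @ v)),
                    one = [] \<rparr>"

definition fgen :: "nat \<Rightarrow> fletter list" where
  "fgen k = [(k, True)]"

definition word_eval :: "('a, 'b) monoid_scheme \<Rightarrow> (nat \<Rightarrow> 'a) \<Rightarrow> fletter list \<Rightarrow> 'a" where
  "word_eval G f w = foldr (\<lambda>(k, b) acc. (if b then f k else inv\<^bsub>G\<^esub> (f k)) \<otimes>\<^bsub>G\<^esub> acc) w \<one>\<^bsub>G\<^esub>"

definition gcomm :: "('a, 'b) monoid_scheme \<Rightarrow> 'a \<Rightarrow> 'a \<Rightarrow> 'a" where
  "gcomm G a b = inv\<^bsub>G\<^esub> a \<otimes>\<^bsub>G\<^esub> inv\<^bsub>G\<^esub> b \<otimes>\<^bsub>G\<^esub> a \<otimes>\<^bsub>G\<^esub> b"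

text \<open>lcs G k is Gamma_k(G) for k \<ge> 1 (Gamma_1 = G, Gamma_{k+1} = (Gamma_k, G));
  the value at 0 is a dummy.\<close>
fun lcs :: "('a, 'b) monoid_scheme \<Rightarrow> nat \<Rightarrow> 'a set" where
  "lcs G 0 = carrier G"
| "lcs G (Suc 0) = carrier G"
| "lcs G (Suc (Suc k)) =
     generate G {gcomm G a b | a b. a \<in> lcs G (Suc k) \<and> b \<in> carrier G}"

definition Aut_F :: "nat \<Rightarrow> (fletter list \<Rightarrow> fletter list) monoid" where
  "Aut_F n = AutoGroup (free_group n)"

definition andreadakis :: "nat \<Rightarrow> nat \<Rightarrow> (fletter list \<Rightarrow> fletter list) set" where
  "andreadakis n k = {\<phi> \<in> carrier (Aut_F n). \<forall>g \<in> carrier (free_group n).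
      inv\<^bsub>free_group n\<^esub> g \<otimes>\<^bsub>free_group n\<^esub> \<phi> g \<in> lcs (free_group n) (k + 1)}"

definition nu :: "nat \<Rightarrow> nat \<Rightarrow> nat \<Rightarrow> (fletter list \<Rightarrow> fletter list)" where
  "nu n p i = (\<lambda>w \<in> carrier (free_group n).
      word_eval (free_group n)
        (\<lambda>k. if 1 \<le> k \<and> k \<le> p
             then inv\<^bsub>free_group n\<^esub> (fgen i) \<otimes>\<^bsub>free_group n\<^esub> fgen k \<otimes>\<^bsub>free_group n\<^esub> fgen i
             else fgen k) w)"

definition partial_inner :: "nat \<Rightarrow> (fletter list \<Rightarrow> fletter list) set" where
  "partial_inner n = generate (Aut_F n) {nu n p i | p i. 2 \<le> p \<and> p \<le> n \<and> 1 \<le> i \<and> i \<le> p}"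

definition partial_inner_group :: "nat \<Rightarrow> (fletter list \<Rightarrow> fletter list) monoid" where
  "partial_inner_group n = (Aut_F n) \<lparr> carrier := partial_inner n \<rparr>"

end

(* The Magnus expansion x_i -> 1 + X_i maps the free group into the units of the ring of
   noncommutative integer power series. The heart of the proof is that g lies in Gamma_k as soon as
   its expansion is 1 up to degree k. This follows from Lazard elimination carried out in the group:
   modulo Gamma_(d+1), a subgroup generated by elements whose leading terms are freely independent
   is the product of the powers of one generator x of least weight and of the subgroup generated by
   the commutators [y, x, ..., x]; those again have freely independent leading terms, and an element
   of the kernel has no x-part.

   An element of level p of the partial inner group is the conjugation c_g of the first p generators
   by some g in F_p, followed by an element psi of level p - 1. If the composite lies in the
   Andreadakis group of index k, its value at x_p shows that g commutes with x_p modulo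
   Gamma_(k+1); the expansion then gives g = h x_p^m with h in Gamma_k(F_p), and the value at x_1
   gives m = 0. So c_h lies in Gamma_k of the partial inner group, and psi is handled by induction
   on p. *)

theory Submission
  imports Defs "HOL-Library.Multiset" "HOL-Library.Nat_Bijection"
begin

text \<open>The inclusion of Gamma_k(I_n) in the Andreadakis group is formal: the commutator of an
  element of A(k) with one of A(1) lies in A(k+1). The converse must turn a condition on single
  values of an automorphism into membership in the lower central series of F_p, and the Magnus
  expansion makes that checkable. Elimination needs no commutator bases: all the algebra is that
  monomials of weight at most \<open>d\<close> in the leading terms are linearly independent over
  the integers. This survives a step because [y, x, ..., x] has y x ... x as its smallest word and
  such words can be decoded uniquely from their concatenation, so the new monomials expand
  unitriangularly. Working modulo Gamma_(d+1) keeps the families finite; choosing x of least weight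
  makes the number of elements of that weight drop, until no weight up to \<open>d\<close> is left.
  The argument for m = 0 reads a coefficient of degree 2, so it needs a condition in Gamma_3, that
  is k >= 2; k = 1 is trivial. As psi(x_1) is only known to lie in F_(p-1), the coefficient of X_p
  X_1 is used, where psi(x_1) enters only through its coefficient of X_1.\<close>

section \<open>Noncommutative power series\<close>

text \<open>The concatenation (Cauchy) product: the sum of \<open>f u * g v\<close> over all
  splittings \<open>w = u @ v\<close>. Removing a first letter \<open>a\<close> replaces
  \<open>f\<close> by its left derivative \<open>\<lambda>v. f (a # v)\<close>, so inductions on the
  word generalise over \<open>f\<close>.\<close>

fun conv :: "(nat list \<Rightarrow> int) \<Rightarrow> (nat list \<Rightarrow> int) \<Rightarrow> nat list \<Rightarrow> int" where
  "conv f g [] = f [] * g []"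
| "conv f g (a # w) = f [] * g (a # w) + conv (\<lambda>v. f (a # v)) g w"

lemma conv_add_left: "conv (\<lambda>v. f v + g v) h w = conv f h w + conv g h w"
  by (induction w arbitrary: f g) (auto simp: algebra_simps)

lemma conv_add_right: "conv f (\<lambda>v. g v + h v) w = conv f g w + conv f h w"
  by (induction w arbitrary: f) (auto simp: algebra_simps)

lemma conv_scale_left: "conv (\<lambda>v. c * f v) g w = c * conv f g w"
  by (induction w arbitrary: f) (auto simp: algebra_simps)

lemma conv_zero_left: "conv (\<lambda>v. 0) g w = 0"
  by (induction w) auto

lemma conv_unit_left: "conv (\<lambda>v. if v = [] then 1 else 0) g w = g w"
  by (cases w) (auto simp: conv_zero_left)

lemma conv_unit_right: "conv f (\<lambda>v. if v = [] then 1 else 0) w = f w"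
  by (induction w arbitrary: f) auto

text \<open>The left derivative of \<open>conv f g\<close> is \<open>f []\<close> times that of
  \<open>g\<close> plus the product of the derivative of \<open>f\<close> with \<open>g\<close>;
  linearity in the left factor then reduces a word to its tail.\<close>

lemma conv_assoc: "conv (conv f g) h w = conv f (conv g h) w"
proof (induction w arbitrary: f)
  case (Cons a w)
  have "conv (conv f g) h (a # w)
      = f [] * (g [] * h (a # w) + conv (\<lambda>v. g (a # v)) h w) + conv (conv (\<lambda>v. f (a # v)) g) h w"
    by (simp add: conv_add_left conv_scale_left algebra_simps)
  then show ?case by (simp add: Cons.IH)
qed simp

text \<open>The left derivative lowers the order of \<open>f\<close> by one. For
  \<open>a = 0\<close> the truncated \<open>a - 1\<close> does no harm: the bound on the length then
  comes from \<open>b\<close> alone.\<close>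

lemma conv_low:
  assumes "\<And>w. length w < a \<Longrightarrow> f w = 0" and "\<And>w. length w < b \<Longrightarrow> g w = 0"
    and "length w < a + b"
  shows "conv f g w = 0"
  using assms
proof (induction w arbitrary: f a)
  case Nil
  then show ?case by (cases "a = 0") auto
next
  case (Cons x w)
  have "conv (\<lambda>v. f (x # v)) g w = 0"
    using Cons.prems by (intro Cons.IH[of "a - 1"]) auto
  moreover have "f [] * g (x # w) = 0"
    using Cons.prems by (cases "a = 0") auto
  ultimately show ?case by simp
qed

lemma conv_homogeneous:
  assumes "\<And>w. length w \<noteq> a \<Longrightarrow> f w = 0" and "\<And>w. length w \<noteq> b \<Longrightarrow> g w = 0"
    and "length w \<noteq> a + b"
  shows "conv f g w = 0"
  using assms
proof (induction w arbitrary: f a)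
  case Nil
  then show ?case by (cases "a = 0") auto
next
  case (Cons x w)
  show ?case
  proof (cases a)
    case 0
    then have "(\<lambda>v. f (x # v)) = (\<lambda>v. 0)" using Cons.prems(1) by auto
    then show ?thesis using Cons.prems 0 by (simp add: conv_zero_left)
  next
    case (Suc a')
    have "conv (\<lambda>v. f (x # v)) g w = 0"
      using Cons.prems Suc by (intro Cons.IH[of a']) auto
    then show ?thesis using Cons.prems(1)[of "[]"] Suc by simp
  qed
qed

text \<open>Formal power series with integer coefficients in noncommuting variables indexed by the
  natural numbers; a word is a monomial.\<close>

typedef ncs = "UNIV :: (nat list \<Rightarrow> int) set"
  morphisms coeff NCS ..

setup_lifting type_definition_ncs

lemma ncs_eqI: "(\<And>w. coeff f w = coeff g w) \<Longrightarrow> f = g"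
  by (metis coeff_inject ext)

instantiation ncs :: ring_1
begin
lift_definition zero_ncs :: ncs is "\<lambda>w. 0" .
lift_definition one_ncs :: ncs is "\<lambda>w. if w = [] then 1 else 0" .
lift_definition plus_ncs :: "ncs \<Rightarrow> ncs \<Rightarrow> ncs" is "\<lambda>f g w. f w + g w" .
lift_definition minus_ncs :: "ncs \<Rightarrow> ncs \<Rightarrow> ncs" is "\<lambda>f g w. f w - g w" .
lift_definition uminus_ncs :: "ncs \<Rightarrow> ncs" is "\<lambda>f w. - f w" .
lift_definition times_ncs :: "ncs \<Rightarrow> ncs \<Rightarrow> ncs" is conv .
instance
proof
  fix a b c :: ncs
  show "a * b * c = a * (b * c)" by transfer (rule ext, rule conv_assoc)
  show "1 * a = a" by transfer (rule ext, rule conv_unit_left)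
  show "a * 1 = a" by transfer (rule ext, rule conv_unit_right)
  show "(a + b) * c = a * c + b * c" by transfer (rule ext, rule conv_add_left)
  show "a * (b + c) = a * b + a * c" by transfer (rule ext, rule conv_add_right)
  show "(0::ncs) \<noteq> 1" by transfer (metis zero_neq_one)
qed (transfer; auto)+
end

lemma coeff_simps [simp]:
  "coeff 0 w = 0" "coeff 1 w = (if w = [] then 1 else 0)"
  "coeff (f + g) w = coeff f w + coeff g w" "coeff (f - g) w = coeff f w - coeff g w"
  "coeff (- f) w = - coeff f w"
  by (transfer; simp)+

lemma coeff_mult: "coeff (f * g) w = conv (coeff f) (coeff g) w"
  by transfer simp

lemma coeff_mult_Nil [simp]: "coeff (f * g) [] = coeff f [] * coeff g []"
  by (simp add: coeff_mult)

lemma coeff_of_int_mult [simp]: "coeff (of_int c * f) w = c * coeff f w"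
proof -
  have nat: "coeff (of_nat m * g) w = int m * coeff g w" for m g
    by (induction m) (auto simp: algebra_simps)
  show ?thesis
    by (cases c) (auto simp: nat algebra_simps simp del: of_nat_Suc)
qed

lemma coeff_sum [simp]: "coeff (sum f A) w = (\<Sum>x\<in>A. coeff (f x) w)"
  by (induction A rule: infinite_finite_induct) auto

section \<open>Order of a series and homogeneous series\<close>

definition low :: "nat \<Rightarrow> ncs \<Rightarrow> bool" where
  "low d f \<longleftrightarrow> (\<forall>w. length w < d \<longrightarrow> coeff f w = 0)"

definition homogeneous :: "nat \<Rightarrow> ncs \<Rightarrow> bool" where
  "homogeneous d f \<longleftrightarrow> (\<forall>w. length w \<noteq> d \<longrightarrow> coeff f w = 0)"

lemma low_zero_order [simp]: "low 0 f" by (simp add: low_def)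
lemma low_0 [simp]: "low d 0" by (simp add: low_def)
lemma low_add: "low d f \<Longrightarrow> low d g \<Longrightarrow> low d (f + g)" by (simp add: low_def)
lemma low_diff: "low d f \<Longrightarrow> low d g \<Longrightarrow> low d (f - g)" by (simp add: low_def)
lemma low_minus: "low d f \<Longrightarrow> low d (- f)" by (simp add: low_def)
lemma low_mono: "low d f \<Longrightarrow> e \<le> d \<Longrightarrow> low e f" by (simp add: low_def)

lemma low_mult: "low a f \<Longrightarrow> low b g \<Longrightarrow> low (a + b) (f * g)"
  unfolding low_def coeff_mult using conv_low by blast

lemma low_mult_left: "low b g \<Longrightarrow> low b (f * g)"
  using low_mult[of 0 f b g] by simp

lemma low_mult_right: "low a f \<Longrightarrow> low a (f * g)"
  using low_mult[of a f 0 g] by simp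

lemma homogeneous_low: "homogeneous d f \<Longrightarrow> low d f"
  by (simp add: low_def homogeneous_def)

lemma homogeneous_mult: "homogeneous a f \<Longrightarrow> homogeneous b g \<Longrightarrow> homogeneous (a + b) (f * g)"
  unfolding homogeneous_def coeff_mult using conv_homogeneous by blast

lemma homogeneous_diff: "homogeneous d f \<Longrightarrow> homogeneous d g \<Longrightarrow> homogeneous d (f - g)"
  by (simp add: homogeneous_def)

lemma homogeneous_low_imp_0: "homogeneous d f \<Longrightarrow> low (Suc d) f \<Longrightarrow> f = 0"
  by (rule ncs_eqI) (metis coeff_simps(1) homogeneous_def lessI low_def)

definition ncs_var :: "nat \<Rightarrow> ncs" where
  "ncs_var k = NCS (\<lambda>w. if w = [k] then 1 else 0)"

text \<open>The alternating geometric series, inverse to \<open>1 + ncs_var k\<close>; it is the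
  Magnus image of the inverse of a generator.\<close>

definition ncs_geom :: "nat \<Rightarrow> ncs" where
  "ncs_geom k = NCS (\<lambda>w. if set w \<subseteq> {k} then (-1) ^ length w else 0)"

lemma coeff_var: "coeff (ncs_var k) w = (if w = [k] then 1 else 0)"
  by (simp add: ncs_var_def NCS_inverse)

lemma coeff_geom: "coeff (ncs_geom k) w = (if set w \<subseteq> {k} then (-1) ^ length w else 0)"
  by (simp add: ncs_geom_def NCS_inverse)

lemma coeff_var_mult_Cons: "coeff (ncs_var k * f) (a # w) = (if a = k then coeff f w else 0)"
proof -
  have "(\<lambda>v. coeff (ncs_var k) (a # v)) = (if a = k then (\<lambda>v. if v = [] then 1 else 0) else (\<lambda>v. 0))"
    by (auto simp: coeff_var)
  then show ?thesis
    by (simp add: coeff_mult conv_unit_left conv_zero_left) (simp add: coeff_var)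
qed

lemma conv_var_right:
  "conv f (coeff (ncs_var k)) (w @ [a]) = (if a = k then f w else 0)"
proof (induction w arbitrary: f)
  case Nil
  then show ?case by (auto simp: coeff_var)
next
  case (Cons b w)
  then show ?case by (auto simp: coeff_var)
qed

lemma coeff_mult_var_snoc: "coeff (f * ncs_var k) (w @ [a]) = (if a = k then coeff f w else 0)"
  by (simp add: coeff_mult conv_var_right)

lemma homogeneous_var: "homogeneous 1 (ncs_var k)"
  by (simp add: homogeneous_def coeff_var)

lemma var_mult_geom: "(1 + ncs_var k) * ncs_geom k = 1"
proof (rule ncs_eqI)
  fix w show "coeff ((1 + ncs_var k) * ncs_geom k) w = coeff 1 w"
    by (cases w) (auto simp: distrib_right coeff_var_mult_Cons coeff_geom, simp_all add: coeff_var)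
qed

lemma geom_mult_var: "ncs_geom k * (1 + ncs_var k) = 1"
proof (rule ncs_eqI)
  fix w show "coeff (ncs_geom k * (1 + ncs_var k)) w = coeff 1 w"
    by (cases w rule: rev_cases) (auto simp: distrib_left coeff_mult_var_snoc coeff_geom, simp_all add: coeff_var)
qed

section \<open>Free groups\<close>

abbreviation flip :: "fletter \<Rightarrow> fletter" where "flip a \<equiv> (fst a, \<not> snd a)"

lemma cancels_iff: "cancels a b \<longleftrightarrow> b = flip a"
  by (cases a, cases b) (auto simp: cancels_def)

lemma reduced_tl: "reduced (a # w) \<Longrightarrow> reduced w"
  by (cases w) auto

lemma reduced_push: "reduced w \<Longrightarrow> reduced (push_letter a w)"
  by (cases w) (auto dest: reduced_tl)

lemma reduced_foldr_push: "reduced v \<Longrightarrow> reduced (foldr push_letter w v)"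
  by (induction w) (auto intro: reduced_push)

lemma reduced_normalize: "reduced (normalize w)"
  by (simp add: normalize_def reduced_foldr_push)

lemma normalize_reduced: "reduced w \<Longrightarrow> normalize w = w"
proof (induction w)
  case (Cons a w)
  then have "normalize w = w" by (auto dest: reduced_tl)
  then show ?case using Cons.prems by (cases w) (auto simp: normalize_def)
qed (simp add: normalize_def)

text \<open>If \<open>b\<close> cancels the first letter \<open>c\<close> of \<open>w\<close>, then
  \<open>c = a\<close>; since \<open>w\<close> is reduced, \<open>a\<close> does not cancel against
  the letter after \<open>c\<close>, and pushing it restores \<open>w\<close>.\<close>

lemma push_push_cancel:
  assumes "reduced w" "cancels a b"
  shows "push_letter a (push_letter b w) = w"
proof (cases w)
  case (Cons c w')
  show ?thesis
  proof (cases "cancels b c")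
    case True
    then have "a = c" using assms(2) by (auto simp: cancels_iff)
    then show ?thesis using True Cons assms(1) by (cases w') auto
  next
    case False
    then show ?thesis using assms(2) Cons by simp
  qed
qed (use assms in simp)

lemma foldr_push_push:
  assumes "reduced v"
  shows "foldr push_letter (push_letter a u) v = push_letter a (foldr push_letter u v)"
proof (cases u)
  case (Cons b u')
  then show ?thesis
    using push_push_cancel[OF reduced_foldr_push[OF assms], of a b] by auto
qed simp

text \<open>Letters act on reduced words by \<open>push_letter\<close>, opposite letters as inverse
  maps (van der Waerden's construction). The action of a word therefore depends only on its normal
  form, and associativity of the product follows.\<close>

lemma foldr_push_normalize:
  "reduced v \<Longrightarrow> foldr push_letter (normalize u) v = foldr push_letter u v"
  by (induction u) (simp_all add: normalize_def foldr_push_push)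

lemma normalize_append: "normalize (u @ v) = foldr push_letter u (normalize v)"
  by (simp add: normalize_def)

lemma normalize_append_left: "normalize (normalize u @ v) = normalize (u @ v)"
  by (simp add: normalize_append foldr_push_normalize reduced_normalize)

lemma normalize_append_right: "normalize (u @ normalize v) = normalize (u @ v)"
  by (simp add: normalize_append normalize_reduced reduced_normalize)

lemma foldr_push_flip:
  "reduced v \<Longrightarrow> foldr push_letter (map flip (rev w)) (foldr push_letter w v) = v"
proof (induction w)
  case (Cons a w)
  have "push_letter (flip a) (push_letter a (foldr push_letter w v)) = foldr push_letter w v"
    using Cons.prems by (intro push_push_cancel reduced_foldr_push) (auto simp: cancels_iff)
  then show ?case using Cons by simp
qed simp

lemma set_push: "set (push_letter a w) \<subseteq> insert a (set w)"
  by (cases w) auto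

lemma set_normalize: "set (normalize w) \<subseteq> set w"
proof (induction w)
  case (Cons a w)
  then show ?case using set_push[of a "normalize w"] by (auto simp: normalize_def)
qed (simp add: normalize_def)

lemma carrier_free_group: "carrier (free_group n) = {w. set w \<subseteq> {1..n} \<times> UNIV \<and> reduced w}"
  by (simp add: free_group_def)

lemma mult_free_group: "u \<otimes>\<^bsub>free_group n\<^esub> v = normalize (u @ v)"
  by (simp add: free_group_def)

lemma one_free_group: "\<one>\<^bsub>free_group n\<^esub> = []"
  by (simp add: free_group_def)

lemma normalize_in_free_group:
  "set w \<subseteq> {1..n} \<times> UNIV \<Longrightarrow> normalize w \<in> carrier (free_group n)"
  using set_normalize[of w] by (auto simp: carrier_free_group reduced_normalize)

lemma group_free_group: "group (free_group n)"
proof (rule groupI)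
  fix x y assume "x \<in> carrier (free_group n)" "y \<in> carrier (free_group n)"
  then show "x \<otimes>\<^bsub>free_group n\<^esub> y \<in> carrier (free_group n)"
    unfolding mult_free_group by (intro normalize_in_free_group) (auto simp: carrier_free_group)
next
  fix x assume x: "x \<in> carrier (free_group n)"
  show "\<exists>y\<in>carrier (free_group n). y \<otimes>\<^bsub>free_group n\<^esub> x = \<one>\<^bsub>free_group n\<^esub>"
  proof (rule bexI)
    have "normalize (map flip (rev x) @ x) = foldr push_letter (map flip (rev x)) (foldr push_letter x [])"
      by (simp add: normalize_def)
    also have "\<dots> = []" by (rule foldr_push_flip) simp
    finally show "normalize (map flip (rev x)) \<otimes>\<^bsub>free_group n\<^esub> x = \<one>\<^bsub>free_group n\<^esub>"
      by (simp add: mult_free_group one_free_group normalize_append_left)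
    show "normalize (map flip (rev x)) \<in> carrier (free_group n)"
      using x by (intro normalize_in_free_group) (auto simp: carrier_free_group)
  qed
qed (auto simp: carrier_free_group mult_free_group one_free_group normalize_append_left
    normalize_append_right normalize_reduced)

lemma fgen_closed: "k \<in> {1..n} \<Longrightarrow> fgen k \<in> carrier (free_group n)"
  by (auto simp: fgen_def carrier_free_group)

lemma inv_fgen:
  assumes "k \<in> {1..n}" shows "inv\<^bsub>free_group n\<^esub> (fgen k) = [(k, False)]"
proof (rule group.inv_equality[OF group_free_group])
  show "[(k, False)] \<otimes>\<^bsub>free_group n\<^esub> fgen k = \<one>\<^bsub>free_group n\<^esub>"
    by (simp add: mult_free_group one_free_group fgen_def normalize_def cancels_def)
qed (use assms in \<open>auto simp: fgen_def carrier_free_group\<close>)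

text \<open>In a reduced word, prepending the first letter to the rest is already the group product
  with a generator or its inverse, so induction on the list is enough.\<close>

lemma free_group_induct [consumes 1, case_names one gen inv]:
  assumes "g \<in> carrier (free_group n)"
    and "P \<one>\<^bsub>free_group n\<^esub>"
    and gen: "\<And>k g. k \<in> {1..n} \<Longrightarrow> g \<in> carrier (free_group n) \<Longrightarrow> P g \<Longrightarrow>
      P (fgen k \<otimes>\<^bsub>free_group n\<^esub> g)"
    and inv: "\<And>k g. k \<in> {1..n} \<Longrightarrow> g \<in> carrier (free_group n) \<Longrightarrow> P g \<Longrightarrow>
      P (inv\<^bsub>free_group n\<^esub> (fgen k) \<otimes>\<^bsub>free_group n\<^esub> g)"
  shows "P g"
  using assms(1)
proof (induction g)
  case Nil
  then show ?case using assms(2) by (simp add: one_free_group)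
next
  case (Cons a w)
  obtain k b where a: "a = (k, b)" by (cases a)
  have k: "k \<in> {1..n}" and w: "w \<in> carrier (free_group n)" and red: "normalize (a # w) = a # w"
    using Cons.prems normalize_reduced[of "a # w"] by (auto simp: carrier_free_group a dest: reduced_tl)
  have "fgen k \<otimes>\<^bsub>free_group n\<^esub> w = a # w" if b
    using red that by (simp add: mult_free_group a fgen_def)
  moreover have "inv\<^bsub>free_group n\<^esub> (fgen k) \<otimes>\<^bsub>free_group n\<^esub> w = a # w" if "\<not> b"
    using red that by (simp add: inv_fgen[OF k] mult_free_group a)
  ultimately show ?case using gen[OF k w Cons.IH[OF w]] inv[OF k w Cons.IH[OF w]] by (cases b) simp_all
qed

section \<open>Evaluation of words and the universal property\<close>

context group begin

abbreviation letter_eval :: "(nat \<Rightarrow> 'a) \<Rightarrow> fletter \<Rightarrow> 'a" where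
  "letter_eval f a \<equiv> (if snd a then f (fst a) else inv (f (fst a)))"

lemma word_eval_Nil: "word_eval G f [] = \<one>"
  by (simp add: word_eval_def)

lemma word_eval_Cons: "word_eval G f (a # w) = letter_eval f a \<otimes> word_eval G f w"
  by (cases a) (simp add: word_eval_def)

lemma word_eval_closed:
  "set w \<subseteq> {1..n} \<times> UNIV \<Longrightarrow> (\<And>k. k \<in> {1..n} \<Longrightarrow> f k \<in> carrier G) \<Longrightarrow>
    word_eval G f w \<in> carrier G"
  by (induction w) (auto simp: word_eval_Nil word_eval_Cons)

lemma word_eval_append:
  assumes "set u \<subseteq> {1..n} \<times> UNIV" "set v \<subseteq> {1..n} \<times> UNIV" "\<And>k. k \<in> {1..n} \<Longrightarrow> f k \<in> carrier G"
  shows "word_eval G f (u @ v) = word_eval G f u \<otimes> word_eval G f v"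
  using assms(1)
proof (induction u)
  case Nil
  then show ?case using word_eval_closed[OF assms(2,3)] by (simp add: word_eval_Nil)
next
  case (Cons a u)
  then have "letter_eval f a \<in> carrier G" "word_eval G f u \<in> carrier G"
    using assms(3) word_eval_closed[of u n f] by auto
  then show ?case using Cons word_eval_closed[OF assms(2,3)]
    by (simp add: word_eval_Cons m_assoc del: if_split) 
qed

lemma word_eval_push:
  assumes "set (a # w) \<subseteq> {1..n} \<times> UNIV" "\<And>k. k \<in> {1..n} \<Longrightarrow> f k \<in> carrier G"
  shows "word_eval G f (push_letter a w) = letter_eval f a \<otimes> word_eval G f w"
proof (cases w)
  case (Cons b w')
  have a: "f (fst a) \<in> carrier G" and w': "word_eval G f w' \<in> carrier G"
    using assms Cons word_eval_closed[of w' n f] by auto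
  show ?thesis
  proof (cases "cancels a b")
    case True
    then show ?thesis using a w'
      by (auto simp: Cons cancels_iff word_eval_Cons m_assoc[symmetric])
  qed (simp add: Cons word_eval_Cons)
qed (simp add: word_eval_Cons)

lemma word_eval_normalize:
  assumes "set w \<subseteq> {1..n} \<times> UNIV" "\<And>k. k \<in> {1..n} \<Longrightarrow> f k \<in> carrier G"
  shows "word_eval G f (normalize w) = word_eval G f w"
  using assms(1)
proof (induction w)
  case (Cons a w)
  have "set (a # normalize w) \<subseteq> {1..n} \<times> UNIV"
    using Cons.prems set_normalize[of w] by auto
  from word_eval_push[OF this assms(2)] Cons show ?case
    by (simp add: normalize_def word_eval_Cons)
qed (simp add: normalize_def)

text \<open>The existence half of the universal property; uniqueness is
  \<open>free_group_hom_eq\<close>.\<close>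

lemma word_eval_hom:
  assumes "\<And>k. k \<in> {1..n} \<Longrightarrow> f k \<in> carrier G"
  shows "word_eval G f \<in> hom (free_group n) G"
proof (rule homI)
  fix x y assume "x \<in> carrier (free_group n)" "y \<in> carrier (free_group n)"
  then show "word_eval G f (x \<otimes>\<^bsub>free_group n\<^esub> y) = word_eval G f x \<otimes> word_eval G f y"
    using assms word_eval_normalize[of "x @ y" n f] word_eval_append[of x n y f]
    by (auto simp: mult_free_group carrier_free_group)
next
  fix x assume "x \<in> carrier (free_group n)"
  then show "word_eval G f x \<in> carrier G"
    using assms word_eval_closed[of x n f] by (simp add: carrier_free_group)
qed

lemma word_eval_fgen: "f k \<in> carrier G \<Longrightarrow> word_eval G f (fgen k) = f k"
  by (simp add: fgen_def word_eval_def)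

end

lemma free_group_hom_eq:
  assumes "group G" "h \<in> hom (free_group n) G" "h' \<in> hom (free_group n) G"
    and eq: "\<And>k. k \<in> {1..n} \<Longrightarrow> h (fgen k) = h' (fgen k)"
    and "g \<in> carrier (free_group n)"
  shows "h g = h' g"
proof -
  interpret h: group_hom "free_group n" G h
    using assms group_free_group by (simp add: group_hom_def group_hom_axioms_def)
  interpret h': group_hom "free_group n" G h'
    using assms group_free_group by (simp add: group_hom_def group_hom_axioms_def)
  from assms(5) show ?thesis
    by (induction rule: free_group_induct) (auto simp: eq fgen_closed)
qed

section \<open>Lower central series\<close>

context group begin

lemma inv_mult_cancel: "a \<in> carrier G \<Longrightarrow> b \<in> carrier G \<Longrightarrow> inv a \<otimes> (a \<otimes> b) = b"
  by (simp add: m_assoc[symmetric])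

lemma mult_inv_cancel: "a \<in> carrier G \<Longrightarrow> b \<in> carrier G \<Longrightarrow> a \<otimes> (inv a \<otimes> b) = b"
  by (simp add: m_assoc[symmetric])

lemmas group_word_simps = m_assoc inv_mult_group inv_mult_cancel mult_inv_cancel

lemma gcomm_closed [simp]: "a \<in> carrier G \<Longrightarrow> b \<in> carrier G \<Longrightarrow> gcomm G a b \<in> carrier G"
  by (simp add: gcomm_def)

lemma inv_gcomm: "a \<in> carrier G \<Longrightarrow> b \<in> carrier G \<Longrightarrow> inv (gcomm G a b) = gcomm G b a"
  by (simp add: gcomm_def group_word_simps)

lemma gcomm_mult_left:
  "\<lbrakk>s \<in> carrier G; t \<in> carrier G; b \<in> carrier G\<rbrakk> \<Longrightarrow>
    gcomm G (s \<otimes> t) b = inv t \<otimes> gcomm G s b \<otimes> t \<otimes> gcomm G t b"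
  by (simp add: gcomm_def group_word_simps)

lemma gcomm_inv_left:
  "\<lbrakk>s \<in> carrier G; b \<in> carrier G\<rbrakk> \<Longrightarrow> gcomm G (inv s) b = s \<otimes> inv (gcomm G s b) \<otimes> inv s"
  by (simp add: gcomm_def group_word_simps)

lemma conj_gcomm:
  "\<lbrakk>a \<in> carrier G; b \<in> carrier G; g \<in> carrier G\<rbrakk> \<Longrightarrow>
    g \<otimes> gcomm G a b \<otimes> inv g = gcomm G (g \<otimes> a \<otimes> inv g) (g \<otimes> b \<otimes> inv g)"
  by (simp add: gcomm_def group_word_simps)

lemma hall_witt:
  "\<lbrakk>a \<in> carrier G; b \<in> carrier G; c \<in> carrier G\<rbrakk> \<Longrightarrow>
    (inv b \<otimes> gcomm G (gcomm G a (inv b)) c \<otimes> b) \<otimes>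
    (inv c \<otimes> gcomm G (gcomm G b (inv c)) a \<otimes> c) \<otimes>
    (inv a \<otimes> gcomm G (gcomm G c (inv a)) b \<otimes> a) = \<one>"
  by (simp add: gcomm_def group_word_simps)

lemma normal_closed:
  assumes "N \<lhd> G"
  shows "x \<in> N \<Longrightarrow> y \<in> N \<Longrightarrow> x \<otimes> y \<in> N" and "x \<in> N \<Longrightarrow> inv x \<in> N" and "\<one> \<in> N"
    and "x \<in> N \<Longrightarrow> x \<in> carrier G"
    and "g \<in> carrier G \<Longrightarrow> x \<in> N \<Longrightarrow> inv g \<otimes> x \<otimes> g \<in> N"
    and "g \<in> carrier G \<Longrightarrow> x \<in> N \<Longrightarrow> g \<otimes> x \<otimes> inv g \<in> N"
  using assms normal_imp_subgroup[OF assms]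
  by (auto simp: subgroup.m_closed subgroup.m_inv_closed subgroup.one_closed
      normal.inv_op_closed1 normal.inv_op_closed2 dest: subgroup.mem_carrier)

text \<open>The elements that commute with \<open>b\<close> modulo the normal subgroup
  \<open>N\<close> are closed under products and inverses, so it suffices to test
  generators.\<close>

lemma gcomm_generate_left:
  assumes N: "N \<lhd> G" and S: "S \<subseteq> carrier G" and b: "b \<in> carrier G"
    and gens: "\<And>s. s \<in> S \<Longrightarrow> gcomm G s b \<in> N" and t: "t \<in> generate G S"
  shows "gcomm G t b \<in> N"
  using t
proof (induction rule: generate.induct)
  case one
  then show ?case using b normal_closed(3)[OF N] by (simp add: gcomm_def)
next
  case (incl h)
  then show ?case by (rule gens)
next
  case (inv h)
  have "h \<in> carrier G" using inv S by auto
  then show ?case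
    using gens[OF inv] normal_closed[OF N] b by (simp add: gcomm_inv_left)
next
  case (eng h1 h2)
  have "h1 \<in> carrier G" "h2 \<in> carrier G" using eng generate_in_carrier[OF S] by auto
  then show ?case
    using eng.IH normal_closed[OF N] b by (simp add: gcomm_mult_left)
qed

lemma lcs_Suc:
  "k \<ge> 1 \<Longrightarrow> lcs G (Suc k) = generate G {gcomm G a b | a b. a \<in> lcs G k \<and> b \<in> carrier G}"
  by (cases k) auto

lemma lcs_normal: "lcs G k \<lhd> G"
proof (induction k)
  case 0
  show ?case by (simp add: normal_self)
next
  case (Suc k)
  show ?case
  proof (cases "k = 0")
    case False
    show ?thesis
    proof (subst lcs_Suc)
      show "generate G {gcomm G a b |a b. a \<in> lcs G k \<and> b \<in> carrier G} \<lhd> G"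
      proof (rule normal_generateI)
        show "{gcomm G a b |a b. a \<in> lcs G k \<and> b \<in> carrier G} \<subseteq> carrier G"
          using normal_closed[OF Suc.IH] by auto
      next
        fix h g assume h: "h \<in> {gcomm G a b |a b. a \<in> lcs G k \<and> b \<in> carrier G}" and g: "g \<in> carrier G"
        then obtain a b where ab: "h = gcomm G a b" "a \<in> lcs G k" "b \<in> carrier G" by blast
        then have "g \<otimes> h \<otimes> inv g = gcomm G (g \<otimes> a \<otimes> inv g) (g \<otimes> b \<otimes> inv g)"
          using g normal_closed[OF Suc.IH] by (simp add: conj_gcomm)
        moreover have "g \<otimes> a \<otimes> inv g \<in> lcs G k" "g \<otimes> b \<otimes> inv g \<in> carrier G"
          using ab g normal_closed[OF Suc.IH] by auto
        ultimately show "g \<otimes> h \<otimes> inv g \<in> {gcomm G a b |a b. a \<in> lcs G k \<and> b \<in> carrier G}"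
          by blast
      qed
    qed (use False in simp)
  qed (simp add: normal_self)
qed

lemmas lcs_closed = normal_closed[OF lcs_normal]

lemma gcomm_lcs: "k \<ge> 1 \<Longrightarrow> a \<in> lcs G k \<Longrightarrow> b \<in> carrier G \<Longrightarrow> gcomm G a b \<in> lcs G (Suc k)"
  by (auto simp: lcs_Suc intro: generate.incl)

lemma lcs_Suc_subset: "lcs G (Suc k) \<subseteq> lcs G k"
proof (cases "k = 0")
  case False
  have "gcomm G a b \<in> lcs G k" if "a \<in> lcs G k" "b \<in> carrier G" for a b
  proof -
    have "gcomm G a b = inv a \<otimes> (inv b \<otimes> a \<otimes> b)"
      using that lcs_closed(4)[of a] by (simp add: gcomm_def group_word_simps)
    then show ?thesis using that lcs_closed by metis
  qed
  then have "generate G {gcomm G a b | a b. a \<in> lcs G k \<and> b \<in> carrier G} \<subseteq> lcs G k"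
    by (intro generate_subgroup_incl normal_imp_subgroup[OF lcs_normal]) auto
  then show ?thesis using False by (simp add: lcs_Suc)
qed simp

lemma lcs_antimono: "i \<le> j \<Longrightarrow> lcs G j \<subseteq> lcs G i"
  using lcs_Suc_subset by (rule lift_Suc_antimono_le)

text \<open>The three subgroup argument: the Hall-Witt identity bounds one triple commutator by two
  others whose depth is known from smaller \<open>j\<close>.\<close>

lemma gcomm_lcs_lcs:
  assumes "i \<ge> 1" "j \<ge> 1" "a \<in> lcs G i" "b \<in> lcs G j"
  shows "gcomm G a b \<in> lcs G (i + j)"
  using assms(2,1,3,4)
proof (induction j arbitrary: i a b rule: dec_induct)
  case base
  then show ?case by (simp add: gcomm_lcs)
next
  case (step j)
  let ?N = "lcs G (i + Suc j)"
  have a: "a \<in> carrier G" using step.prems lcs_closed(4) by blast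
  have gens: "gcomm G (gcomm G c x) a \<in> ?N" if c: "c \<in> lcs G j" and x: "x \<in> carrier G" for c x
  proof -
    have cG: "c \<in> carrier G" using c lcs_closed(4) by blast
    note closed = a x cG
    let ?p = "gcomm G (gcomm G c x) a"
    have "gcomm G (inv a) (inv x) \<in> lcs G (Suc i)"
      using step.prems closed lcs_closed by (intro gcomm_lcs) auto
    then have "inv (gcomm G (inv a) (inv x)) \<in> lcs G (Suc i)"
      using lcs_closed by blast
    then have "gcomm G (inv x) (inv a) \<in> lcs G (Suc i)"
      using closed by (simp add: inv_gcomm)
    \<comment> \<open>The induction hypothesis is applied at \<open>Suc i\<close>: one unit of depth
      has moved from the right entry to the left one, hence the generalisation over
      \<open>i\<close>.\<close>
    then have q: "gcomm G (gcomm G (inv x) (inv a)) c \<in> ?N"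
      using step.IH[of "Suc i" _ c] c by simp
    have "gcomm G a (inv c) \<in> lcs G (i + j)"
      using step.prems c by (intro step.IH) (auto intro: lcs_closed(2))
    then have r: "gcomm G (gcomm G a (inv c)) (inv x) \<in> ?N"
      using step.hyps closed gcomm_lcs[of "i + j" _ "inv x"] by simp
    let ?q = "inv a \<otimes> gcomm G (gcomm G (inv x) (inv a)) c \<otimes> a"
    let ?r = "inv c \<otimes> gcomm G (gcomm G a (inv c)) (inv x) \<otimes> c"
    have qr: "?q \<otimes> ?r \<in> ?N"
      using q r closed by (intro lcs_closed(1) lcs_closed(5))
    \<comment> \<open>Hall-Witt at \<open>c\<close>, \<open>inv x\<close>, \<open>a\<close>. Two of
      its three factors lie in \<open>?N\<close>, hence so does the third, which is a conjugate of
      \<open>?p\<close>.\<close>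
    have "(x \<otimes> ?p \<otimes> inv x) \<otimes> (?q \<otimes> ?r) = \<one>"
      using hall_witt[of c "inv x" a] closed by (simp add: m_assoc)
    then have "x \<otimes> ?p \<otimes> inv x = inv (?q \<otimes> ?r)"
      using closed by (intro inv_equality[symmetric]) auto
    then have "x \<otimes> ?p \<otimes> inv x \<in> ?N" using qr lcs_closed(2) by metis
    then have "inv x \<otimes> (x \<otimes> ?p \<otimes> inv x) \<otimes> x \<in> ?N" using x lcs_closed(5) by blast
    moreover have "inv x \<otimes> (x \<otimes> ?p \<otimes> inv x) \<otimes> x = ?p"
      using closed by (simp add: group_word_simps)
    ultimately show ?thesis by simp
  qed
  \<comment> \<open>The entry that is a product of commutators is \<open>b\<close>; the reversed
    commutator puts it on the left, where \<open>gcomm_generate_left\<close> applies.\<close>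
  have "gcomm G b a \<in> ?N"
  proof (rule gcomm_generate_left[OF lcs_normal _ a])
    show "b \<in> generate G {gcomm G c x |c x. c \<in> lcs G j \<and> x \<in> carrier G}"
      using step by (simp add: lcs_Suc)
    show "{gcomm G c x |c x. c \<in> lcs G j \<and> x \<in> carrier G} \<subseteq> carrier G"
      using lcs_closed(4) by fastforce
  qed (use gens in auto)
  then have "inv (gcomm G b a) \<in> ?N" using lcs_closed by blast
  then show ?case using a step.prems lcs_closed(4)[of b] by (simp add: inv_gcomm)
qed

text \<open>Modulo \<open>N\<close>, the map \<open>\<phi>\<close> and the identity are
  homomorphisms into the quotient, and two homomorphisms agree on the subgroup generated by any set
  where they agree.\<close>

lemma displacement_generate:
  assumes N: "N \<lhd> G" and phi: "\<phi> \<in> hom G G" and S: "S \<subseteq> carrier G"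
    and gens: "\<And>s. s \<in> S \<Longrightarrow> inv s \<otimes> \<phi> s \<in> N" and g: "g \<in> generate G S"
  shows "inv g \<otimes> \<phi> g \<in> N"
proof -
  interpret phi: group_hom G G \<phi>
    using phi by (simp add: group_hom_def group_hom_axioms_def is_group)
  show ?thesis using g
  proof (induction rule: generate.induct)
    case one
    then show ?case using normal_closed(3)[OF N] by simp
  next
    case (incl h)
    then show ?case by (rule gens)
  next
    case (inv h)
    then have h: "h \<in> carrier G" using S by auto
    have "inv (inv h) \<otimes> \<phi> (inv h) = h \<otimes> inv (inv h \<otimes> \<phi> h) \<otimes> inv h"
      using h by (simp add: group_word_simps)
    then show ?case using gens[OF inv] h normal_closed[OF N] by metis
  next
    case (eng h1 h2)
    then have h: "h1 \<in> carrier G" "h2 \<in> carrier G" using generate_in_carrier[OF S] by auto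
    then have "inv (h1 \<otimes> h2) \<otimes> \<phi> (h1 \<otimes> h2) =
        (inv h2 \<otimes> (inv h1 \<otimes> \<phi> h1) \<otimes> h2) \<otimes> (inv h2 \<otimes> \<phi> h2)"
      by (simp add: group_word_simps)
    then show ?case using eng.IH h normal_closed[OF N] by metis
  qed
qed

text \<open>In a commutator of \<open>a\<close> and \<open>h\<close>, the entry \<open>a\<close> is
  perturbed by some \<open>t\<close> of depth \<open>i + j\<close> (induction) and \<open>h\<close>
  by some \<open>s\<close> of depth \<open>i + 1\<close>. Every effect of a perturbation is a
  commutator of depth at least \<open>i + j + 1\<close>.\<close>

lemma displacement_lcs:
  assumes phi: "\<phi> \<in> hom G G" and disp: "\<And>g. g \<in> carrier G \<Longrightarrow> inv g \<otimes> \<phi> g \<in> lcs G (Suc i)"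
    and "j \<ge> 1" "g \<in> lcs G j"
  shows "inv g \<otimes> \<phi> g \<in> lcs G (i + j)"
  using assms(3,4)
proof (induction j arbitrary: g rule: dec_induct)
  case base
  then show ?case using disp by simp
next
  case (step j)
  interpret phi: group_hom G G \<phi>
    using phi by (simp add: group_hom_def group_hom_axioms_def is_group)
  show ?case
  proof (rule displacement_generate[OF lcs_normal phi])
    show "g \<in> generate G {gcomm G a b |a b. a \<in> lcs G j \<and> b \<in> carrier G}"
      using step by (simp add: lcs_Suc)
    show "{gcomm G a b |a b. a \<in> lcs G j \<and> b \<in> carrier G} \<subseteq> carrier G"
      using lcs_closed(4) by fastforce
  next
    fix u assume "u \<in> {gcomm G a b |a b. a \<in> lcs G j \<and> b \<in> carrier G}"
    then obtain a h where u: "u = gcomm G a h" and a: "a \<in> lcs G j" and h: "h \<in> carrier G" by blast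
    have aG: "a \<in> carrier G" using a lcs_closed(4) by blast
    define t where "t = inv a \<otimes> \<phi> a"
    define s where "s = inv h \<otimes> \<phi> h"
    have t: "t \<in> lcs G (i + j)" unfolding t_def by (rule step.IH[OF a])
    have s: "s \<in> lcs G (Suc i)" unfolding s_def by (rule disp[OF h])
    have closed: "a \<in> carrier G" "h \<in> carrier G" "t \<in> carrier G" "s \<in> carrier G" "u \<in> carrier G"
      using aG h by (auto simp: t_def s_def u)
    have pa: "\<phi> a = a \<otimes> t" and ph: "\<phi> h = h \<otimes> s"
      using aG h by (auto simp: t_def s_def mult_inv_cancel)
    have "\<phi> u = gcomm G (a \<otimes> t) (h \<otimes> s)"
      using closed by (simp add: u gcomm_def pa ph)
    \<comment> \<open>The displacement of \<open>u\<close> factors into a conjugate of one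
      commutator and two further commutators, each with an entry built from \<open>s\<close> or
      \<open>t\<close>; their depths are bounded one by one below.\<close>
    then have eq: "inv u \<otimes> \<phi> u =
        (inv (t \<otimes> u) \<otimes> gcomm G a s \<otimes> (t \<otimes> u)) \<otimes> gcomm G u (s \<otimes> t) \<otimes> gcomm G t (h \<otimes> s)"
      using closed unfolding u by (simp add: gcomm_def group_word_simps)
    have 1: "gcomm G a s \<in> lcs G (i + Suc j)"
      using gcomm_lcs_lcs[OF _ _ a s] step by (simp add: add.commute)
    have "u \<in> lcs G (Suc j)" using a h step by (simp add: u gcomm_lcs)
    moreover have "s \<otimes> t \<in> lcs G (Suc i)"
      using s t lcs_antimono[of "Suc i" "i + j"] step by (intro lcs_closed) auto
    ultimately have "gcomm G u (s \<otimes> t) \<in> lcs G (Suc j + Suc i)"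
      by (intro gcomm_lcs_lcs) auto
    then have 2: "gcomm G u (s \<otimes> t) \<in> lcs G (i + Suc j)"
      using lcs_antimono[of "i + Suc j" "Suc j + Suc i"] by auto
    have 3: "gcomm G t (h \<otimes> s) \<in> lcs G (i + Suc j)"
      using gcomm_lcs[of "i + j" t "h \<otimes> s"] t closed step by simp
    show "inv u \<otimes> \<phi> u \<in> lcs G (i + Suc j)"
      unfolding eq using 1 2 3 closed lcs_closed by auto
  qed
qed

end

lemma (in group_hom) hom_gcomm:
  "a \<in> carrier G \<Longrightarrow> b \<in> carrier G \<Longrightarrow> h (gcomm G a b) = gcomm H (h a) (h b)"
  by (simp add: gcomm_def)

lemma (in group_hom) hom_lcs: "g \<in> lcs G k \<Longrightarrow> h g \<in> lcs H k"
proof (induction k arbitrary: g)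
  case (Suc k)
  show ?case
  proof (cases "k = 0")
    case True
    then show ?thesis using Suc.prems by simp
  next
    case False
    let ?S = "{gcomm G a b |a b. a \<in> lcs G k \<and> b \<in> carrier G}"
    have S: "?S \<subseteq> carrier G" using G.lcs_closed(4) by fastforce
    have "g \<in> generate G ?S" using Suc.prems False by (simp add: G.lcs_Suc)
    then have "h g \<in> generate H (h ` ?S)" using generate_img[OF S] by blast
    moreover have "h ` ?S \<subseteq> {gcomm H a b |a b. a \<in> lcs H k \<and> b \<in> carrier H}"
      using Suc.IH G.lcs_closed(4) by (fastforce simp: hom_gcomm)
    ultimately have "h g \<in> generate H {gcomm H a b |a b. a \<in> lcs H k \<and> b \<in> carrier H}"
      using H.mono_generate by blast
    then show ?thesis using False by (simp add: H.lcs_Suc)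
  qed
qed simp

section \<open>Elimination in free associative algebras\<close>

definition word_prod :: "('i \<Rightarrow> 'a::ring_1) \<Rightarrow> 'i list \<Rightarrow> 'a" where
  "word_prod u W = prod_list (map u W)"

definition words :: "'i set \<Rightarrow> ('i \<Rightarrow> nat) \<Rightarrow> nat \<Rightarrow> 'i list set" where
  "words X w d = {W. set W \<subseteq> X \<and> sum_list (map w W) \<le> d}"

text \<open>The truncated form of free generation of an associative algebra: only monomials of
  weight at most \<open>d\<close> are tested, with integer coefficients.\<close>

definition words_independent :: "'i set \<Rightarrow> ('i \<Rightarrow> nat) \<Rightarrow> ('i \<Rightarrow> 'a::ring_1) \<Rightarrow> nat \<Rightarrow> bool" where
  "words_independent X w u d \<longleftrightarrow>
    (\<forall>S c. finite S \<and> S \<subseteq> words X w d \<and> (\<Sum>W\<in>S. of_int (c W) * word_prod u W) = 0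
      \<longrightarrow> (\<forall>W\<in>S. c W = 0))"

lemma words_independentD:
  "\<lbrakk>words_independent X w u d; finite S; S \<subseteq> words X w d;
    (\<Sum>W\<in>S. of_int (c W) * word_prod u W) = 0; W \<in> S\<rbrakk> \<Longrightarrow> c W = 0"
  unfolding words_independent_def by blast

text \<open>Combinations are kept formal, as lists with possible repetitions, because the argument
  by leading words must know which words occur and not only the value of the sum.\<close>

definition lin_eval :: "('i \<Rightarrow> 'a::ring_1) \<Rightarrow> (int \<times> 'i list) list \<Rightarrow> 'a" where
  "lin_eval u L = sum_list (map (\<lambda>(c, V). of_int c * word_prod u V) L)"

definition lin_coeff :: "(int \<times> 'i list) list \<Rightarrow> 'i list \<Rightarrow> int" where
  "lin_coeff L V = sum_list (map (\<lambda>(c, V'). if V' = V then c else 0) L)"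

definition lin_mult :: "(int \<times> 'i list) list \<Rightarrow> (int \<times> 'i list) list \<Rightarrow> (int \<times> 'i list) list" where
  "lin_mult L M = concat (map (\<lambda>(c, V). map (\<lambda>(c', V'). (c * c', V @ V')) M) L)"

lemma word_prod_append: "word_prod u (V @ W) = word_prod u V * word_prod u W"
  by (simp add: word_prod_def)

lemma lin_eval_simps [simp]:
  "lin_eval u [] = 0" "lin_eval u ((c, V) # L) = of_int c * word_prod u V + lin_eval u L"
  "lin_eval u (L @ M) = lin_eval u L + lin_eval u M"
  by (simp_all add: lin_eval_def)

lemma lin_eval_mult: "lin_eval u (lin_mult L M) = lin_eval u L * lin_eval u M"
proof (induction L)
  case (Cons p L)
  obtain c V where p: "p = (c, V)" by (cases p)
  have "lin_eval u (map (\<lambda>(c', V'). (c * c', V @ V')) M) = of_int c * word_prod u V * lin_eval u M"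
  proof (induction M)
    case (Cons q M)
    obtain c' V' where q: "q = (c', V')" by (cases q)
    have "of_int c * word_prod u V * (of_int c' * word_prod u V') =
        of_int (c * c') * word_prod u (V @ V')"
      by (simp add: word_prod_append mult.assoc) (metis mult.assoc mult_of_int_commute)
    then show ?case using Cons by (simp add: q distrib_left)
  qed simp
  then show ?case using Cons by (simp add: p lin_mult_def distrib_right)
qed (simp add: lin_mult_def)

lemma set_lin_mult: "snd ` set (lin_mult L M) = (\<Union>U\<in>snd ` set L. (@) U ` snd ` set M)"
  by (force simp: lin_mult_def split: prod.splits)

lemma lin_eval_coeff:
  assumes "finite A" "snd ` set L \<subseteq> A"
  shows "lin_eval u L = (\<Sum>V\<in>A. of_int (lin_coeff L V) * word_prod u V)"
  using assms(2)
proof (induction L)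
  case (Cons p L)
  obtain c V where p: "p = (c, V)" by (cases p)
  have "(\<Sum>U\<in>A. of_int (if V = U then c else 0) * word_prod u U) = of_int c * word_prod u V"
    using Cons.prems assms(1) by (simp add: p if_distrib if_distribR cong: if_cong)
  then show ?case using Cons
    by (simp add: p lin_coeff_def distrib_right sum.distrib)
qed (simp add: lin_coeff_def)

lemma lin_coeff_eq_0: "V \<notin> snd ` set L \<Longrightarrow> lin_coeff L V = 0"
  unfolding lin_coeff_def by (induction L) auto

text \<open>Reads a word as a binary number whose digits mark the occurrences of \<open>x\<close>: a statistic that
  orders words of equal length compatibly with concatenation.\<close>

fun bin_val :: "'i \<Rightarrow> 'i list \<Rightarrow> nat" where
  "bin_val x [] = 0"
| "bin_val x (a # V) = (if a = x then 2 ^ length V else 0) + bin_val x V"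

lemma bin_val_append: "bin_val x (U @ V) = bin_val x U * 2 ^ length V + bin_val x V"
  by (induction U) (auto simp: power_add algebra_simps)

lemma bin_val_less: "bin_val x V < 2 ^ length V"
  by (induction V) auto

section \<open>Leading words of iterated commutators\<close>

fun ad_pow :: "'a::ring_1 \<Rightarrow> 'a \<Rightarrow> nat \<Rightarrow> 'a" where
  "ad_pow a b 0 = a"
| "ad_pow a b (Suc m) = ad_pow a b m * b - b * ad_pow a b m"

text \<open>Makes \<open>l\<close> the smallest word of the combination \<open>l + L\<close>. Being
  a rearrangement preserves the length, which makes \<open>bin_val\<close> compatible with
  concatenation, and the weight, which keeps all words inside \<open>words X w d\<close>.\<close>

definition above :: "'i \<Rightarrow> 'i list \<Rightarrow> (int \<times> 'i list) list \<Rightarrow> bool" where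
  "above x l L \<longleftrightarrow> (\<forall>V\<in>snd ` set L. mset V = mset l \<and> bin_val x l < bin_val x V)"

text \<open>In [y, x, ..., x] the word with every \<open>x\<close> behind \<open>y\<close> occurs
  with coefficient 1; every other word has some \<open>x\<close> in front of \<open>y\<close>, at a
  more significant binary digit.\<close>

lemma ad_pow_expand:
  assumes "y \<noteq> x"
  shows "\<exists>L. ad_pow (u y) (u x) m = word_prod u (y # replicate m x) + lin_eval u L \<and>
    above x (y # replicate m x) L"
proof (induction m)
  case 0
  show ?case by (rule exI[of _ "[]"]) (simp add: word_prod_def above_def)
next
  case (Suc m)
  let ?l = "\<lambda>m. y # replicate m x"
  obtain L where L: "ad_pow (u y) (u x) m = word_prod u (?l m) + lin_eval u L"
    and ab: "above x (?l m) L" using Suc by blast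
  define M where "M = lin_mult L [(1, [x])] @ lin_mult [(-1, [x])] ((1, ?l m) # L)"
  have x: "word_prod u [x] = u x" by (simp add: word_prod_def)
  have l: "?l (Suc m) = ?l m @ [x]" by (simp add: replicate_append_same)
  have "ad_pow (u y) (u x) (Suc m) = word_prod u (?l (Suc m)) + lin_eval u M"
    unfolding l word_prod_append
    by (simp only: ad_pow.simps L M_def lin_eval_mult lin_eval_simps x)
      (simp add: distrib_left distrib_right)
  moreover have "above x (?l (Suc m)) M"
    unfolding above_def
  proof
    fix V assume "V \<in> snd ` set M"
    then consider (1) U where "U \<in> snd ` set L" "V = U @ [x]"
      | (2) U where "U = ?l m \<or> U \<in> snd ` set L" "V = x # U"
      by (auto simp: M_def image_Un set_lin_mult)
    then show "mset V = mset (?l (Suc m)) \<and> bin_val x (?l (Suc m)) < bin_val x V"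
    proof cases
      case 1
      then have "mset U = mset (?l m)" "bin_val x (?l m) < bin_val x U"
        using ab by (auto simp: above_def)
      moreover have "bin_val x V = 2 * bin_val x U + 1"
        "bin_val x (?l m @ [x]) = 2 * bin_val x (?l m) + 1"
        unfolding 1 bin_val_append by simp_all
      ultimately show ?thesis unfolding l using 1 by simp
    next
      case 2
      then have U: "mset U = mset (?l m)" using ab by (auto simp: above_def)
      then have "length U = Suc m" by (metis size_mset length_Cons length_replicate)
      \<comment> \<open>The new first letter \<open>x\<close> sets the top digit, which is 0 in
        \<open>?l (Suc m)\<close> because that word starts with \<open>y\<close>.\<close>
      then have "2 ^ Suc m \<le> bin_val x V" using 2 by simp
      moreover have "bin_val x (?l (Suc m)) < 2 ^ Suc m"
        using assms bin_val_less[of x "replicate (Suc m) x"] by (simp del: replicate_Suc)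
      ultimately show ?thesis using U 2 by simp
    qed
  qed
  ultimately show ?case by blast
qed

text \<open>Elimination of the letter \<open>x\<close>: the code \<open>prod_encode (y, m)\<close> stands for the commutator of \<open>y\<close>
  with \<open>m\<close> copies of \<open>x\<close>.\<close>

definition elim_set :: "nat \<Rightarrow> nat set \<Rightarrow> (nat \<Rightarrow> nat) \<Rightarrow> nat \<Rightarrow> nat set" where
  "elim_set x X w d = prod_encode ` {(y, m). y \<in> X - {x} \<and> w y + m * w x \<le> d}"

definition elim_weight :: "nat \<Rightarrow> (nat \<Rightarrow> nat) \<Rightarrow> nat \<Rightarrow> nat" where
  "elim_weight x w i = (case prod_decode i of (y, m) \<Rightarrow> w y + m * w x)"

definition elim_ring :: "nat \<Rightarrow> (nat \<Rightarrow> 'a::ring_1) \<Rightarrow> nat \<Rightarrow> 'a" where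
  "elim_ring x u i = (case prod_decode i of (y, m) \<Rightarrow> ad_pow (u y) (u x) m)"

definition elim_lead :: "nat \<Rightarrow> nat \<Rightarrow> nat list" where
  "elim_lead x i = (case prod_decode i of (y, m) \<Rightarrow> y # replicate m x)"

text \<open>Smallest words multiply: for factors of fixed lengths, \<open>bin_val\<close> of a
  concatenation is ordered lexicographically by the values of the factors, and \<open>above\<close>
  fixes the lengths.\<close>

lemma elim_expand:
  assumes "set W \<subseteq> elim_set x X w d"
  shows "\<exists>L. word_prod (elim_ring x u) W =
      word_prod u (concat (map (elim_lead x) W)) + lin_eval u L \<and>
    above x (concat (map (elim_lead x) W)) L"
  using assms
proof (induction W)
  case Nil
  show ?case by (rule exI[of _ "[]"]) (simp add: word_prod_def above_def)
next
  case (Cons i W)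
  obtain y m where i: "i = prod_encode (y, m)" and "y \<noteq> x"
    using Cons.prems by (auto simp: elim_set_def)
  let ?l = "elim_lead x i" and ?k = "concat (map (elim_lead x) W)"
  obtain L where L: "elim_ring x u i = word_prod u ?l + lin_eval u L" "above x ?l L"
    using ad_pow_expand[OF \<open>y \<noteq> x\<close>, of u m] by (auto simp: i elim_ring_def elim_lead_def)
  obtain M where M: "word_prod (elim_ring x u) W = word_prod u ?k + lin_eval u M" "above x ?k M"
    using Cons by auto
  define N where "N = lin_mult [(1, ?l)] M @ lin_mult L ((1, ?k) # M)"
  have Wi: "word_prod (elim_ring x u) (i # W) = elim_ring x u i * word_prod (elim_ring x u) W"
    by (simp add: word_prod_def)
  have "word_prod (elim_ring x u) (i # W) = word_prod u (?l @ ?k) + lin_eval u N"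
    using L(1) M(1) unfolding word_prod_append
    by (simp add: Wi N_def lin_eval_mult distrib_left distrib_right)
  moreover have "above x (?l @ ?k) N"
    unfolding above_def
  proof
    have set_N: "snd ` set N =
        (@) ?l ` snd ` set M \<union> (\<Union>U\<in>snd ` set L. (@) U ` insert ?k (snd ` set M))"
      by (simp add: N_def image_Un set_lin_mult)
    fix V assume "V \<in> snd ` set N"
    then have "V \<in> (@) ?l ` snd ` set M \<or>
        V \<in> (\<Union>U\<in>snd ` set L. (@) U ` insert ?k (snd ` set M))"
      by (simp only: set_N Un_iff)
    then show "mset V = mset (?l @ ?k) \<and> bin_val x (?l @ ?k) < bin_val x V"
    proof
      assume "V \<in> (@) ?l ` snd ` set M"
      then obtain V2 where V: "V = ?l @ V2" and "V2 \<in> snd ` set M" by (rule imageE)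
      then have V2: "mset V2 = mset ?k" "bin_val x ?k < bin_val x V2"
        using M(2) unfolding above_def by auto
      then have "length V2 = length ?k" by (metis size_mset)
      then show ?thesis using V V2 by (simp add: bin_val_append)
    next
      assume "V \<in> (\<Union>U\<in>snd ` set L. (@) U ` insert ?k (snd ` set M))"
      then obtain V1 where "V1 \<in> snd ` set L" and V1V: "V \<in> (@) V1 ` insert ?k (snd ` set M)"
        by (rule UN_E)
      from V1V obtain V2 where V: "V = V1 @ V2" and "V2 \<in> insert ?k (snd ` set M)" by (rule imageE)
      then have V1: "mset V1 = mset ?l" "bin_val x ?l < bin_val x V1" and V2: "mset V2 = mset ?k"
        using L(2) M(2) \<open>V1 \<in> snd ` set L\<close> unfolding above_def by auto
      have len: "length V2 = length ?k" using V2 by (metis size_mset)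
      \<comment> \<open>A strictly larger first factor gains at least \<open>2 ^ length ?k\<close>,
        more than the tail \<open>?k\<close> can contribute, so nothing has to be known about the
        second factor except its length.\<close>
      have "bin_val x (?l @ ?k) < Suc (bin_val x ?l) * 2 ^ length ?k"
        using bin_val_less[of x ?k] by (simp add: bin_val_append)
      also have "\<dots> \<le> bin_val x V1 * 2 ^ length ?k"
        using V1 by (intro mult_right_mono) auto
      also have "\<dots> \<le> bin_val x V" using V len by (simp add: bin_val_append)
      finally show ?thesis using V V1 V2 by simp
    qed
  qed
  ultimately show ?case by auto
qed

lemma replicate_append_eq:
  assumes "replicate m x @ U = replicate m' x @ V"
    and "U = [] \<or> hd U \<noteq> x" and "V = [] \<or> hd V \<noteq> x"
  shows "m = m' \<and> U = V"
  using assms(1)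
proof (induction m arbitrary: m')
  case 0
  then show ?case using assms(2,3) by (cases m') auto
next
  case (Suc m)
  then show ?case using assms(2,3) by (cases m') auto
qed

text \<open>Each block y x ... x carries its only letter different from \<open>x\<close> in front,
  so these letters mark the beginnings of the blocks and the concatenation can be decoded.\<close>

lemma elim_lead_inj:
  assumes "set W \<subseteq> elim_set x X w d" "set W' \<subseteq> elim_set x X w d"
    and "concat (map (elim_lead x) W) = concat (map (elim_lead x) W')"
  shows "W = W'"
  using assms
proof (induction W arbitrary: W')
  case Nil
  then show ?case by (cases W') (auto simp: elim_lead_def split: prod.splits)
next
  case (Cons i W)
  obtain i' V where W': "W' = i' # V"
    using Cons.prems by (cases W') (auto simp: elim_lead_def split: prod.splits)
  obtain y m where i: "i = prod_encode (y, m)" using Cons.prems by (auto simp: elim_set_def)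
  obtain y' m' where i': "i' = prod_encode (y', m')" using Cons.prems by (auto simp: elim_set_def W')
  have hd: "concat (map (elim_lead x) Z) = [] \<or> hd (concat (map (elim_lead x) Z)) \<noteq> x"
    if "set Z \<subseteq> elim_set x X w d" for Z
    using that by (cases Z) (auto simp: elim_lead_def elim_set_def)
  have leads: "elim_lead x i = y # replicate m x" "elim_lead x i' = y' # replicate m' x"
    by (simp_all add: elim_lead_def i i')
  have W: "set W \<subseteq> elim_set x X w d" and V: "set V \<subseteq> elim_set x X w d"
    using Cons.prems by (auto simp: W')
  have y: "y = y'" and eq: "replicate m x @ concat (map (elim_lead x) W) =
      replicate m' x @ concat (map (elim_lead x) V)"
    using Cons.prems(3) by (simp_all add: W' leads)
  from replicate_append_eq[OF eq hd[OF W] hd[OF V]]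
  have "m = m'" "W = V" using Cons.IH[OF W V] by simp_all
  then show ?case using y by (simp add: W' i i')
qed

lemma elim_weight_lead: "sum_list (map w (elim_lead x i)) = elim_weight x w i"
  by (cases "prod_decode i") (simp add: elim_weight_def elim_lead_def sum_list_replicate)

lemma elim_weight_concat:
  "sum_list (map w (concat (map (elim_lead x) W))) = sum_list (map (elim_weight x w) W)"
  by (induction W) (simp_all add: elim_weight_lead)

lemma elim_words:
  assumes W: "W \<in> words (elim_set x X w d) (elim_weight x w) d" and x: "x \<in> X"
  shows "concat (map (elim_lead x) W) \<in> words X w d"
proof -
  have lead: "set (elim_lead x i) \<subseteq> X" if i: "i \<in> elim_set x X w d" for i
  proof -
    obtain y m where "i = prod_encode (y, m)" "y \<in> X" using i by (auto simp: elim_set_def)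
    then show ?thesis using x by (auto simp: elim_lead_def)
  qed
  have "set W \<subseteq> elim_set x X w d" using W by (simp add: words_def)
  then have "set (concat (map (elim_lead x) W)) \<subseteq> X" using lead by auto
  moreover have "sum_list (map w (concat (map (elim_lead x) W))) \<le> d"
    using W by (simp only: words_def mem_Collect_eq elim_weight_concat)
  ultimately show ?thesis by (simp only: words_def mem_Collect_eq simp_thms)
qed

lemma words_mset_cong: "V \<in> words X w d \<Longrightarrow> mset U = mset V \<Longrightarrow> U \<in> words X w d"
  unfolding words_def by (metis (mono_tags, lifting) mem_Collect_eq mset_eq_setD mset_map sum_mset_sum_list)

text \<open>Lazard elimination in truncated form: expanding the new monomials turns a relation among
  them into one among the old monomials, all still of weight at most \<open>d\<close>, through a
  unitriangular system.\<close>

lemma elim_independent: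
  assumes ind: "words_independent X w u d" and x: "x \<in> X"
  shows "words_independent (elim_set x X w d) (elim_weight x w) (elim_ring x u) d"
  unfolding words_independent_def
proof (intro allI impI, elim conjE)
  fix S and c :: "nat list \<Rightarrow> int"
  assume S: "finite S" "S \<subseteq> words (elim_set x X w d) (elim_weight x w) d"
    and zero: "(\<Sum>W\<in>S. of_int (c W) * word_prod (elim_ring x u) W) = 0"
  let ?l = "\<lambda>W. concat (map (elim_lead x) W)"
  have "\<forall>W\<in>S. \<exists>L. word_prod (elim_ring x u) W = word_prod u (?l W) + lin_eval u L \<and> above x (?l W) L"
    using S(2) elim_expand by (metis (mono_tags, lifting) mem_Collect_eq subsetD words_def)
  then obtain L where L: "\<And>W. W \<in> S \<Longrightarrow>
      word_prod (elim_ring x u) W = word_prod u (?l W) + lin_eval u (L W) \<and> above x (?l W) (L W)"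
    by metis
  define E where "E W = (1, ?l W) # L W" for W
  define A where "A = (\<Union>W\<in>S. snd ` set (E W))"
  have A: "finite A" "A \<subseteq> words X w d"
  proof -
    show "finite A" using S(1) by (simp add: A_def)
    show "A \<subseteq> words X w d"
    proof
      fix V assume "V \<in> A"
      then obtain W where W: "W \<in> S" "V \<in> snd ` set (E W)" by (auto simp: A_def)
      then have "mset V = mset (?l W)" using L[of W] by (auto simp: E_def above_def)
      moreover have "?l W \<in> words X w d" using W S(2) x elim_words by blast
      ultimately show "V \<in> words X w d" using words_mset_cong by blast
    qed
  qed
  have E: "word_prod (elim_ring x u) W = (\<Sum>V\<in>A. of_int (lin_coeff (E W) V) * word_prod u V)"
    if "W \<in> S" for W
  proof -
    have "word_prod (elim_ring x u) W = lin_eval u (E W)" using L[OF that] by (simp add: E_def)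
    also have "\<dots> = (\<Sum>V\<in>A. of_int (lin_coeff (E W) V) * word_prod u V)"
      using that by (intro lin_eval_coeff[OF A(1)]) (auto simp: A_def)
    finally show ?thesis .
  qed
  have "0 = (\<Sum>W\<in>S. of_int (c W) * (\<Sum>V\<in>A. of_int (lin_coeff (E W) V) * word_prod u V))"
    using zero E by simp
  also have "\<dots> = (\<Sum>V\<in>A. of_int (\<Sum>W\<in>S. c W * lin_coeff (E W) V) * word_prod u V)"
    by (simp add: sum_distrib_left sum_distrib_right mult.assoc sum.swap[of _ A])
  finally have "(\<Sum>V\<in>A. of_int (\<Sum>W\<in>S. c W * lin_coeff (E W) V) * word_prod u V) = 0" by simp
  from words_independentD[OF ind A this]
  have coeffs: "(\<Sum>W\<in>S. c W * lin_coeff (E W) V) = 0" if "V \<in> A" for V using that by simp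
  show "\<forall>W\<in>S. c W = 0"
  proof (rule ccontr)
    assume "\<not> (\<forall>W\<in>S. c W = 0)"
    then have "\<exists>W. W \<in> S \<and> c W \<noteq> 0" by blast
    \<comment> \<open>Among the words with nonzero coefficient, one with smallest leading word is
      chosen. That leading word lies in no tail, as tails lie strictly above their own leading
      words, and it is no other leading word by \<open>elim_lead_inj\<close>; its total coefficient
      is therefore \<open>c W0\<close>.\<close>
    from ex_has_least_nat[of "\<lambda>W. W \<in> S \<and> c W \<noteq> 0", OF this[THEN someI_ex], of "\<lambda>W. bin_val x (?l W)"]
    obtain W0 where W0: "W0 \<in> S" "c W0 \<noteq> 0"
      and least: "\<And>W. W \<in> S \<Longrightarrow> c W \<noteq> 0 \<Longrightarrow> bin_val x (?l W0) \<le> bin_val x (?l W)" by blast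
    have rest: "lin_coeff (L W) (?l W0) = 0" if "W \<in> S" "c W \<noteq> 0" for W
      using L[OF that(1)] least[OF that] by (intro lin_coeff_eq_0) (force simp: above_def)
    have "c W * lin_coeff (E W) (?l W0) = 0" if "W \<in> S - {W0}" for W
    proof (cases "c W = 0")
      case False
      have "?l W \<noteq> ?l W0" using elim_lead_inj[of W x X w d W0] that S(2) W0(1) by (auto simp: words_def)
      then show ?thesis using rest[OF _ False] that by (simp add: E_def lin_coeff_def)
    qed simp
    then have "(\<Sum>W\<in>S. c W * lin_coeff (E W) (?l W0)) = c W0 * lin_coeff (E W0) (?l W0)"
      using S(1) W0(1) by (simp add: sum.remove[of S W0] sum.neutral)
    also have "\<dots> = c W0" using rest[OF W0] by (simp add: E_def lin_coeff_def)
    finally have "c W0 = 0" using coeffs[of "?l W0"] W0(1) by (auto simp: A_def E_def)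
    then show False using W0(2) by simp
  qed
qed

lemma coeff_word_prod_var: "coeff (word_prod ncs_var W) V = (if V = W then 1 else 0)"
proof (induction W arbitrary: V)
  case Nil
  then show ?case by (simp add: word_prod_def)
next
  case (Cons a W)
  have "word_prod ncs_var (a # W) = ncs_var a * word_prod ncs_var W" by (simp add: word_prod_def)
  then show ?case using Cons by (cases V) (auto simp: coeff_var_mult_Cons, simp add: coeff_var)
qed

lemma var_independent: "words_independent X w ncs_var d"
  unfolding words_independent_def
proof (intro allI impI ballI, elim conjE)
  fix S and c :: "nat list \<Rightarrow> int" and W
  assume "finite S" "W \<in> S" and zero: "(\<Sum>W\<in>S. of_int (c W) * word_prod ncs_var W) = 0"
  have "coeff (\<Sum>W\<in>S. of_int (c W) * word_prod ncs_var W) W = c W"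
    using \<open>finite S\<close> \<open>W \<in> S\<close> by (simp add: coeff_word_prod_var if_distrib cong: if_cong)
  then show "c W = 0" by (simp add: zero)
qed

section \<open>The Magnus expansion and the lower central series\<close>

lemma low_diff_cancel: "low d f \<Longrightarrow> low d (f - g) \<Longrightarrow> low d g"
  by (simp add: low_def)

definition magnus_letter :: "fletter \<Rightarrow> ncs" where
  "magnus_letter a = (if snd a then 1 + ncs_var (fst a) else ncs_geom (fst a))"

definition magnus :: "fletter list \<Rightarrow> ncs" where
  "magnus w = prod_list (map magnus_letter w)"

lemma magnus_Cons: "magnus (a # w) = magnus_letter a * magnus w"
  by (simp add: magnus_def)

lemma magnus_push: "magnus (push_letter a w) = magnus_letter a * magnus w"
proof (cases w)
  case (Cons b v)
  have "magnus_letter a * magnus_letter b = 1" if "cancels a b"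
    using that by (auto simp: cancels_iff magnus_letter_def var_mult_geom geom_mult_var)
  then show ?thesis by (simp add: Cons magnus_Cons mult.assoc[symmetric])
qed (simp add: magnus_def)

lemma magnus_normalize: "magnus (normalize w) = magnus w"
  by (induction w) (simp_all add: normalize_def magnus_push magnus_Cons)

lemma magnus_mult: "magnus (u \<otimes>\<^bsub>free_group n\<^esub> v) = magnus u * magnus v"
  by (simp add: mult_free_group magnus_normalize) (simp add: magnus_def)

lemma magnus_one: "magnus \<one>\<^bsub>free_group n\<^esub> = 1"
  by (simp add: one_free_group magnus_def)

lemma magnus_fgen: "magnus (fgen k) = 1 + ncs_var k"
  by (simp add: magnus_def fgen_def magnus_letter_def)

lemma coeff_magnus_Nil [simp]: "coeff (magnus w) [] = 1"
  by (induction w) (auto simp: magnus_Cons magnus_letter_def coeff_var coeff_geom, simp add: magnus_def)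

lemma low_1_magnus: "low 1 (magnus w - 1)"
  by (simp add: low_def)

context
  fixes n :: nat
begin

interpretation F: group "free_group n" by (rule group_free_group)

lemma magnus_inv:
  assumes "g \<in> carrier (free_group n)"
  shows "magnus (inv\<^bsub>free_group n\<^esub> g) * magnus g = 1" "magnus g * magnus (inv\<^bsub>free_group n\<^esub> g) = 1"
  using assms by (simp_all flip: magnus_mult[of n] add: magnus_one)

lemma magnus_inv_diff:
  assumes "g \<in> carrier (free_group n)"
  shows "magnus (inv\<^bsub>free_group n\<^esub> g) - 1 = - (magnus (inv\<^bsub>free_group n\<^esub> g) * (magnus g - 1))"
  by (simp add: right_diff_distrib magnus_inv[OF assms])

text \<open>Subtracting 1 from both entries does not change a ring commutator; this is why the
  orders of \<open>magnus a - 1\<close> and \<open>magnus b - 1\<close> add up in a group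
  commutator.\<close>

lemma magnus_gcomm_diff:
  assumes "a \<in> carrier (free_group n)" "b \<in> carrier (free_group n)"
  shows "magnus (gcomm (free_group n) a b) - 1 =
    magnus (inv\<^bsub>free_group n\<^esub> a) * magnus (inv\<^bsub>free_group n\<^esub> b) *
      ((magnus a - 1) * (magnus b - 1) - (magnus b - 1) * (magnus a - 1))"
proof -
  let ?A = "magnus (inv\<^bsub>free_group n\<^esub> a)" and ?B = "magnus (inv\<^bsub>free_group n\<^esub> b)"
  have "(magnus a - 1) * (magnus b - 1) - (magnus b - 1) * (magnus a - 1) =
      magnus a * magnus b - magnus b * magnus a"
    by (simp add: algebra_simps)
  moreover have "?A * ?B * (magnus b * magnus a) = 1"
    using magnus_inv[OF assms(1)] magnus_inv[OF assms(2)]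
    by (metis mult.assoc mult.left_neutral)
  ultimately show ?thesis
    by (simp add: gcomm_def magnus_mult right_diff_distrib mult.assoc)
qed

lemma low_magnus_mult:
  "low d (magnus g - 1) \<Longrightarrow> low d (magnus h - 1) \<Longrightarrow> low d (magnus (g \<otimes>\<^bsub>free_group n\<^esub> h) - 1)"
proof -
  assume l: "low d (magnus g - 1)" "low d (magnus h - 1)"
  have eq: "magnus (g \<otimes>\<^bsub>free_group n\<^esub> h) - 1 = (magnus g - 1) * magnus h + (magnus h - 1)"
    by (simp add: magnus_mult algebra_simps)
  show ?thesis unfolding eq using l by (intro low_add low_mult_right)
qed

lemma low_magnus_inv:
  "g \<in> carrier (free_group n) \<Longrightarrow> low d (magnus g - 1) \<Longrightarrow> low d (magnus (inv\<^bsub>free_group n\<^esub> g) - 1)"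
  by (simp add: magnus_inv_diff low_minus low_mult_left)

text \<open>The easy half of the degree criterion: a commutator of entries of orders
  \<open>k\<close> and 1 has order \<open>k + 1\<close>, and products and inverses do not lower the
  order.\<close>

lemma lcs_low_magnus: "g \<in> lcs (free_group n) k \<Longrightarrow> low k (magnus g - 1)"
proof (induction k arbitrary: g)
  case (Suc k)
  show ?case
  proof (cases "k = 0")
    case True
    then show ?thesis using low_1_magnus by simp
  next
    case False
    let ?S = "{gcomm (free_group n) a b |a b. a \<in> lcs (free_group n) k \<and> b \<in> carrier (free_group n)}"
    have S: "low (Suc k) (magnus s - 1) \<and> s \<in> carrier (free_group n)" if s_in: "s \<in> ?S" for s
    proof -
      obtain a b where s: "s = gcomm (free_group n) a b" and a: "a \<in> lcs (free_group n) k"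
        and b: "b \<in> carrier (free_group n)" using s_in by blast
      have "low (k + 1) ((magnus a - 1) * (magnus b - 1))"
        and "low (1 + k) ((magnus b - 1) * (magnus a - 1))"
        using Suc.IH[OF a] low_1_magnus by (blast intro: low_mult)+
      then show ?thesis using a b F.lcs_closed(4)[OF a]
        by (simp add: s magnus_gcomm_diff low_mult_left low_diff)
    qed
    have "g \<in> generate (free_group n) ?S" using Suc.prems False by (simp add: F.lcs_Suc)
    then show ?thesis
    proof (induction rule: generate.induct)
      case one
      then show ?case by (simp add: magnus_one)
    next
      case (incl s)
      then show ?case using S by blast
    next
      case (inv s)
      then show ?case using S[OF inv] low_magnus_inv[of s "Suc k"] by blast
    next
      case (eng h1 h2)
      then show ?case by (intro low_magnus_mult)
    qed
  qed
qed simp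

text \<open>Nothing occurs strictly between degree 0 and degree \<open>w\<close>, and
  \<open>u\<close> is the component of degree \<open>w\<close>. It may be 0, so the notion survives
  products in which leading terms cancel.\<close>

definition leads :: "nat \<Rightarrow> fletter list \<Rightarrow> ncs \<Rightarrow> bool" where
  "leads w g u \<longleftrightarrow> homogeneous w u \<and> low (Suc w) (magnus g - 1 - u)"

lemma leads_low: "leads w g u \<Longrightarrow> low w (magnus g - 1)"
proof -
  assume "leads w g u"
  then have "low w (magnus g - 1 - u)" "low w u"
    by (auto simp: leads_def intro: homogeneous_low low_mono[OF _ le_SucI[OF order_refl]])
  from low_add[OF this] show ?thesis by simp
qed

text \<open>The cross term of the two factors has order \<open>w + w\<close>, which exceeds
  \<open>w\<close> because \<open>1 \<le> w\<close>; so leading terms of equal degree add.\<close>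

lemma leads_mult:
  assumes "1 \<le> w" and g: "leads w g u" and h: "leads w h v"
  shows "leads w (g \<otimes>\<^bsub>free_group n\<^esub> h) (u + v)"
proof -
  have "low (w + w) ((magnus g - 1) * (magnus h - 1))"
    by (intro low_mult leads_low[OF g] leads_low[OF h])
  then have l: "low (Suc w) ((magnus g - 1) * (magnus h - 1))"
    by (rule low_mono) (use assms in simp)
  have eq: "magnus (g \<otimes>\<^bsub>free_group n\<^esub> h) - 1 - (u + v) =
      (magnus g - 1) * (magnus h - 1) + (magnus g - 1 - u) + (magnus h - 1 - v)"
    by (simp add: magnus_mult algebra_simps)
  have "low (Suc w) (magnus (g \<otimes>\<^bsub>free_group n\<^esub> h) - 1 - (u + v))"
    unfolding eq using g h l by (intro low_add) (simp_all add: leads_def)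
  then show ?thesis using g h by (simp add: leads_def homogeneous_def)
qed

lemma leads_inv:
  assumes "g \<in> carrier (free_group n)" and g: "leads w g u"
  shows "leads w (inv\<^bsub>free_group n\<^esub> g) (- u)"
proof -
  let ?i = "magnus (inv\<^bsub>free_group n\<^esub> g)"
  have "low (1 + w) ((?i - 1) * (magnus g - 1))"
    by (intro low_mult leads_low[OF g] low_1_magnus)
  then have l: "low (Suc w) ((?i - 1) * (magnus g - 1))" by simp
  have eq: "?i - 1 - (- u) = - ((?i - 1) * (magnus g - 1)) - (magnus g - 1 - u)"
    by (simp add: algebra_simps magnus_inv[OF assms(1)])
  have "low (Suc w) (?i - 1 - (- u))"
    unfolding eq using g low_diff[OF low_minus[OF l], of "magnus g - 1 - u"] by (simp only: leads_def)
  then show ?thesis using g by (simp add: leads_def homogeneous_def)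
qed

lemma leads_one: "leads w \<one>\<^bsub>free_group n\<^esub> 0"
  by (simp add: leads_def magnus_one homogeneous_def)

lemma leads_gcomm:
  assumes "g \<in> carrier (free_group n)" "h \<in> carrier (free_group n)"
    and g: "leads a g u" and h: "leads b h v"
  shows "leads (a + b) (gcomm (free_group n) g h) (u * v - v * u)"
proof -
  let ?P = "magnus (inv\<^bsub>free_group n\<^esub> g) * magnus (inv\<^bsub>free_group n\<^esub> h)"
  let ?g = "magnus g - 1" and ?h = "magnus h - 1"
  let ?Z = "?g * ?h - ?h * ?g"
  have hom: "homogeneous a u" "homogeneous b v" and lg: "low (Suc a) (?g - u)" "low (Suc b) (?h - v)"
    using g h by (auto simp: leads_def)
  note l = leads_low[OF g] leads_low[OF h] lg hom[THEN homogeneous_low]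
  have "low (a + b) (?g * ?h)" "low (b + a) (?h * ?g)" using l by (blast intro: low_mult)+
  then have Z: "low (a + b) ?Z" by (simp add: add.commute low_diff)
  have "low 1 (?P - 1)" by (simp add: low_def)
  from low_mult[OF this Z] have 1: "low (Suc (a + b)) ((?P - 1) * ?Z)" by simp
  have "low (Suc a + b) ((?g - u) * ?h)" "low (a + Suc b) (u * (?h - v))"
    "low (Suc b + a) ((?h - v) * ?g)" "low (b + Suc a) (v * (?g - u))"
    using l by (blast intro: low_mult)+
  then have "low (Suc (a + b)) ((?g - u) * ?h)" "low (Suc (a + b)) (u * (?h - v))"
    "low (Suc (a + b)) ((?h - v) * ?g)" "low (Suc (a + b)) (v * (?g - u))"
    by (simp_all add: add.commute)
  then have 2: "low (Suc (a + b)) (((?g - u) * ?h + u * (?h - v)) - ((?h - v) * ?g + v * (?g - u)))"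
    by (intro low_diff low_add)
  have "magnus (gcomm (free_group n) g h) - 1 - (u * v - v * u) = ?P * ?Z - (u * v - v * u)"
    by (simp only: magnus_gcomm_diff[OF assms(1,2)])
  \<comment> \<open>The unit \<open>?P\<close> is replaced by 1 and then one factor at a time by its
    leading term; each replacement leaves an error of one degree more than
    \<open>a + b\<close>.\<close>
  also have "\<dots> = (?P - 1) * ?Z + (((?g - u) * ?h + u * (?h - v)) - ((?h - v) * ?g + v * (?g - u)))"
    by (simp add: algebra_simps)
  finally have "low (Suc (a + b)) (magnus (gcomm (free_group n) g h) - 1 - (u * v - v * u))"
    using low_add[OF 1 2] by simp
  moreover have "homogeneous (a + b) (u * v - v * u)"
    using homogeneous_mult[OF hom] homogeneous_mult[OF hom(2,1)] by (simp add: add.commute homogeneous_diff)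
  ultimately show ?thesis by (simp add: leads_def)
qed

end

section \<open>Elimination in the free group modulo Gamma_(d+1)\<close>

fun comm_pow :: "('a, 'b) monoid_scheme \<Rightarrow> 'a \<Rightarrow> 'a \<Rightarrow> nat \<Rightarrow> 'a" where
  "comm_pow G a b 0 = a"
| "comm_pow G a b (Suc m) = gcomm G (comm_pow G a b m) b"

definition elim_grp :: "('a, 'b) monoid_scheme \<Rightarrow> nat \<Rightarrow> (nat \<Rightarrow> 'a) \<Rightarrow> nat \<Rightarrow> 'a" where
  "elim_grp G x g i = (case prod_decode i of (y, m) \<Rightarrow> comm_pow G (g y) (g x) m)"

text \<open>The invariant of the elimination: group elements of known depth whose leading terms
  behave like free generators up to weight \<open>d\<close>. Weights exceed 0 so that commutators
  gain depth, and stay at most \<open>d\<close> because deeper elements are absorbed by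
  Gamma_(d+1).\<close>

definition free_family ::
  "nat \<Rightarrow> nat \<Rightarrow> nat set \<Rightarrow> (nat \<Rightarrow> nat) \<Rightarrow> (nat \<Rightarrow> fletter list) \<Rightarrow> (nat \<Rightarrow> ncs) \<Rightarrow> bool" where
  "free_family n d X w g u \<longleftrightarrow> finite X \<and> words_independent X w u d \<and>
    (\<forall>i\<in>X. 1 \<le> w i \<and> w i \<le> d \<and> g i \<in> lcs (free_group n) (w i) \<and> leads (w i) (g i) (u i))"

definition span_mod :: "nat \<Rightarrow> nat \<Rightarrow> nat set \<Rightarrow> (nat \<Rightarrow> fletter list) \<Rightarrow> fletter list set" where
  "span_mod n d X g = generate (free_group n) (g ` X \<union> lcs (free_group n) (Suc d))"

context
  fixes n :: nat
begin

interpretation F: group "free_group n" by (rule group_free_group)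

lemma comm_pow_lcs_leads:
  assumes "g \<in> lcs (free_group n) a" "h \<in> lcs (free_group n) b" "1 \<le> a" "1 \<le> b"
    and "leads a g u" "leads b h v"
  shows "comm_pow (free_group n) g h m \<in> lcs (free_group n) (a + m * b) \<and>
    leads (a + m * b) (comm_pow (free_group n) g h m) (ad_pow u v m)"
proof (induction m)
  case 0
  then show ?case using assms by simp
next
  case (Suc m)
  have "a + Suc m * b = a + m * b + b" by simp
  then show ?case
    using F.gcomm_lcs_lcs[of "a + m * b" b] leads_gcomm[of _ n h "a + m * b" _ b v]
      Suc assms F.lcs_closed(4) by (metis ad_pow.simps(2) add_leD1 comm_pow.simps(2) trans_le_add1)
qed

text \<open>The cut at weight \<open>d\<close> keeps the family finite: as \<open>w x\<close> is at
  least 1, the number of copies of \<open>x\<close> in a commutator is at most \<open>d\<close>.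
  Group and ring commutators match by \<open>comm_pow_lcs_leads\<close>.\<close>

lemma elim_free_family:
  assumes fam: "free_family n d X w g u" and x: "x \<in> X"
  shows "free_family n d (elim_set x X w d) (elim_weight x w) (elim_grp (free_group n) x g) (elim_ring x u)"
  unfolding free_family_def
proof (intro conjI ballI)
  have "m \<le> d" if "y \<in> X" "w y + m * w x \<le> d" for y m
  proof -
    have "1 \<le> w x" using fam x by (auto simp: free_family_def)
    then have "m * 1 \<le> m * w x" by (intro mult_le_mono) simp_all
    then show ?thesis using that by linarith
  qed
  then have "elim_set x X w d \<subseteq> prod_encode ` (X \<times> {..d})" by (auto simp: elim_set_def)
  then show "finite (elim_set x X w d)"
    using fam by (auto simp: free_family_def intro: finite_subset)
  show "words_independent (elim_set x X w d) (elim_weight x w) (elim_ring x u) d"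
    using fam x by (auto simp: free_family_def intro: elim_independent)
  fix i assume "i \<in> elim_set x X w d"
  then obtain y m where i: "i = prod_encode (y, m)" "y \<in> X" "w y + m * w x \<le> d"
    by (auto simp: elim_set_def)
  then show "1 \<le> elim_weight x w i" "elim_weight x w i \<le> d"
    using fam by (auto simp: elim_weight_def free_family_def)
  show "elim_grp (free_group n) x g i \<in> lcs (free_group n) (elim_weight x w i)"
    "leads (elim_weight x w i) (elim_grp (free_group n) x g i) (elim_ring x u i)"
    using comm_pow_lcs_leads[of "g y" "w y" "g x" "w x"] fam i x
    by (auto simp: elim_weight_def elim_grp_def elim_ring_def free_family_def)
qed

lemma span_mod_carrier:
  "free_family n d X w g u \<Longrightarrow> g ` X \<union> lcs (free_group n) (Suc d) \<subseteq> carrier (free_group n)"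
  using F.lcs_closed(4) unfolding free_family_def by blast

lemma span_mod_subgroup:
  "free_family n d X w g u \<Longrightarrow> subgroup (span_mod n d X g) (free_group n)"
  unfolding span_mod_def by (intro F.generate_is_subgroup span_mod_carrier)

lemma lcs_span_mod: "s \<in> lcs (free_group n) (Suc d) \<Longrightarrow> s \<in> span_mod n d X g"
  unfolding span_mod_def by (intro generate.incl) simp

text \<open>Conjugation by \<open>g x\<close> sends \<open>[y, x, \<dots>, x]\<close> to its product with the next longer such
  commutator; for the inverse one descends from the commutators that are trivial modulo
  \<open>\<Gamma>\<^sub>d\<^sub>+\<^sub>1\<close>.\<close>

lemma comm_pow_span_mod:
  assumes fam: "free_family n d X w g u" and x: "x \<in> X" and y: "y \<in> X - {x}"
  defines "K \<equiv> span_mod n d (elim_set x X w d) (elim_grp (free_group n) x g)"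
    and "c \<equiv> comm_pow (free_group n) (g y) (g x)"
  shows "c m \<in> K" and "inv\<^bsub>free_group n\<^esub> (g x) \<otimes>\<^bsub>free_group n\<^esub> c m \<otimes>\<^bsub>free_group n\<^esub> g x \<in> K"
    and "g x \<otimes>\<^bsub>free_group n\<^esub> c m \<otimes>\<^bsub>free_group n\<^esub> inv\<^bsub>free_group n\<^esub> (g x) \<in> K"
proof -
  interpret K: subgroup K "free_group n"
    unfolding K_def by (rule span_mod_subgroup[OF elim_free_family[OF fam x]])
  have lcs: "c m \<in> lcs (free_group n) (w y + m * w x)" for m
    using comm_pow_lcs_leads[of "g y" "w y" "g x" "w x"] fam x y
    by (auto simp: free_family_def c_def)
  have gx: "g x \<in> carrier (free_group n)" using span_mod_carrier[OF fam] x by blast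
  have c: "c m \<in> carrier (free_group n)" for m using lcs F.lcs_closed(4) by blast
  have big: "c m \<in> lcs (free_group n) (Suc d)" if "d < w y + m * w x" for m
    using lcs[of m] F.lcs_antimono[of "Suc d" "w y + m * w x"] that by auto
  show cK: "c m \<in> K" for m
  proof (cases "w y + m * w x \<le> d")
    case True
    then have "prod_encode (y, m) \<in> elim_set x X w d" using y by (auto simp: elim_set_def)
    then have "elim_grp (free_group n) x g (prod_encode (y, m)) \<in> K"
      unfolding K_def span_mod_def by (intro generate.incl) blast
    then show ?thesis by (simp add: elim_grp_def c_def)
  next
    case False
    then show ?thesis using big lcs_span_mod by (simp add: K_def)
  qed
  have cSuc: "c m \<otimes>\<^bsub>free_group n\<^esub> c (Suc m) = inv\<^bsub>free_group n\<^esub> (g x) \<otimes>\<^bsub>free_group n\<^esub> c m \<otimes>\<^bsub>free_group n\<^esub> g x" for m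
    using c[of m] gx by (simp add: c_def gcomm_def F.group_word_simps)
  show "inv\<^bsub>free_group n\<^esub> (g x) \<otimes>\<^bsub>free_group n\<^esub> c m \<otimes>\<^bsub>free_group n\<^esub> g x \<in> K"
    using cK[of m] cK[of "Suc m"] K.m_closed by (simp flip: cSuc)
  have large: "g x \<otimes>\<^bsub>free_group n\<^esub> c m \<otimes>\<^bsub>free_group n\<^esub> inv\<^bsub>free_group n\<^esub> (g x) \<in> K" if "d \<le> m" for m
  proof -
    have "1 \<le> w x" "1 \<le> w y" using fam x y by (auto simp: free_family_def)
    then have "m * 1 \<le> m * w x" by (intro mult_le_mono) simp_all
    then have "d < w y + m * w x" using that \<open>1 \<le> w y\<close> by linarith
    then have "g x \<otimes>\<^bsub>free_group n\<^esub> c m \<otimes>\<^bsub>free_group n\<^esub> inv\<^bsub>free_group n\<^esub> (g x) \<in> lcs (free_group n) (Suc d)"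
      using big gx by (intro F.lcs_closed(6))
    then show ?thesis using lcs_span_mod by (simp add: K_def)
  qed
  show "g x \<otimes>\<^bsub>free_group n\<^esub> c m \<otimes>\<^bsub>free_group n\<^esub> inv\<^bsub>free_group n\<^esub> (g x) \<in> K"
  proof (induction "d - m" arbitrary: m)
    case 0
    then show ?case by (intro large) simp
  next
    case (Suc j)
    have "(g x \<otimes>\<^bsub>free_group n\<^esub> c m \<otimes>\<^bsub>free_group n\<^esub> inv\<^bsub>free_group n\<^esub> (g x)) =
        c m \<otimes>\<^bsub>free_group n\<^esub> inv\<^bsub>free_group n\<^esub> (g x \<otimes>\<^bsub>free_group n\<^esub> c (Suc m) \<otimes>\<^bsub>free_group n\<^esub> inv\<^bsub>free_group n\<^esub> (g x))"
      using c[of m] gx by (simp add: c_def gcomm_def F.group_word_simps)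
    moreover have "g x \<otimes>\<^bsub>free_group n\<^esub> c (Suc m) \<otimes>\<^bsub>free_group n\<^esub> inv\<^bsub>free_group n\<^esub> (g x) \<in> K"
      using Suc.hyps(2) by (intro Suc.hyps(1)) simp
    ultimately show ?case using cK[of m] by simp
  qed
qed

lemma conj_generate:
  assumes "group G" "S \<subseteq> carrier G" "x \<in> carrier G"
    and gens: "\<And>s. s \<in> S \<Longrightarrow> x \<otimes>\<^bsub>G\<^esub> s \<otimes>\<^bsub>G\<^esub> inv\<^bsub>G\<^esub> x \<in> generate G S" and k: "k \<in> generate G S"
  shows "x \<otimes>\<^bsub>G\<^esub> k \<otimes>\<^bsub>G\<^esub> inv\<^bsub>G\<^esub> x \<in> generate G S"
proof -
  interpret G: group G by fact
  interpret K: subgroup "generate G S" G by (rule G.generate_is_subgroup) fact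
  show ?thesis using k
  proof (induction rule: generate.induct)
    case one
    then show ?case using assms(3) by simp
  next
    case (incl h)
    then show ?case by (rule gens)
  next
    case (inv h)
    then have "x \<otimes>\<^bsub>G\<^esub> inv\<^bsub>G\<^esub> h \<otimes>\<^bsub>G\<^esub> inv\<^bsub>G\<^esub> x = inv\<^bsub>G\<^esub> (x \<otimes>\<^bsub>G\<^esub> h \<otimes>\<^bsub>G\<^esub> inv\<^bsub>G\<^esub> x)"
      using assms(2,3) by (auto simp: G.group_word_simps)
    then show ?case using gens[OF inv] by simp
  next
    case (eng h1 h2)
    then have "x \<otimes>\<^bsub>G\<^esub> (h1 \<otimes>\<^bsub>G\<^esub> h2) \<otimes>\<^bsub>G\<^esub> inv\<^bsub>G\<^esub> x =
        (x \<otimes>\<^bsub>G\<^esub> h1 \<otimes>\<^bsub>G\<^esub> inv\<^bsub>G\<^esub> x) \<otimes>\<^bsub>G\<^esub> (x \<otimes>\<^bsub>G\<^esub> h2 \<otimes>\<^bsub>G\<^esub> inv\<^bsub>G\<^esub> x)"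
      using assms(3) K.mem_carrier by (simp add: G.group_word_simps)
    then show ?case using eng.IH by simp
  qed
qed

lemma conj_span_mod:
  assumes fam: "free_family n d X w g u" and x: "x \<in> X"
  defines "K \<equiv> span_mod n d (elim_set x X w d) (elim_grp (free_group n) x g)"
  assumes k: "k \<in> K"
  shows "g x \<otimes>\<^bsub>free_group n\<^esub> k \<otimes>\<^bsub>free_group n\<^esub> inv\<^bsub>free_group n\<^esub> (g x) \<in> K"
    and "inv\<^bsub>free_group n\<^esub> (g x) \<otimes>\<^bsub>free_group n\<^esub> k \<otimes>\<^bsub>free_group n\<^esub> g x \<in> K"
proof -
  let ?S = "elim_grp (free_group n) x g ` elim_set x X w d \<union> lcs (free_group n) (Suc d)"
  have S: "?S \<subseteq> carrier (free_group n)" by (rule span_mod_carrier[OF elim_free_family[OF fam x]])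
  have gx: "g x \<in> carrier (free_group n)" using span_mod_carrier[OF fam] x by blast
  have K: "K = generate (free_group n) ?S" by (simp add: K_def span_mod_def)
  have N: "s \<in> K" if "s \<in> lcs (free_group n) (Suc d)" for s
    using lcs_span_mod[OF that] by (simp add: K_def)
  have gens: "g x \<otimes>\<^bsub>free_group n\<^esub> s \<otimes>\<^bsub>free_group n\<^esub> inv\<^bsub>free_group n\<^esub> (g x) \<in> K \<and>
      inv\<^bsub>free_group n\<^esub> (g x) \<otimes>\<^bsub>free_group n\<^esub> s \<otimes>\<^bsub>free_group n\<^esub> g x \<in> K" if s: "s \<in> ?S" for s
    using s
  proof
    assume "s \<in> elim_grp (free_group n) x g ` elim_set x X w d"
    then obtain y m where "y \<in> X - {x}" "s = comm_pow (free_group n) (g y) (g x) m"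
      by (auto simp: elim_set_def elim_grp_def)
    then show ?thesis using comm_pow_span_mod(2,3)[OF fam x] by (simp add: K_def)
  next
    assume "s \<in> lcs (free_group n) (Suc d)"
    then show ?thesis using N F.lcs_closed(5,6)[OF gx] by simp
  qed
  show "g x \<otimes>\<^bsub>free_group n\<^esub> k \<otimes>\<^bsub>free_group n\<^esub> inv\<^bsub>free_group n\<^esub> (g x) \<in> K"
    using conj_generate[OF group_free_group S gx] gens k unfolding K by blast
  have "inv\<^bsub>free_group n\<^esub> (g x) \<otimes>\<^bsub>free_group n\<^esub> k \<otimes>\<^bsub>free_group n\<^esub> inv\<^bsub>free_group n\<^esub> (inv\<^bsub>free_group n\<^esub> (g x)) \<in> K"
    using conj_generate[OF group_free_group S F.inv_closed[OF gx]] gens k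
    unfolding K F.inv_inv[OF gx] by blast
  then show "inv\<^bsub>free_group n\<^esub> (g x) \<otimes>\<^bsub>free_group n\<^esub> k \<otimes>\<^bsub>free_group n\<^esub> g x \<in> K"
    using gx by simp
qed

lemma conj_pow_span_mod:
  fixes e :: int
  assumes fam: "free_family n d X w g u" and x: "x \<in> X"
  defines "K \<equiv> span_mod n d (elim_set x X w d) (elim_grp (free_group n) x g)"
  assumes "k \<in> K"
  shows "g x [^]\<^bsub>free_group n\<^esub> e \<otimes>\<^bsub>free_group n\<^esub> k \<otimes>\<^bsub>free_group n\<^esub> inv\<^bsub>free_group n\<^esub> (g x [^]\<^bsub>free_group n\<^esub> e) \<in> K"
proof -
  interpret K: subgroup K "free_group n"
    unfolding K_def by (rule span_mod_subgroup[OF elim_free_family[OF fam x]])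
  have gx: "g x \<in> carrier (free_group n)" using span_mod_carrier[OF fam] x by blast
  note conj = conj_span_mod[OF fam x, folded K_def]
  show ?thesis using \<open>k \<in> K\<close>
  proof (induction e arbitrary: k rule: int_induct[of _ 0])
    case base
    then show ?case by simp
  next
    case (step1 i)
    have "g x [^]\<^bsub>free_group n\<^esub> (i + 1) = g x [^]\<^bsub>free_group n\<^esub> i \<otimes>\<^bsub>free_group n\<^esub> g x"
      using gx by (simp add: F.int_pow_mult)
    then show ?case
      using step1(2)[OF conj(1)[OF step1(3)]] K.mem_carrier[OF step1(3)] gx
      by (simp add: F.group_word_simps)
  next
    case (step2 i)
    have "g x [^]\<^bsub>free_group n\<^esub> (i - 1) = g x [^]\<^bsub>free_group n\<^esub> i \<otimes>\<^bsub>free_group n\<^esub> inv\<^bsub>free_group n\<^esub> (g x)"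
      using gx by (simp add: F.int_pow_diff)
    then show ?case
      using step2(2)[OF conj(2)[OF step2(3)]] K.mem_carrier[OF step2(3)] gx
      by (simp add: F.group_word_simps)
  qed
qed

text \<open>Powers of \<open>g x\<close> normalise the new span, so its products with these powers
  are closed under multiplication; the old generators \<open>g y\<close> with
  \<open>y \<noteq> x\<close> are the commutators with \<open>m = 0\<close>.\<close>

lemma span_mod_decompose:
  assumes fam: "free_family n d X w g u" and x: "x \<in> X" and h: "h \<in> span_mod n d X g"
  shows "\<exists>k\<in>span_mod n d (elim_set x X w d) (elim_grp (free_group n) x g). \<exists>e::int.
    h = k \<otimes>\<^bsub>free_group n\<^esub> g x [^]\<^bsub>free_group n\<^esub> e"
proof -
  let ?K = "span_mod n d (elim_set x X w d) (elim_grp (free_group n) x g)"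
  interpret K: subgroup ?K "free_group n"
    by (rule span_mod_subgroup[OF elim_free_family[OF fam x]])
  have gx: "g x \<in> carrier (free_group n)" using span_mod_carrier[OF fam] x by blast
  have gens: "s \<in> ?K" if "s \<in> g ` (X - {x}) \<union> lcs (free_group n) (Suc d)" for s
    using that comm_pow_span_mod(1)[OF fam x, of _ 0] lcs_span_mod by auto
  have "h \<in> generate (free_group n) (g ` X \<union> lcs (free_group n) (Suc d))"
    using h by (simp add: span_mod_def)
  then show ?thesis
  proof (induction rule: generate.induct)
    case one
    show ?case by (rule bexI[of _ "\<one>\<^bsub>free_group n\<^esub>"], rule exI[of _ 0]) auto
  next
    case (incl s)
    show ?case
    proof (cases "s = g x")
      case True
      then show ?thesis using gx
        by (intro bexI[of _ "\<one>\<^bsub>free_group n\<^esub>"] exI[of _ 1]) auto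
    next
      case False
      then have "s \<in> ?K" using incl gens by blast
      then show ?thesis by (intro bexI[of _ s] exI[of _ 0]) auto
    qed
  next
    case (inv s)
    show ?case
    proof (cases "s = g x")
      case True
      then show ?thesis using gx
        by (intro bexI[of _ "\<one>\<^bsub>free_group n\<^esub>"] exI[of _ "- 1"]) (auto simp: F.int_pow_neg)
    next
      case False
      then have "s \<in> ?K" using inv gens by blast
      then show ?thesis by (intro bexI[of _ "inv\<^bsub>free_group n\<^esub> s"] exI[of _ 0]) auto
    qed
  next
    case (eng h1 h2)
    from eng.IH obtain k1 k2 and e1 e2 :: int where k: "k1 \<in> ?K" "k2 \<in> ?K"
      and h: "h1 = k1 \<otimes>\<^bsub>free_group n\<^esub> g x [^]\<^bsub>free_group n\<^esub> e1" "h2 = k2 \<otimes>\<^bsub>free_group n\<^esub> g x [^]\<^bsub>free_group n\<^esub> e2"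
      by blast
    let ?c = "g x [^]\<^bsub>free_group n\<^esub> e1 \<otimes>\<^bsub>free_group n\<^esub> k2 \<otimes>\<^bsub>free_group n\<^esub> inv\<^bsub>free_group n\<^esub> (g x [^]\<^bsub>free_group n\<^esub> e1)"
    have "k1 \<otimes>\<^bsub>free_group n\<^esub> ?c \<in> ?K" using k conj_pow_span_mod[OF fam x k(2)] by simp
    moreover have "h1 \<otimes>\<^bsub>free_group n\<^esub> h2 = (k1 \<otimes>\<^bsub>free_group n\<^esub> ?c) \<otimes>\<^bsub>free_group n\<^esub> g x [^]\<^bsub>free_group n\<^esub> (e1 + e2)"
      using k[THEN K.mem_carrier] gx by (simp add: h F.int_pow_mult F.group_word_simps)
    ultimately show ?case by blast
  qed
qed

lemma leads_pow:
  fixes e :: int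
  assumes "h \<in> carrier (free_group n)" "1 \<le> w" "leads w h v"
  shows "leads w (h [^]\<^bsub>free_group n\<^esub> e) (of_int e * v)"
proof (induction e rule: int_induct[of _ 0])
  case base
  then show ?case by (simp add: leads_one)
next
  case (step1 i)
  have "h [^]\<^bsub>free_group n\<^esub> (i + 1) = h [^]\<^bsub>free_group n\<^esub> i \<otimes>\<^bsub>free_group n\<^esub> h"
    using assms by (simp add: F.int_pow_mult)
  then show ?case using leads_mult[OF assms(2) step1(2) assms(3)] by (simp add: distrib_right)
next
  case (step2 i)
  have "h [^]\<^bsub>free_group n\<^esub> (i - 1) = h [^]\<^bsub>free_group n\<^esub> i \<otimes>\<^bsub>free_group n\<^esub> inv\<^bsub>free_group n\<^esub> h"
    using assms by (simp add: F.int_pow_diff)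
  then show ?case using leads_mult[OF assms(2) step2(2) leads_inv[OF assms(1,3)]]
    by (simp add: left_diff_distrib)
qed

text \<open>As \<open>w x\<close> is least, a generator of the new span has order above
  \<open>w x\<close> unless it is some \<open>g y\<close> itself with \<open>w y = w x\<close>.
  Hence \<open>u x\<close> does not enter the component of degree \<open>w x\<close>.\<close>

lemma span_mod_leads:
  assumes fam: "free_family n d X w g u" and x: "x \<in> X" and min: "\<And>i. i \<in> X \<Longrightarrow> w x \<le> w i"
    and k: "k \<in> span_mod n d (elim_set x X w d) (elim_grp (free_group n) x g)"
  shows "\<exists>c :: nat \<Rightarrow> int. leads (w x) k (\<Sum>y\<in>{y \<in> X - {x}. w y = w x}. of_int (c y) * u y)"
proof -
  let ?Y = "{y \<in> X - {x}. w y = w x}"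
  have w: "1 \<le> w x" "w x \<le> d" and Y: "finite ?Y" using fam x by (auto simp: free_family_def)
  have zero: "\<exists>c :: nat \<Rightarrow> int. leads (w x) k (\<Sum>y\<in>?Y. of_int (c y) * u y)"
    if "low (Suc (w x)) (magnus k - 1)" for k
    using that by (intro exI[of _ "\<lambda>_. 0"]) (simp add: leads_def homogeneous_def)
  have gens: "s \<in> carrier (free_group n) \<and> (\<exists>c :: nat \<Rightarrow> int. leads (w x) s (\<Sum>y\<in>?Y. of_int (c y) * u y))"
    if s: "s \<in> elim_grp (free_group n) x g ` elim_set x X w d \<union> lcs (free_group n) (Suc d)" for s
    using s
  proof
    assume "s \<in> elim_grp (free_group n) x g ` elim_set x X w d"
    then obtain y m where y: "y \<in> X" "y \<noteq> x" and s: "s = comm_pow (free_group n) (g y) (g x) m"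
      by (auto simp: elim_set_def elim_grp_def)
    have *: "s \<in> lcs (free_group n) (w y + m * w x)" "leads (w y + m * w x) s (ad_pow (u y) (u x) m)"
      using comm_pow_lcs_leads[of "g y" "w y" "g x" "w x"] fam x y by (auto simp: free_family_def s)
    show ?thesis
    proof (cases "m = 0 \<and> w y = w x")
      case True
      then have "leads (w x) s (u y)" using * by simp
      moreover have "(\<Sum>z\<in>?Y. of_int (if z = y then 1 else 0) * u z) = (\<Sum>z\<in>?Y. if z = y then u z else 0)"
        by (intro sum.cong) simp_all
      moreover have "\<dots> = u y" using True y Y by simp
      ultimately have "leads (w x) s (\<Sum>z\<in>?Y. of_int (if z = y then 1 else 0) * u z)" by simp
      then show ?thesis by (intro conjI F.lcs_closed(4)[OF *(1)] exI[of _ "\<lambda>z. if z = y then 1 else 0"])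
    next
      case False
      have "w x < w y + m * w x"
      proof (cases m)
        case 0
        then show ?thesis using False min[OF y(1)] by simp
      next
        case (Suc m')
        then show ?thesis using min[OF y(1)] w(1) by simp
      qed
      then have "low (Suc (w x)) (magnus s - 1)"
        by (intro low_mono[OF leads_low[OF *(2)]]) simp
      then show ?thesis by (intro conjI F.lcs_closed(4)[OF *(1)] zero)
    qed
  next
    assume s: "s \<in> lcs (free_group n) (Suc d)"
    have "low (Suc (w x)) (magnus s - 1)"
      by (rule low_mono[OF lcs_low_magnus[OF s]]) (use w in simp)
    then show ?thesis by (intro conjI F.lcs_closed(4)[OF s] zero)
  qed
  have "k \<in> generate (free_group n) (elim_grp (free_group n) x g ` elim_set x X w d \<union> lcs (free_group n) (Suc d))"
    using k by (simp add: span_mod_def)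
  then show ?thesis
  proof (induction rule: generate.induct)
    case one
    then show ?case using zero by (simp add: magnus_one)
  next
    case (incl s)
    then show ?case using gens by blast
  next
    case (inv s)
    then obtain c :: "nat \<Rightarrow> int" where "leads (w x) s (\<Sum>y\<in>?Y. of_int (c y) * u y)" "s \<in> carrier (free_group n)"
      using gens by blast
    from leads_inv[OF this(2,1)] show ?case
      by (intro exI[of _ "\<lambda>y. - c y"]) (simp add: sum_negf)
  next
    case (eng h1 h2)
    then obtain c1 c2 :: "nat \<Rightarrow> int" where "leads (w x) h1 (\<Sum>y\<in>?Y. of_int (c1 y) * u y)"
      "leads (w x) h2 (\<Sum>y\<in>?Y. of_int (c2 y) * u y)" by blast
    from leads_mult[OF w(1) this] show ?case
      by (intro exI[of _ "\<lambda>y. c1 y + c2 y"]) (simp add: sum.distrib distrib_right)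
  qed
qed

text \<open>Write \<open>h\<close> as \<open>k\<close> times the power \<open>e\<close> of
  \<open>g x\<close>. Its component of degree \<open>w x\<close> is \<open>e\<close> times
  \<open>u x\<close> plus a combination of other \<open>u y\<close>; it vanishes because
  \<open>w x \<le> d\<close>, and independence gives \<open>e = 0\<close>.\<close>

lemma span_mod_eliminate:
  assumes fam: "free_family n d X w g u" and x: "x \<in> X" and min: "\<And>i. i \<in> X \<Longrightarrow> w x \<le> w i"
    and h: "h \<in> span_mod n d X g" and low: "low (Suc d) (magnus h - 1)"
  shows "h \<in> span_mod n d (elim_set x X w d) (elim_grp (free_group n) x g)"
proof -
  let ?K = "span_mod n d (elim_set x X w d) (elim_grp (free_group n) x g)"
  let ?Y = "{y \<in> X - {x}. w y = w x}"
  interpret K: subgroup ?K "free_group n"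
    by (rule span_mod_subgroup[OF elim_free_family[OF fam x]])
  have w: "1 \<le> w x" "w x \<le> d" and Y: "finite ?Y" and ind: "words_independent X w u d"
    and gx_lead: "leads (w x) (g x) (u x)"
    using fam x by (auto simp: free_family_def)
  have gx: "g x \<in> carrier (free_group n)" using span_mod_carrier[OF fam] x by blast
  obtain k and e :: int where k: "k \<in> ?K" and hk: "h = k \<otimes>\<^bsub>free_group n\<^esub> g x [^]\<^bsub>free_group n\<^esub> e"
    using span_mod_decompose[OF fam x h] by blast
  obtain c :: "nat \<Rightarrow> int" where c: "leads (w x) k (\<Sum>y\<in>?Y. of_int (c y) * u y)"
    using span_mod_leads[OF fam x min k] by blast
  let ?u = "(\<Sum>y\<in>?Y. of_int (c y) * u y) + of_int e * u x"
  have lead: "leads (w x) h ?u"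
    unfolding hk by (rule leads_mult[OF w(1) c leads_pow[OF gx w(1) gx_lead]])
  then have hom: "homogeneous (w x) ?u" and l: "low (Suc (w x)) (magnus h - 1 - ?u)"
    by (simp_all only: leads_def)
  have "low (Suc (w x)) (magnus h - 1)" by (rule low_mono[OF low]) (use w in simp)
  from low_diff_cancel[OF this l] have "low (Suc (w x)) ?u" .
  then have zero: "?u = 0" by (rule homogeneous_low_imp_0[OF hom])
  \<comment> \<open>Independence is stated for words, so \<open>c\<close> and \<open>e\<close>
    become coefficients of one-letter words; \<open>hd W\<close> recovers the letter.\<close>
  define c' where "c' W = (if hd W = x then e else c (hd W))" for W :: "nat list"
  define S where "S = (\<lambda>y. [y]) ` insert x ?Y"
  have "inj_on (\<lambda>y. [y]) (insert x ?Y)" by (simp add: inj_on_def)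
  then have "(\<Sum>W\<in>S. of_int (c' W) * word_prod u W) = (\<Sum>y\<in>insert x ?Y. of_int (c' [y]) * u y)"
    unfolding S_def by (subst sum.reindex) (simp_all only: o_def word_prod_def list.map prod_list.Cons prod_list.Nil mult_1_right)
  also have "\<dots> = ?u"
  proof -
    have "(\<Sum>y\<in>?Y. of_int (c' [y]) * u y) = (\<Sum>y\<in>?Y. of_int (c y) * u y)"
      by (intro sum.cong) (auto simp: c'_def)
    then show ?thesis using Y by (simp add: c'_def add.commute)
  qed
  finally have "(\<Sum>W\<in>S. of_int (c' W) * word_prod u W) = 0" using zero by simp
  moreover have "finite S" "S \<subseteq> words X w d" "[x] \<in> S"
    using Y x w by (auto simp: S_def words_def)
  ultimately have "c' [x] = 0" using words_independentD[OF ind] by blast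
  then have "e = 0" by (simp add: c'_def)
  then show ?thesis using k K.mem_carrier[OF k] by (simp add: hk)
qed

text \<open>The termination measure: a commutator with at least one \<open>x\<close> has weight
  above \<open>w x\<close>, so weight \<open>w x\<close> is left only to old elements, and
  \<open>x\<close> itself is gone.\<close>

lemma elim_set_min_card:
  assumes fam: "free_family n d X w g u" and x: "x \<in> X" and min: "\<And>i. i \<in> X \<Longrightarrow> w x \<le> w i"
  shows "i \<in> elim_set x X w d \<Longrightarrow> w x \<le> elim_weight x w i"
    and "card {i \<in> elim_set x X w d. elim_weight x w i = w x} < card {i \<in> X. w i = w x}"
proof -
  have w: "1 \<le> w x" "w x \<le> d" and X: "finite X" using fam x by (auto simp: free_family_def)
  show "w x \<le> elim_weight x w i" if i: "i \<in> elim_set x X w d" for i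
  proof -
    obtain y m where "i = prod_encode (y, m)" "y \<in> X" using i by (auto simp: elim_set_def)
    then show ?thesis using min[of y] by (simp add: elim_weight_def)
  qed
  have m0: "m = 0" if "y \<in> X" "w y + m * w x = w x" for y m
  proof (cases m)
    case (Suc m')
    then have "w y + w x \<le> w x" using that(2) by simp
    then show ?thesis using min[OF that(1)] w by simp
  qed
  have "{i \<in> elim_set x X w d. elim_weight x w i = w x} \<subseteq> (\<lambda>y. prod_encode (y, 0)) ` ({i \<in> X. w i = w x} - {x})"
    using m0 by (force simp: elim_set_def elim_weight_def)
  then have "card {i \<in> elim_set x X w d. elim_weight x w i = w x} \<le> card ({i \<in> X. w i = w x} - {x})"
    using X by (intro surj_card_le) simp_all
  also have "\<dots> < card {i \<in> X. w i = w x}"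
    using X x by (intro psubset_card_mono) auto
  finally show "card {i \<in> elim_set x X w d. elim_weight x w i = w x} < card {i \<in> X. w i = w x}" .
qed

text \<open>Two nested inductions: \<open>j\<close> bounds the distance of the weights from
  \<open>Suc d\<close>, the inner count is the number of elements at the current lower bound. Once
  the lower bound is \<open>Suc d\<close> the family is empty and the span is Gamma_(d+1)
  itself.\<close>

lemma span_mod_kernel:
  assumes low: "low (Suc d) (magnus h - 1)"
    and "free_family n d X w g u" "\<forall>i\<in>X. Suc d - j \<le> w i" "h \<in> span_mod n d X g"
  shows "h \<in> lcs (free_group n) (Suc d)"
  using assms(2-4)
proof (induction j arbitrary: X w g u)
  case 0
  then have "X = {}" by (fastforce simp: free_family_def)
  then have "h \<in> generate (free_group n) (lcs (free_group n) (Suc d))"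
    using 0 by (simp add: span_mod_def)
  then show ?case
    by (rule subsetD[OF F.generate_subgroup_incl[OF subset_refl normal_imp_subgroup[OF F.lcs_normal]]])
next
  case (Suc j)
  define e where "e = Suc d - Suc j"
  have e: "Suc d - j \<le> m" if "e \<le> m" "m \<noteq> e" for m
    using that by (simp add: e_def)
  have "h \<in> lcs (free_group n) (Suc d)"
    if "card {i \<in> X. w i = e} = c" "free_family n d X w g u" "\<forall>i\<in>X. e \<le> w i"
      "h \<in> span_mod n d X g" for c X w g u
    using that
  proof (induction c arbitrary: X w g u rule: less_induct)
    case (less c)
    show ?case
    proof (cases "\<exists>x\<in>X. w x = e")
      case False
      then have "\<forall>i\<in>X. Suc d - j \<le> w i" using less.prems(3) e by blast
      then show ?thesis by (rule Suc.IH[OF less.prems(2) _ less.prems(4)])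
    next
      case True
      then obtain x where x: "x \<in> X" and wx: "w x = e" by blast
      have min: "w x \<le> w i" if "i \<in> X" for i using less.prems(3) that wx by simp
      have card: "card {i \<in> elim_set x X w d. elim_weight x w i = e} < c"
        using elim_set_min_card(2)[OF less.prems(2) x min] less.prems(1) wx by simp
      have ge: "\<forall>i\<in>elim_set x X w d. e \<le> elim_weight x w i"
        using elim_set_min_card(1)[OF less.prems(2) x min] wx by simp
      show ?thesis
        by (rule less.IH[OF card refl elim_free_family[OF less.prems(2) x] ge
              span_mod_eliminate[OF less.prems(2) x min less.prems(4) low]])
    qed
  qed
  from this[OF refl Suc.prems(1) Suc.prems(2)[folded e_def] Suc.prems(3)] show ?case .
qed

text \<open>The Magnus-Witt theorem. The elimination starts from the generators of the free group,
  all of weight 1, whose leading terms are the variables.\<close>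

theorem lcs_iff_low_magnus:
  assumes g: "g \<in> carrier (free_group n)"
  shows "g \<in> lcs (free_group n) k \<longleftrightarrow> low k (magnus g - 1)"
proof
  assume low: "low k (magnus g - 1)"
  show "g \<in> lcs (free_group n) k"
  proof (cases "k \<le> 1")
    case True
    then show ?thesis using g by (cases k) auto
  next
    case False
    then obtain d where k: "k = Suc d" and d: "1 \<le> d" by (cases k) auto
    have "leads 1 (fgen i) (ncs_var i)" for i
      unfolding leads_def by (simp add: magnus_fgen homogeneous_var[simplified])
    then have fam: "free_family n d {1..n} (\<lambda>_. 1) fgen ncs_var"
      using d fgen_closed by (auto simp: free_family_def var_independent)
    interpret H: subgroup "span_mod n d {1..n} fgen" "free_group n"
      by (rule span_mod_subgroup[OF fam])
    have fgen_span: "fgen i \<in> span_mod n d {1..n} fgen" if "i \<in> {1..n}" for i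
      unfolding span_mod_def using that by (intro generate.incl) blast
    have "g \<in> span_mod n d {1..n} fgen"
      using g
    proof (induction rule: free_group_induct)
      case (gen k g)
      then show ?case by (intro H.m_closed fgen_span)
    next
      case (inv k g)
      then show ?case by (intro H.m_closed H.m_inv_closed fgen_span)
    qed (rule H.one_closed)
    \<comment> \<open>The starting value is \<open>j = d\<close>, since all weights equal
      \<open>1 = Suc d - d\<close>.\<close>
    then show ?thesis using span_mod_kernel[OF low[unfolded k] fam, of d] by (simp add: k)
  qed
qed (rule lcs_low_magnus)

end

section \<open>Conjugations of free factors\<close>

text \<open>\<open>normalize\<close> does not see the rank, so F_p is a subset of F_n with the same
  product. Inverses are chosen inside the carrier and need the separate argument of
  \<open>inv_free_group_cong\<close>.\<close>

lemma mult_free_group_cong: "x \<otimes>\<^bsub>free_group p\<^esub> y = x \<otimes>\<^bsub>free_group n\<^esub> y"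
  by (simp add: mult_free_group)

lemma free_group_mono: "p \<le> n \<Longrightarrow> carrier (free_group p) \<subseteq> carrier (free_group n)"
  by (auto simp: carrier_free_group)

lemma inv_free_group_cong:
  assumes "p \<le> n" "g \<in> carrier (free_group p)"
  shows "inv\<^bsub>free_group n\<^esub> g = inv\<^bsub>free_group p\<^esub> g"
proof -
  interpret P: group "free_group p" by (rule group_free_group)
  interpret N: group "free_group n" by (rule group_free_group)
  have "inv\<^bsub>free_group p\<^esub> g \<otimes>\<^bsub>free_group n\<^esub> g = \<one>\<^bsub>free_group n\<^esub>"
    using P.l_inv[OF assms(2)] by (simp add: mult_free_group one_free_group)
  then show ?thesis
    using assms free_group_mono[OF assms(1)] P.inv_closed[OF assms(2)] by (intro N.inv_equality) auto
qed

lemma hom_free_group_mono: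
  "p \<le> n \<Longrightarrow> h \<in> hom (free_group n) G \<Longrightarrow> h \<in> hom (free_group p) G"
  using free_group_mono[of p n] by (auto simp: hom_def mult_free_group_cong[of p _ _ n] Pi_iff subset_iff)

text \<open>Conjugation is taken as \<open>g y g^-1\<close>, opposite to \<open>nu\<close>, so that
  \<open>g \<mapsto> factor_conj n p g\<close> is a homomorphism on F_p; \<open>nu n p i\<close> is
  its value at the inverse of x_i.\<close>

definition factor_conj :: "nat \<Rightarrow> nat \<Rightarrow> fletter list \<Rightarrow> fletter list \<Rightarrow> fletter list" where
  "factor_conj n p g = (\<lambda>w \<in> carrier (free_group n). word_eval (free_group n)
    (\<lambda>k. if 1 \<le> k \<and> k \<le> p
         then g \<otimes>\<^bsub>free_group n\<^esub> fgen k \<otimes>\<^bsub>free_group n\<^esub> inv\<^bsub>free_group n\<^esub> g else fgen k) w)"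

context
  fixes n :: nat
begin

interpretation F: group "free_group n" by (rule group_free_group)

lemma nu_eq_factor_conj: "i \<in> {1..n} \<Longrightarrow> nu n p i = factor_conj n p (inv\<^bsub>free_group n\<^esub> (fgen i))"
  unfolding nu_def factor_conj_def by (simp only: F.inv_inv fgen_closed)

lemma factor_conj_hom:
  assumes "g \<in> carrier (free_group n)"
  shows "factor_conj n p g \<in> hom (free_group n) (free_group n)"
proof -
  have "word_eval (free_group n)
    (\<lambda>k. if 1 \<le> k \<and> k \<le> p
         then g \<otimes>\<^bsub>free_group n\<^esub> fgen k \<otimes>\<^bsub>free_group n\<^esub> inv\<^bsub>free_group n\<^esub> g else fgen k)
      \<in> hom (free_group n) (free_group n)"
    by (rule F.word_eval_hom) (simp add: assms fgen_closed)
  then show ?thesis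
    by (simp add: factor_conj_def hom_def Pi_iff)
qed

lemma factor_conj_closed:
  "g \<in> carrier (free_group n) \<Longrightarrow> w \<in> carrier (free_group n) \<Longrightarrow> factor_conj n p g w \<in> carrier (free_group n)"
  using factor_conj_hom by (auto simp: hom_def)

lemma factor_conj_fgen:
  assumes "g \<in> carrier (free_group n)" "k \<in> {1..n}"
  shows "factor_conj n p g (fgen k) = (if k \<le> p
    then g \<otimes>\<^bsub>free_group n\<^esub> fgen k \<otimes>\<^bsub>free_group n\<^esub> inv\<^bsub>free_group n\<^esub> g else fgen k)"
  using assms fgen_closed[OF assms(2)] by (simp add: factor_conj_def F.word_eval_fgen)

lemma conj_hom:
  assumes "g \<in> carrier (free_group n)"
  shows "(\<lambda>y. g \<otimes>\<^bsub>free_group n\<^esub> y \<otimes>\<^bsub>free_group n\<^esub> inv\<^bsub>free_group n\<^esub> g) \<in> hom (free_group n) (free_group n)"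
  using assms by (auto intro!: homI simp: F.group_word_simps)

lemma factor_conj_factor:
  assumes "p \<le> n" "g \<in> carrier (free_group n)" "y \<in> carrier (free_group p)"
  shows "factor_conj n p g y = g \<otimes>\<^bsub>free_group n\<^esub> y \<otimes>\<^bsub>free_group n\<^esub> inv\<^bsub>free_group n\<^esub> g"
proof (rule free_group_hom_eq[OF group_free_group _ _ _ assms(3)])
  show "factor_conj n p g \<in> hom (free_group p) (free_group n)"
    by (rule hom_free_group_mono[OF assms(1) factor_conj_hom[OF assms(2)]])
  show "(\<lambda>y. g \<otimes>\<^bsub>free_group n\<^esub> y \<otimes>\<^bsub>free_group n\<^esub> inv\<^bsub>free_group n\<^esub> g) \<in> hom (free_group p) (free_group n)"
    by (rule hom_free_group_mono[OF assms(1) conj_hom[OF assms(2)]])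
qed (use assms in \<open>auto simp: factor_conj_fgen\<close>)

text \<open>Because \<open>h\<close> lies in F_p, the inner map sends x_1, ..., x_p into F_p, where
  the outer one is honest conjugation by \<open>g\<close>.\<close>

lemma factor_conj_mult:
  assumes "p \<le> n" "g \<in> carrier (free_group p)" "h \<in> carrier (free_group p)" "w \<in> carrier (free_group n)"
  shows "factor_conj n p g (factor_conj n p h w) = factor_conj n p (g \<otimes>\<^bsub>free_group n\<^esub> h) w"
proof -
  interpret P: group "free_group p" by (rule group_free_group)
  have gh: "g \<in> carrier (free_group n)" "h \<in> carrier (free_group n)" "g \<otimes>\<^bsub>free_group n\<^esub> h \<in> carrier (free_group n)"
    using assms free_group_mono[OF assms(1)] by auto
  have "(factor_conj n p g \<circ> factor_conj n p h) w = factor_conj n p (g \<otimes>\<^bsub>free_group n\<^esub> h) w"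
  proof (rule free_group_hom_eq[OF group_free_group _ factor_conj_hom[OF gh(3)] _ assms(4)])
    show "factor_conj n p g \<circ> factor_conj n p h \<in> hom (free_group n) (free_group n)"
      using factor_conj_hom gh by (intro Group.hom_compose)
    fix k assume k: "k \<in> {1..n}"
    show "(factor_conj n p g \<circ> factor_conj n p h) (fgen k) = factor_conj n p (g \<otimes>\<^bsub>free_group n\<^esub> h) (fgen k)"
    proof (cases "k \<le> p")
      case True
      then have "fgen k \<in> carrier (free_group p)" using k fgen_closed by simp
      then have "h \<otimes>\<^bsub>free_group p\<^esub> fgen k \<otimes>\<^bsub>free_group p\<^esub> inv\<^bsub>free_group p\<^esub> h \<in> carrier (free_group p)"
        using assms by simp
      then have "h \<otimes>\<^bsub>free_group n\<^esub> fgen k \<otimes>\<^bsub>free_group n\<^esub> inv\<^bsub>free_group n\<^esub> h \<in> carrier (free_group p)"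
        using assms by (simp add: inv_free_group_cong mult_free_group_cong[of p _ _ n])
      then show ?thesis
        using True k gh assms(1) fgen_closed[OF k]
        by (simp add: factor_conj_fgen factor_conj_factor F.group_word_simps)
    qed (use k gh in \<open>simp add: factor_conj_fgen\<close>)
  qed
  then show ?thesis by simp
qed

lemma factor_conj_one:
  assumes w: "w \<in> carrier (free_group n)" shows "factor_conj n p \<one>\<^bsub>free_group n\<^esub> w = w"
proof (rule free_group_hom_eq[OF group_free_group _ _ _ w])
  show "(\<lambda>w. w) \<in> hom (free_group n) (free_group n)" by (simp add: hom_def)
qed (use fgen_closed in \<open>simp_all add: factor_conj_hom factor_conj_fgen\<close>)

section \<open>The automorphism group and the image of F_p in it\<close>

lemma group_Aut_F: "group (Aut_F n)"
  unfolding Aut_F_def by (rule F.AutoGroup)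

lemma carrier_Aut_F:
  "\<phi> \<in> carrier (Aut_F n) \<longleftrightarrow> \<phi> \<in> hom (free_group n) (free_group n) \<and>
    \<phi> \<in> extensional (carrier (free_group n)) \<and> bij_betw \<phi> (carrier (free_group n)) (carrier (free_group n))"
  by (simp add: Aut_F_def AutoGroup_def auto_def Bij_def)

lemma mult_Aut_F:
  assumes "\<phi> \<in> carrier (Aut_F n)" "\<psi> \<in> carrier (Aut_F n)"
  shows "\<phi> \<otimes>\<^bsub>Aut_F n\<^esub> \<psi> = compose (carrier (free_group n)) \<phi> \<psi>"
  using assms by (simp add: Aut_F_def AutoGroup_def BijGroup_def auto_def)

lemma mult_Aut_F_apply:
  assumes "\<phi> \<in> carrier (Aut_F n)" "\<psi> \<in> carrier (Aut_F n)" "w \<in> carrier (free_group n)"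
  shows "(\<phi> \<otimes>\<^bsub>Aut_F n\<^esub> \<psi>) w = \<phi> (\<psi> w)"
  using assms by (simp add: mult_Aut_F compose_def)

lemma one_Aut_F: "\<one>\<^bsub>Aut_F n\<^esub> = (\<lambda>w \<in> carrier (free_group n). w)"
  by (simp add: Aut_F_def AutoGroup_def BijGroup_def)

lemma Aut_F_closed: "\<phi> \<in> carrier (Aut_F n) \<Longrightarrow> w \<in> carrier (free_group n) \<Longrightarrow> \<phi> w \<in> carrier (free_group n)"
  unfolding carrier_Aut_F by (meson hom_in_carrier)

lemma Aut_F_mult: "\<phi> \<in> carrier (Aut_F n) \<Longrightarrow> v \<in> carrier (free_group n) \<Longrightarrow> w \<in> carrier (free_group n) \<Longrightarrow>
    \<phi> (v \<otimes>\<^bsub>free_group n\<^esub> w) = \<phi> v \<otimes>\<^bsub>free_group n\<^esub> \<phi> w"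
  unfolding carrier_Aut_F by (meson hom_mult)

lemma Aut_F_group_hom: "\<phi> \<in> carrier (Aut_F n) \<Longrightarrow> group_hom (free_group n) (free_group n) \<phi>"
  by (simp add: carrier_Aut_F group_hom_def group_hom_axioms_def group_free_group)

lemma Aut_F_eqI:
  assumes "\<phi> \<in> carrier (Aut_F n)" "\<psi> \<in> carrier (Aut_F n)"
    and "\<And>k. k \<in> {1..n} \<Longrightarrow> \<phi> (fgen k) = \<psi> (fgen k)"
  shows "\<phi> = \<psi>"
proof (rule extensionalityI)
  show "\<phi> \<in> extensional (carrier (free_group n))" "\<psi> \<in> extensional (carrier (free_group n))"
    using assms(1,2) unfolding carrier_Aut_F by blast+
  fix w assume w: "w \<in> carrier (free_group n)"
  have "\<phi> \<in> hom (free_group n) (free_group n)" "\<psi> \<in> hom (free_group n) (free_group n)"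
    using assms(1,2) unfolding carrier_Aut_F by blast+
  from free_group_hom_eq[OF group_free_group this assms(3) w] show "\<phi> w = \<psi> w" .
qed

lemma factor_conj_Aut:
  assumes "p \<le> n" "g \<in> carrier (free_group p)"
  shows "factor_conj n p g \<in> carrier (Aut_F n)"
proof -
  interpret P: group "free_group p" by (rule group_free_group)
  have g: "g \<in> carrier (free_group n)" using assms free_group_mono by blast
  let ?i = "inv\<^bsub>free_group n\<^esub> g"
  have ip: "?i \<in> carrier (free_group p)" using assms by (simp add: inv_free_group_cong)
  have "factor_conj n p g (factor_conj n p ?i w) = w" "factor_conj n p ?i (factor_conj n p g w) = w"
    if "w \<in> carrier (free_group n)" for w
    using that factor_conj_mult[OF assms(1) assms(2) ip that] factor_conj_mult[OF assms(1) ip assms(2) that] g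
    by (simp_all add: factor_conj_one)
  then have "bij_betw (factor_conj n p g) (carrier (free_group n)) (carrier (free_group n))"
    using factor_conj_closed[OF g] factor_conj_closed[OF F.inv_closed[OF g]]
    by (intro bij_betw_byWitness[of _ "factor_conj n p ?i"]) auto
  then show ?thesis
    using factor_conj_hom[OF g] by (simp add: carrier_Aut_F factor_conj_def)
qed

lemma factor_conj_group_hom:
  assumes "p \<le> n" shows "group_hom (free_group p) (Aut_F n) (factor_conj n p)"
proof -
  have "factor_conj n p \<in> hom (free_group p) (Aut_F n)"
  proof (rule homI)
    fix g h assume gh: "g \<in> carrier (free_group p)" "h \<in> carrier (free_group p)"
    interpret P: group "free_group p" by (rule group_free_group)
    have "g \<otimes>\<^bsub>free_group p\<^esub> h \<in> carrier (free_group p)" using gh by simp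
    then have gh': "g \<otimes>\<^bsub>free_group n\<^esub> h \<in> carrier (free_group p)" by (simp add: mult_free_group)
    show "factor_conj n p (g \<otimes>\<^bsub>free_group p\<^esub> h) = factor_conj n p g \<otimes>\<^bsub>Aut_F n\<^esub> factor_conj n p h"
      unfolding mult_free_group_cong[of p g h n]
    proof (rule extensionalityI)
      show "factor_conj n p (g \<otimes>\<^bsub>free_group n\<^esub> h) \<in> extensional (carrier (free_group n))"
        by (simp add: factor_conj_def)
      show "factor_conj n p g \<otimes>\<^bsub>Aut_F n\<^esub> factor_conj n p h \<in> extensional (carrier (free_group n))"
        using assms gh by (simp add: mult_Aut_F factor_conj_Aut)
    qed (use assms gh in \<open>simp add: mult_Aut_F_apply factor_conj_Aut factor_conj_mult\<close>)
  qed (use assms in \<open>simp add: factor_conj_Aut\<close>)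
  then show ?thesis
    by (simp add: group_hom_def group_hom_axioms_def group_free_group group_Aut_F)
qed

end

text \<open>The stages I_q of a tower, all inside the same Aut(F_n): stage 1 is trivial because
  \<open>2 \<le> p\<close>, and stage \<open>n\<close> is I_n.\<close>

definition partial_inner_upto :: "nat \<Rightarrow> nat \<Rightarrow> (fletter list \<Rightarrow> fletter list) set" where
  "partial_inner_upto n q = generate (Aut_F n) {nu n p i | p i. 2 \<le> p \<and> p \<le> q \<and> 1 \<le> i \<and> i \<le> p}"

lemma partial_inner_eq: "partial_inner n = partial_inner_upto n n"
  by (simp add: partial_inner_def partial_inner_upto_def)

context
  fixes n :: nat
begin

interpretation F: group "free_group n" by (rule group_free_group)
interpretation Aut: group "Aut_F n" by (rule group_Aut_F)

lemma nu_factor_conj: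
  assumes "p \<le> n" "i \<in> {1..p}"
  shows "nu n p i = factor_conj n p (inv\<^bsub>free_group p\<^esub> (fgen i))"
    and "inv\<^bsub>Aut_F n\<^esub> (nu n p i) = factor_conj n p (fgen i)"
    and "nu n p i \<in> carrier (Aut_F n)"
proof -
  interpret C: group_hom "free_group p" "Aut_F n" "factor_conj n p"
    by (rule factor_conj_group_hom[OF assms(1)])
  have i: "fgen i \<in> carrier (free_group p)" using assms fgen_closed by simp
  have "i \<in> {1..n}" using assms by simp
  then show *: "nu n p i = factor_conj n p (inv\<^bsub>free_group p\<^esub> (fgen i))"
    using i assms by (simp only: nu_eq_factor_conj inv_free_group_cong)
  show "inv\<^bsub>Aut_F n\<^esub> (nu n p i) = factor_conj n p (fgen i)"
    unfolding * using i by simp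
  show "nu n p i \<in> carrier (Aut_F n)"
    unfolding * using i by simp
qed

lemma partial_inner_upto_gens_carrier:
  "q \<le> n \<Longrightarrow> {nu n p i | p i. 2 \<le> p \<and> p \<le> q \<and> 1 \<le> i \<and> i \<le> p} \<subseteq> carrier (Aut_F n)"
  using nu_factor_conj(3) by fastforce

lemma subgroup_partial_inner_upto: "q \<le> n \<Longrightarrow> subgroup (partial_inner_upto n q) (Aut_F n)"
  unfolding partial_inner_upto_def by (intro Aut.generate_is_subgroup partial_inner_upto_gens_carrier)

text \<open>Both \<open>nu n p i\<close> and its inverse are conjugations by elements of F_p, so a
  single case covers generators and inverses.\<close>

lemma partial_inner_upto_induct [consumes 2, case_names one conj mult]:
  assumes \<phi>: "\<phi> \<in> partial_inner_upto n q" and q: "q \<le> n"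
    and one: "P \<one>\<^bsub>Aut_F n\<^esub>"
    and conj: "\<And>p a. \<lbrakk>2 \<le> p; p \<le> q; a \<in> carrier (free_group p)\<rbrakk> \<Longrightarrow> P (factor_conj n p a)"
    and mult: "\<And>\<phi> \<psi>. \<lbrakk>\<phi> \<in> partial_inner_upto n q; \<psi> \<in> partial_inner_upto n q; P \<phi>; P \<psi>\<rbrakk> \<Longrightarrow>
      P (\<phi> \<otimes>\<^bsub>Aut_F n\<^esub> \<psi>)"
  shows "P \<phi>"
  using \<phi> unfolding partial_inner_upto_def
proof (induction rule: generate.induct)
  case one
  show ?case by (rule assms(3))
next
  case (incl h)
  then obtain p i where h: "h = nu n p i" and pi: "2 \<le> p" "p \<le> q" "i \<in> {1..p}" by auto
  interpret P: group "free_group p" by (rule group_free_group)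
  have "inv\<^bsub>free_group p\<^esub> (fgen i) \<in> carrier (free_group p)"
    using fgen_closed[OF pi(3)] by simp
  then show ?case using conj[OF pi(1,2)] nu_factor_conj(1)[OF _ pi(3)] pi(2) q by (simp add: h)
next
  case (inv h)
  then obtain p i where h: "h = nu n p i" and pi: "2 \<le> p" "p \<le> q" "i \<in> {1..p}" by auto
  then show ?case using conj[OF pi(1,2) fgen_closed[OF pi(3)]] nu_factor_conj(2)[OF _ pi(3)] pi(2) q
    by simp
next
  case (eng h1 h2)
  then show ?case by (intro mult) (simp_all add: partial_inner_upto_def)
qed

text \<open>\<open>factor_conj n p\<close> is a homomorphism sending the generators of F_p to the
  inverses of the \<open>nu n p i\<close>.\<close>

lemma factor_conj_partial_inner:
  assumes "2 \<le> p" "p \<le> q" "q \<le> n" and g: "g \<in> carrier (free_group p)"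
  shows "factor_conj n p g \<in> partial_inner_upto n q"
proof -
  have pn: "p \<le> n" using assms by simp
  interpret P: group "free_group p" by (rule group_free_group)
  interpret C: group_hom "free_group p" "Aut_F n" "factor_conj n p"
    by (rule factor_conj_group_hom[OF pn])
  interpret I: subgroup "partial_inner_upto n q" "Aut_F n"
    by (rule subgroup_partial_inner_upto[OF assms(3)])
  have nu: "nu n p i \<in> partial_inner_upto n q" if "i \<in> {1..p}" for i
    unfolding partial_inner_upto_def using that assms(1,2) by (intro generate.incl) auto
  have fgen: "fgen i \<in> carrier (free_group p)" if "i \<in> {1..p}" for i
    using that by (rule fgen_closed)
  show ?thesis using g
  proof (induction rule: free_group_induct)
    case one
    show ?case using C.hom_one I.one_closed by simp
  next
    case (gen i g)
    have "factor_conj n p (fgen i \<otimes>\<^bsub>free_group p\<^esub> g) = inv\<^bsub>Aut_F n\<^esub> (nu n p i) \<otimes>\<^bsub>Aut_F n\<^esub> factor_conj n p g"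
      by (simp only: C.hom_mult fgen[OF gen(1)] gen(2) nu_factor_conj(2)[OF pn gen(1)])
    then show ?case using nu[OF gen(1)] gen(3) by simp
  next
    case (inv i g)
    have "factor_conj n p (inv\<^bsub>free_group p\<^esub> (fgen i) \<otimes>\<^bsub>free_group p\<^esub> g) = nu n p i \<otimes>\<^bsub>Aut_F n\<^esub> factor_conj n p g"
      by (simp only: C.hom_mult P.inv_closed fgen[OF inv(1)] inv(2) nu_factor_conj(1)[OF pn inv(1)])
    then show ?case using nu[OF inv(1)] inv(3) by simp
  qed
qed

lemma Aut_preserves_factor:
  assumes "p \<le> n" and \<phi>: "\<phi> \<in> carrier (Aut_F n)"
    and gens: "\<And>k. k \<in> {1..p} \<Longrightarrow> \<phi> (fgen k) \<in> carrier (free_group p)"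
    and w: "w \<in> carrier (free_group p)"
  shows "\<phi> w \<in> carrier (free_group p)"
proof -
  interpret P: group "free_group p" by (rule group_free_group)
  interpret \<phi>: group_hom "free_group n" "free_group n" \<phi> by (rule Aut_F_group_hom[OF \<phi>])
  have "\<phi> \<in> hom (free_group p) (free_group n)"
    by (rule hom_free_group_mono[OF assms(1) \<phi>.homh])
  then interpret \<phi>p: group_hom "free_group p" "free_group n" \<phi>
    by (simp add: group_hom_def group_hom_axioms_def group_free_group)
  show ?thesis using w
  proof (induction rule: free_group_induct)
    case one
    then show ?case using \<phi>p.hom_one P.one_closed by (simp add: one_free_group)
  next
    case (gen k g)
    have "\<phi> (fgen k \<otimes>\<^bsub>free_group p\<^esub> g) = \<phi> (fgen k) \<otimes>\<^bsub>free_group p\<^esub> \<phi> g"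
      using fgen_closed[OF gen(1)] gen(2) \<phi>p.hom_mult
      by (simp only: mult_free_group_cong[of p "\<phi> (fgen k)" "\<phi> g" n])
    then show ?case using P.m_closed[OF gens[OF gen(1)] gen(3)] by simp
  next
    case (inv k g)
    have i: "inv\<^bsub>free_group p\<^esub> (fgen k) \<in> carrier (free_group p)"
      using fgen_closed[OF inv(1)] by simp
    have "\<phi> (inv\<^bsub>free_group p\<^esub> (fgen k)) = inv\<^bsub>free_group p\<^esub> (\<phi> (fgen k))"
      using \<phi>p.hom_inv[OF fgen_closed[OF inv(1)]] inv_free_group_cong[OF assms(1) gens[OF inv(1)]]
      by simp
    then have "\<phi> (inv\<^bsub>free_group p\<^esub> (fgen k) \<otimes>\<^bsub>free_group p\<^esub> g) =
        inv\<^bsub>free_group p\<^esub> (\<phi> (fgen k)) \<otimes>\<^bsub>free_group p\<^esub> \<phi> g"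
      using i inv(2) \<phi>p.hom_mult
      by (simp only: mult_free_group_cong[of p "inv\<^bsub>free_group p\<^esub> (\<phi> (fgen k))" "\<phi> g" n])
    then show ?case using P.m_closed[OF P.inv_closed[OF gens[OF inv(1)]] inv(3)] by simp
  qed
qed

lemma factor_conj_preserves_factor:
  assumes "q \<le> p" "p \<le> n" "a \<in> carrier (free_group q)" "w \<in> carrier (free_group p)"
  shows "factor_conj n q a w \<in> carrier (free_group p)"
proof (rule Aut_preserves_factor[OF assms(2) factor_conj_Aut _ assms(4)])
  interpret P: group "free_group p" by (rule group_free_group)
  have a: "a \<in> carrier (free_group p)" "a \<in> carrier (free_group n)"
    using assms free_group_mono[of q p] free_group_mono[of q n] by auto
  fix k assume k: "k \<in> {1..p}"
  have "a \<otimes>\<^bsub>free_group p\<^esub> fgen k \<otimes>\<^bsub>free_group p\<^esub> inv\<^bsub>free_group p\<^esub> a \<in> carrier (free_group p)"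
    using a fgen_closed[OF k] by simp
  then have "a \<otimes>\<^bsub>free_group n\<^esub> fgen k \<otimes>\<^bsub>free_group n\<^esub> inv\<^bsub>free_group n\<^esub> a \<in> carrier (free_group p)"
    using inv_free_group_cong[OF assms(2) a(1)] by (simp add: mult_free_group)
  moreover have "k \<in> {1..n}" using k assms(2) by simp
  ultimately show "factor_conj n q a (fgen k) \<in> carrier (free_group p)"
    using fgen_closed[OF k] factor_conj_fgen[OF a(2)] by simp
qed (use assms in auto)

text \<open>With \<open>A = factor_conj n q a\<close>, both sides send x_k to
  \<open>A(g) A(x_k) A(g)^-1\<close> for \<open>k \<le> p\<close>, as \<open>A\<close> preserves
  F_p; for larger \<open>k\<close> everything fixes x_k because \<open>q \<le> p\<close>.\<close>

lemma factor_conj_commute: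
  assumes "q \<le> p" "p \<le> n" "a \<in> carrier (free_group q)" "g \<in> carrier (free_group p)"
  shows "factor_conj n q a \<otimes>\<^bsub>Aut_F n\<^esub> factor_conj n p g =
    factor_conj n p (factor_conj n q a g) \<otimes>\<^bsub>Aut_F n\<^esub> factor_conj n q a"
proof -
  let ?A = "factor_conj n q a" and ?G = "factor_conj n p g"
  let ?b = "?A g"
  have qn: "q \<le> n" using assms by simp
  have b: "?b \<in> carrier (free_group p)" by (rule factor_conj_preserves_factor[OF assms])
  have c: "a \<in> carrier (free_group n)" "g \<in> carrier (free_group n)" "?b \<in> carrier (free_group n)"
    using assms b free_group_mono[of q n] free_group_mono[of p n] by auto
  have Aut: "?A \<in> carrier (Aut_F n)" "?G \<in> carrier (Aut_F n)" "factor_conj n p ?b \<in> carrier (Aut_F n)"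
    using factor_conj_Aut qn assms b by auto
  interpret A: group_hom "free_group n" "free_group n" ?A by (rule Aut_F_group_hom[OF Aut(1)])
  show ?thesis
  proof (rule Aut_F_eqI)
    fix k assume k: "k \<in> {1..n}"
    have fk: "fgen k \<in> carrier (free_group n)" by (rule fgen_closed[OF k])
    show "(?A \<otimes>\<^bsub>Aut_F n\<^esub> ?G) (fgen k) = (factor_conj n p ?b \<otimes>\<^bsub>Aut_F n\<^esub> ?A) (fgen k)"
    proof (cases "k \<le> p")
      case True
      then have kp: "fgen k \<in> carrier (free_group p)" using k fgen_closed by simp
      have "?A (?G (fgen k)) = ?b \<otimes>\<^bsub>free_group n\<^esub> ?A (fgen k) \<otimes>\<^bsub>free_group n\<^esub> inv\<^bsub>free_group n\<^esub> ?b"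
        using True c fk by (simp add: factor_conj_fgen[OF c(2) k])
      also have "\<dots> = factor_conj n p ?b (?A (fgen k))"
        using factor_conj_factor[OF assms(2) c(3) factor_conj_preserves_factor[OF assms(1-3) kp]] by simp
      finally show ?thesis using Aut fk by (simp add: mult_Aut_F_apply)
    next
      case False
      then have "\<not> k \<le> q" using assms(1) by simp
      then show ?thesis using Aut fk False c k by (simp add: mult_Aut_F_apply factor_conj_fgen)
    qed
  qed (use Aut in auto)
qed

text \<open>The action in the semidirect product. Invariance of F_p is carried along in the
  induction, since for a product the relation of the left factor is used at the value of the right
  one.\<close>

lemma partial_inner_upto_commute:
  assumes \<psi>: "\<psi> \<in> partial_inner_upto n q" and "q \<le> p" "p \<le> n" and g: "g \<in> carrier (free_group p)"
  shows "\<psi> g \<in> carrier (free_group p)"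
    and "\<psi> \<otimes>\<^bsub>Aut_F n\<^esub> factor_conj n p g = factor_conj n p (\<psi> g) \<otimes>\<^bsub>Aut_F n\<^esub> \<psi>"
proof -
  have q: "q \<le> n" using assms by simp
  interpret I: subgroup "partial_inner_upto n q" "Aut_F n" by (rule subgroup_partial_inner_upto[OF q])
  have gn: "g \<in> carrier (free_group n)" if "g \<in> carrier (free_group p)" for g
    using that assms(3) free_group_mono by blast
  have "\<forall>g\<in>carrier (free_group p). \<psi> g \<in> carrier (free_group p) \<and>
      \<psi> \<otimes>\<^bsub>Aut_F n\<^esub> factor_conj n p g = factor_conj n p (\<psi> g) \<otimes>\<^bsub>Aut_F n\<^esub> \<psi>"
    using \<psi> q
  proof (induction rule: partial_inner_upto_induct)
    case one
    have "\<one>\<^bsub>Aut_F n\<^esub> g = g" if "g \<in> carrier (free_group p)" for g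
      using gn[OF that] by (simp add: one_Aut_F)
    then show ?case using factor_conj_Aut[OF assms(3)] by simp
  next
    case (conj r a)
    then have "r \<le> p" using assms(2) by simp
    then show ?case
      using factor_conj_preserves_factor[OF _ assms(3) conj(3)] factor_conj_commute[OF _ assms(3) conj(3)]
      by blast
  next
    case (mult \<phi> \<psi>)
    show ?case
    proof
      fix g assume g: "g \<in> carrier (free_group p)"
      note c = mult(1,2)[THEN I.mem_carrier]
      have \<psi>g: "\<psi> g \<in> carrier (free_group p)" using mult(4) g by blast
      have e: "(\<phi> \<otimes>\<^bsub>Aut_F n\<^esub> \<psi>) g = \<phi> (\<psi> g)" using c gn[OF g] by (simp add: mult_Aut_F_apply)
      have \<phi>g: "\<phi> (\<psi> g) \<in> carrier (free_group p)" using mult(3) \<psi>g by blast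
      have k: "factor_conj n p g \<in> carrier (Aut_F n)" "factor_conj n p (\<psi> g) \<in> carrier (Aut_F n)"
        "factor_conj n p (\<phi> (\<psi> g)) \<in> carrier (Aut_F n)"
        using factor_conj_Aut[OF assms(3)] g \<psi>g \<phi>g by auto
      have "(\<phi> \<otimes>\<^bsub>Aut_F n\<^esub> \<psi>) \<otimes>\<^bsub>Aut_F n\<^esub> factor_conj n p g
          = \<phi> \<otimes>\<^bsub>Aut_F n\<^esub> (factor_conj n p (\<psi> g) \<otimes>\<^bsub>Aut_F n\<^esub> \<psi>)"
        using mult(4) g c k by (simp add: Aut.m_assoc)
      also have "\<dots> = (\<phi> \<otimes>\<^bsub>Aut_F n\<^esub> factor_conj n p (\<psi> g)) \<otimes>\<^bsub>Aut_F n\<^esub> \<psi>"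
        using c k by (simp add: Aut.m_assoc)
      also have "\<dots> = (factor_conj n p (\<phi> (\<psi> g)) \<otimes>\<^bsub>Aut_F n\<^esub> \<phi>) \<otimes>\<^bsub>Aut_F n\<^esub> \<psi>"
        using mult(3) \<psi>g by simp
      also have "\<dots> = factor_conj n p (\<phi> (\<psi> g)) \<otimes>\<^bsub>Aut_F n\<^esub> (\<phi> \<otimes>\<^bsub>Aut_F n\<^esub> \<psi>)"
        using c k by (simp add: Aut.m_assoc)
      finally show "(\<phi> \<otimes>\<^bsub>Aut_F n\<^esub> \<psi>) g \<in> carrier (free_group p) \<and>
          (\<phi> \<otimes>\<^bsub>Aut_F n\<^esub> \<psi>) \<otimes>\<^bsub>Aut_F n\<^esub> factor_conj n p g =
          factor_conj n p ((\<phi> \<otimes>\<^bsub>Aut_F n\<^esub> \<psi>) g) \<otimes>\<^bsub>Aut_F n\<^esub> (\<phi> \<otimes>\<^bsub>Aut_F n\<^esub> \<psi>)"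
        using \<phi>g by (simp add: e)
    qed
  qed
  then show "\<psi> g \<in> carrier (free_group p)"
    and "\<psi> \<otimes>\<^bsub>Aut_F n\<^esub> factor_conj n p g = factor_conj n p (\<psi> g) \<otimes>\<^bsub>Aut_F n\<^esub> \<psi>"
    using g by auto
qed

lemma partial_inner_upto_fgen:
  assumes "\<psi> \<in> partial_inner_upto n q" "q \<le> n" "q < k" "k \<le> n"
  shows "\<psi> (fgen k) = fgen k"
  using assms(1,2)
proof (induction rule: partial_inner_upto_induct)
  case one
  show ?case using assms fgen_closed[of k n] by (simp add: one_Aut_F)
next
  case (conj p a)
  then have "a \<in> carrier (free_group n)" using assms(2) free_group_mono[of p n] by auto
  then show ?case using conj assms factor_conj_fgen[of a n k p] by simp
next
  case (mult \<phi> \<psi>)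
  interpret I: subgroup "partial_inner_upto n q" "Aut_F n"
    by (rule subgroup_partial_inner_upto[OF assms(2)])
  have "fgen k \<in> carrier (free_group n)" using assms fgen_closed by simp
  then show ?case using mult by (simp add: mult_Aut_F_apply)
qed

text \<open>The semidirect decomposition \<open>I\<^sub>p = F\<^sub>p \<rtimes> I\<^sub>p\<^sub>-\<^sub>1\<close>.\<close>

lemma partial_inner_upto_decompose:
  assumes \<phi>: "\<phi> \<in> partial_inner_upto n (Suc q)" and "1 \<le> q" "Suc q \<le> n"
  shows "\<exists>g\<in>carrier (free_group (Suc q)). \<exists>\<psi>\<in>partial_inner_upto n q.
    \<phi> = factor_conj n (Suc q) g \<otimes>\<^bsub>Aut_F n\<^esub> \<psi>"
proof -
  have q: "q \<le> n" using assms by simp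
  interpret I: subgroup "partial_inner_upto n q" "Aut_F n" by (rule subgroup_partial_inner_upto[OF q])
  interpret P: group "free_group (Suc q)" by (rule group_free_group)
  interpret C: group_hom "free_group (Suc q)" "Aut_F n" "factor_conj n (Suc q)"
    by (rule factor_conj_group_hom[OF assms(3)])
  show ?thesis using \<phi> assms(3)
  proof (induction rule: partial_inner_upto_induct)
    case one
    show ?case
      by (rule bexI[OF _ P.one_closed], rule bexI[OF _ I.one_closed]) (simp add: C.hom_one)
  next
    case (conj p a)
    show ?case
    proof (cases "p = Suc q")
      case True
      then show ?thesis using conj(3)
        by (intro bexI[of _ a] bexI[OF _ I.one_closed]) (auto simp: factor_conj_Aut assms(3))
    next
      case False
      then have "factor_conj n p a \<in> partial_inner_upto n q"
        using conj q by (intro factor_conj_partial_inner) auto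
      then show ?thesis
        by (intro bexI[OF _ P.one_closed] bexI[of _ "factor_conj n p a"]) (simp_all add: C.hom_one)
    qed
  next
    case (mult \<phi> \<phi>')
    then obtain g \<psi> g' \<psi>' where g: "g \<in> carrier (free_group (Suc q))" "g' \<in> carrier (free_group (Suc q))"
      and \<psi>: "\<psi> \<in> partial_inner_upto n q" "\<psi>' \<in> partial_inner_upto n q"
      and e: "\<phi> = factor_conj n (Suc q) g \<otimes>\<^bsub>Aut_F n\<^esub> \<psi>" "\<phi>' = factor_conj n (Suc q) g' \<otimes>\<^bsub>Aut_F n\<^esub> \<psi>'"
      by blast
    \<comment> \<open>Moving \<open>\<psi>\<close> past the conjugation by \<open>g'\<close> turns
      \<open>g'\<close> into \<open>\<psi> g'\<close>; the two conjugations then stand side by side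
      and merge.\<close>
    note com = partial_inner_upto_commute[OF \<psi>(1) le_SucI[OF order_refl] assms(3) g(2)]
    have "\<phi> \<otimes>\<^bsub>Aut_F n\<^esub> \<phi>' = factor_conj n (Suc q) g \<otimes>\<^bsub>Aut_F n\<^esub>
        (\<psi> \<otimes>\<^bsub>Aut_F n\<^esub> factor_conj n (Suc q) g') \<otimes>\<^bsub>Aut_F n\<^esub> \<psi>'"
      using g \<psi> by (simp add: e Aut.m_assoc)
    also have "\<dots> = factor_conj n (Suc q) (g \<otimes>\<^bsub>free_group (Suc q)\<^esub> \<psi> g') \<otimes>\<^bsub>Aut_F n\<^esub> (\<psi> \<otimes>\<^bsub>Aut_F n\<^esub> \<psi>')"
      unfolding com(2) using g \<psi> com(1) by (simp add: Aut.m_assoc)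
    finally show ?case using g \<psi> com(1) by blast
  qed
qed

end

section \<open>The Andreadakis filtration\<close>

context
  fixes n :: nat
begin

interpretation F: group "free_group n" by (rule group_free_group)
interpretation Aut: group "Aut_F n" by (rule group_Aut_F)

lemma generate_fgen: "g \<in> carrier (free_group n) \<Longrightarrow> g \<in> generate (free_group n) (fgen ` {1..n})"
proof (induction rule: free_group_induct)
  case one
  show ?case by (rule generate.one)
next
  case (gen k g)
  show ?case by (rule generate.eng[OF generate.incl[OF imageI[OF gen(1)]] gen(3)])
next
  case (inv k g)
  show ?case by (rule generate.eng[OF generate.inv[OF imageI[OF inv(1)]] inv(3)])
qed

lemma inv_Aut_F_apply:
  assumes "\<phi> \<in> carrier (Aut_F n)" "w \<in> carrier (free_group n)"
  shows "\<phi> ((inv\<^bsub>Aut_F n\<^esub> \<phi>) w) = w" "(inv\<^bsub>Aut_F n\<^esub> \<phi>) (\<phi> w) = w"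
proof -
  have one: "\<one>\<^bsub>Aut_F n\<^esub> w = w" using assms(2) by (simp add: one_Aut_F)
  have i: "inv\<^bsub>Aut_F n\<^esub> \<phi> \<in> carrier (Aut_F n)" using assms(1) by simp
  show "\<phi> ((inv\<^bsub>Aut_F n\<^esub> \<phi>) w) = w"
    using mult_Aut_F_apply[OF assms(1) i assms(2)] assms(1) one by simp
  show "(inv\<^bsub>Aut_F n\<^esub> \<phi>) (\<phi> w) = w"
    using mult_Aut_F_apply[OF i assms(1,2)] assms(1) one by simp
qed

lemma andreadakisD:
  assumes "\<phi> \<in> andreadakis n k"
  shows "\<phi> \<in> carrier (Aut_F n)"
    and "g \<in> carrier (free_group n) \<Longrightarrow> inv\<^bsub>free_group n\<^esub> g \<otimes>\<^bsub>free_group n\<^esub> \<phi> g \<in> lcs (free_group n) (Suc k)"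
  using assms by (auto simp: andreadakis_def)

lemma andreadakisI:
  assumes "\<phi> \<in> carrier (Aut_F n)"
    and "\<And>g. g \<in> carrier (free_group n) \<Longrightarrow>
      inv\<^bsub>free_group n\<^esub> g \<otimes>\<^bsub>free_group n\<^esub> \<phi> g \<in> lcs (free_group n) (Suc k)"
  shows "\<phi> \<in> andreadakis n k"
  using assms by (simp add: andreadakis_def)

lemma subgroup_andreadakis: "subgroup (andreadakis n k) (Aut_F n)"
proof (rule subgroup.intro)
  show "andreadakis n k \<subseteq> carrier (Aut_F n)" using andreadakisD by blast
  show "\<one>\<^bsub>Aut_F n\<^esub> \<in> andreadakis n k"
  proof (rule andreadakisI[OF Aut.one_closed])
    fix g assume "g \<in> carrier (free_group n)"
    then show "inv\<^bsub>free_group n\<^esub> g \<otimes>\<^bsub>free_group n\<^esub> \<one>\<^bsub>Aut_F n\<^esub> g \<in> lcs (free_group n) (Suc k)"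
      using F.lcs_closed(3) by (simp add: one_Aut_F)
  qed
next
  fix \<phi> \<psi> assume "\<phi> \<in> andreadakis n k" "\<psi> \<in> andreadakis n k"
  note \<phi> = andreadakisD[OF this(1)] and \<psi> = andreadakisD[OF this(2)]
  show "\<phi> \<otimes>\<^bsub>Aut_F n\<^esub> \<psi> \<in> andreadakis n k"
  proof (rule andreadakisI)
    fix g assume g: "g \<in> carrier (free_group n)"
    have c: "\<psi> g \<in> carrier (free_group n)" "\<phi> (\<psi> g) \<in> carrier (free_group n)"
      using Aut_F_closed \<phi>(1) \<psi>(1) g by auto
    have "inv\<^bsub>free_group n\<^esub> g \<otimes>\<^bsub>free_group n\<^esub> (\<phi> \<otimes>\<^bsub>Aut_F n\<^esub> \<psi>) g =
      (inv\<^bsub>free_group n\<^esub> g \<otimes>\<^bsub>free_group n\<^esub> \<psi> g) \<otimes>\<^bsub>free_group n\<^esub>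
      (inv\<^bsub>free_group n\<^esub> (\<psi> g) \<otimes>\<^bsub>free_group n\<^esub> \<phi> (\<psi> g))"
      using g c \<phi>(1) \<psi>(1) by (simp add: mult_Aut_F_apply F.group_word_simps)
    then show "inv\<^bsub>free_group n\<^esub> g \<otimes>\<^bsub>free_group n\<^esub> (\<phi> \<otimes>\<^bsub>Aut_F n\<^esub> \<psi>) g \<in> lcs (free_group n) (Suc k)"
      using F.lcs_closed(1)[OF \<psi>(2)[OF g] \<phi>(2)[OF c(1)]] by simp
  qed (use \<phi>(1) \<psi>(1) in simp)
next
  fix \<phi> assume "\<phi> \<in> andreadakis n k"
  note \<phi> = andreadakisD[OF this]
  show "inv\<^bsub>Aut_F n\<^esub> \<phi> \<in> andreadakis n k"
  proof (rule andreadakisI)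
    fix g assume g: "g \<in> carrier (free_group n)"
    let ?h = "(inv\<^bsub>Aut_F n\<^esub> \<phi>) g"
    have h: "?h \<in> carrier (free_group n)" using Aut_F_closed \<phi>(1) g by simp
    \<comment> \<open>Since \<open>g\<close> is the image of \<open>?h\<close> under
      \<open>\<phi>\<close>, the displacement of the inverse at \<open>g\<close> is the inverse of
      the displacement of \<open>\<phi>\<close> at \<open>?h\<close>.\<close>
    have "inv\<^bsub>free_group n\<^esub> (inv\<^bsub>free_group n\<^esub> ?h \<otimes>\<^bsub>free_group n\<^esub> \<phi> ?h) = inv\<^bsub>free_group n\<^esub> g \<otimes>\<^bsub>free_group n\<^esub> ?h"
      using h g by (simp add: inv_Aut_F_apply[OF \<phi>(1) g] F.group_word_simps)
    then show "inv\<^bsub>free_group n\<^esub> g \<otimes>\<^bsub>free_group n\<^esub> ?h \<in> lcs (free_group n) (Suc k)"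
      using F.lcs_closed(2)[OF \<phi>(2)[OF h]] by simp
  qed (use \<phi>(1) in simp)
qed

text \<open>The two products of \<open>\<phi>\<close> and \<open>\<psi>\<close> are compared at
  \<open>g\<close>. With \<open>\<phi> g = g a\<close> and \<open>\<psi> g = g b\<close>, they
  differ by the commutator of \<open>a\<close> and \<open>b\<close>, the displacement of
  \<open>a\<close> under \<open>\<psi>\<close> and that of \<open>b\<close> under
  \<open>\<phi>\<close>; all three have depth \<open>k + 2\<close>, the last two by
  \<open>displacement_lcs\<close>.\<close>

lemma gcomm_andreadakis:
  assumes k: "k \<ge> 1" and \<phi>: "\<phi> \<in> andreadakis n k" and \<psi>: "\<psi> \<in> andreadakis n 1"
  shows "gcomm (Aut_F n) \<phi> \<psi> \<in> andreadakis n (Suc k)"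
proof (rule andreadakisI)
  note \<phi>A = andreadakisD(1)[OF \<phi>] and \<psi>A = andreadakisD(1)[OF \<psi>]
  let ?c = "gcomm (Aut_F n) \<phi> \<psi>" and ?N = "lcs (free_group n) (Suc (Suc k))"
  let ?\<chi> = "\<psi> \<otimes>\<^bsub>Aut_F n\<^esub> \<phi>"
  show cA: "?c \<in> carrier (Aut_F n)" using \<phi>A \<psi>A by simp
  fix g assume g: "g \<in> carrier (free_group n)"
  define a where "a = inv\<^bsub>free_group n\<^esub> g \<otimes>\<^bsub>free_group n\<^esub> \<phi> g"
  define b where "b = inv\<^bsub>free_group n\<^esub> g \<otimes>\<^bsub>free_group n\<^esub> \<psi> g"
  define \<alpha> where "\<alpha> = inv\<^bsub>free_group n\<^esub> a \<otimes>\<^bsub>free_group n\<^esub> \<psi> a"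
  define \<beta> where "\<beta> = inv\<^bsub>free_group n\<^esub> b \<otimes>\<^bsub>free_group n\<^esub> \<phi> b"
  have a: "a \<in> lcs (free_group n) (Suc k)" and b: "b \<in> lcs (free_group n) (Suc 1)"
    using andreadakisD(2)[OF \<phi> g] andreadakisD(2)[OF \<psi> g] by (simp_all only: a_def b_def)
  have hom: "\<phi> \<in> hom (free_group n) (free_group n)" "\<psi> \<in> hom (free_group n) (free_group n)"
    using \<phi>A \<psi>A by (simp_all add: carrier_Aut_F)
  have "inv\<^bsub>free_group n\<^esub> a \<otimes>\<^bsub>free_group n\<^esub> \<psi> a \<in> lcs (free_group n) (1 + Suc k)"
    by (rule F.displacement_lcs[OF hom(2) andreadakisD(2)[OF \<psi>] _ a]) simp_all
  then have \<alpha>: "\<alpha> \<in> ?N" by (simp add: \<alpha>_def)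
  have "inv\<^bsub>free_group n\<^esub> b \<otimes>\<^bsub>free_group n\<^esub> \<phi> b \<in> lcs (free_group n) (k + Suc 1)"
    by (rule F.displacement_lcs[OF hom(1) andreadakisD(2)[OF \<phi>] _ b]) simp_all
  then have \<beta>: "\<beta> \<in> ?N" by (simp add: \<beta>_def)
  have closed: "a \<in> carrier (free_group n)" "b \<in> carrier (free_group n)" "\<alpha> \<in> carrier (free_group n)"
    "\<beta> \<in> carrier (free_group n)" "\<phi> a \<in> carrier (free_group n)" "\<phi> b \<in> carrier (free_group n)"
    "\<psi> a \<in> carrier (free_group n)" "\<psi> b \<in> carrier (free_group n)"
    using F.lcs_closed(4)[OF a] F.lcs_closed(4)[OF b] F.lcs_closed(4)[OF \<alpha>] F.lcs_closed(4)[OF \<beta>]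
      Aut_F_closed[OF \<phi>A] Aut_F_closed[OF \<psi>A] by auto
  have \<phi>g: "\<phi> g = g \<otimes>\<^bsub>free_group n\<^esub> a" and \<psi>g: "\<psi> g = g \<otimes>\<^bsub>free_group n\<^esub> b"
    and \<psi>a: "\<psi> a = a \<otimes>\<^bsub>free_group n\<^esub> \<alpha>" and \<phi>b: "\<phi> b = b \<otimes>\<^bsub>free_group n\<^esub> \<beta>"
    using g closed Aut_F_closed[OF \<phi>A g] Aut_F_closed[OF \<psi>A g]
    by (simp_all add: a_def b_def \<alpha>_def \<beta>_def F.mult_inv_cancel)
  have \<chi>g: "?\<chi> g = g \<otimes>\<^bsub>free_group n\<^esub> b \<otimes>\<^bsub>free_group n\<^esub> (a \<otimes>\<^bsub>free_group n\<^esub> \<alpha>)"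
    using g closed \<phi>A \<psi>A by (simp add: mult_Aut_F_apply \<phi>g Aut_F_mult \<psi>g \<psi>a)
  have \<phi>\<psi>g: "(\<phi> \<otimes>\<^bsub>Aut_F n\<^esub> \<psi>) g = g \<otimes>\<^bsub>free_group n\<^esub> a \<otimes>\<^bsub>free_group n\<^esub> (b \<otimes>\<^bsub>free_group n\<^esub> \<beta>)"
    using g closed \<phi>A \<psi>A by (simp add: mult_Aut_F_apply \<psi>g Aut_F_mult \<phi>g \<phi>b)
  have "inv\<^bsub>free_group n\<^esub> (?\<chi> g) \<otimes>\<^bsub>free_group n\<^esub> (\<phi> \<otimes>\<^bsub>Aut_F n\<^esub> \<psi>) g =
      inv\<^bsub>free_group n\<^esub> \<alpha> \<otimes>\<^bsub>free_group n\<^esub> gcomm (free_group n) a b \<otimes>\<^bsub>free_group n\<^esub> \<beta>"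
    unfolding \<chi>g \<phi>\<psi>g using g closed by (simp add: gcomm_def F.group_word_simps)
  moreover have "gcomm (free_group n) a b \<in> ?N" using F.gcomm_lcs[OF _ a closed(2)] by simp
  ultimately have diff: "inv\<^bsub>free_group n\<^esub> (?\<chi> g) \<otimes>\<^bsub>free_group n\<^esub> (\<phi> \<otimes>\<^bsub>Aut_F n\<^esub> \<psi>) g \<in> ?N"
    using \<alpha> \<beta> F.lcs_closed(1,2) by metis
  have \<chi>A: "?\<chi> \<in> carrier (Aut_F n)" and \<phi>\<psi>A: "\<phi> \<otimes>\<^bsub>Aut_F n\<^esub> \<psi> \<in> carrier (Aut_F n)"
    using \<phi>A \<psi>A by auto
  have "?\<chi> \<otimes>\<^bsub>Aut_F n\<^esub> ?c = \<phi> \<otimes>\<^bsub>Aut_F n\<^esub> \<psi>"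
    using \<phi>A \<psi>A by (simp add: gcomm_def Aut.group_word_simps)
  then have \<chi>c: "(\<phi> \<otimes>\<^bsub>Aut_F n\<^esub> \<psi>) g = ?\<chi> (?c g)"
    using mult_Aut_F_apply[OF \<chi>A cA g] by simp
  let ?i = "inv\<^bsub>Aut_F n\<^esub> ?\<chi>"
  have iA: "?i \<in> carrier (Aut_F n)" using \<chi>A by simp
  interpret i: group_hom "free_group n" "free_group n" ?i by (rule Aut_F_group_hom[OF iA])
  have cg: "?c g \<in> carrier (free_group n)" by (rule Aut_F_closed[OF cA g])
  \<comment> \<open>Homomorphisms preserve the lower central series, so the inverse of
    \<open>?\<chi>\<close> carries the comparison of the two products back to the displacement of
    their commutator at \<open>g\<close>.\<close>
  have "?i (inv\<^bsub>free_group n\<^esub> (?\<chi> g) \<otimes>\<^bsub>free_group n\<^esub> ?\<chi> (?c g)) = inv\<^bsub>free_group n\<^esub> g \<otimes>\<^bsub>free_group n\<^esub> ?c g"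
    using Aut_F_closed[OF \<chi>A g] Aut_F_closed[OF \<chi>A cg] inv_Aut_F_apply(2)[OF \<chi>A g] inv_Aut_F_apply(2)[OF \<chi>A cg]
    by simp
  then show "inv\<^bsub>free_group n\<^esub> g \<otimes>\<^bsub>free_group n\<^esub> ?c g \<in> ?N"
    using i.hom_lcs[OF diff[unfolded \<chi>c]] by simp
qed

text \<open>For \<open>k \<le> p\<close> the displacement of x_k is the commutator of x_k with the
  inverse of \<open>a\<close>; the other generators are fixed.\<close>

lemma factor_conj_andreadakis_1:
  assumes p: "p \<le> n" and a: "a \<in> carrier (free_group p)"
  shows "factor_conj n p a \<in> andreadakis n 1"
proof (rule andreadakisI)
  have an: "a \<in> carrier (free_group n)" using assms free_group_mono by blast
  show "factor_conj n p a \<in> carrier (Aut_F n)" by (rule factor_conj_Aut[OF assms])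
  fix g assume g: "g \<in> carrier (free_group n)"
  show "inv\<^bsub>free_group n\<^esub> g \<otimes>\<^bsub>free_group n\<^esub> factor_conj n p a g \<in> lcs (free_group n) (Suc 1)"
  proof (rule F.displacement_generate[OF F.lcs_normal factor_conj_hom[OF an] _ _ generate_fgen[OF g]])
    show "fgen ` {1..n} \<subseteq> carrier (free_group n)" using fgen_closed by blast
    fix s assume "s \<in> fgen ` {1..n}"
    then obtain k where k: "k \<in> {1..n}" and s: "s = fgen k" by blast
    have fk: "fgen k \<in> carrier (free_group n)" by (rule fgen_closed[OF k])
    show "inv\<^bsub>free_group n\<^esub> s \<otimes>\<^bsub>free_group n\<^esub> factor_conj n p a s \<in> lcs (free_group n) (Suc 1)"
    proof (cases "k \<le> p")
      case True
      then have "inv\<^bsub>free_group n\<^esub> s \<otimes>\<^bsub>free_group n\<^esub> factor_conj n p a s =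
          gcomm (free_group n) (fgen k) (inv\<^bsub>free_group n\<^esub> a)"
        using fk an by (simp add: s factor_conj_fgen[OF an k] gcomm_def F.group_word_simps)
      moreover have "\<dots> \<in> lcs (free_group n) (Suc 1)"
        by (rule F.gcomm_lcs) (use fk an in simp_all)
      ultimately show ?thesis by (simp only:)
    next
      case False
      then have "inv\<^bsub>free_group n\<^esub> s \<otimes>\<^bsub>free_group n\<^esub> factor_conj n p a s = \<one>\<^bsub>free_group n\<^esub>"
        using fk by (simp add: s factor_conj_fgen[OF an k])
      then show ?thesis by (simp only: F.lcs_closed(3))
    qed
  qed
qed

lemma partial_inner_upto_andreadakis_1:
  assumes "q \<le> n" "\<phi> \<in> partial_inner_upto n q" shows "\<phi> \<in> andreadakis n 1"
proof -
  interpret A: subgroup "andreadakis n 1" "Aut_F n" by (rule subgroup_andreadakis)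
  show ?thesis using assms(2,1)
  proof (induction rule: partial_inner_upto_induct)
    case one
    show ?case by (rule A.one_closed)
  next
    case (conj p a)
    then show ?case using assms(1) by (intro factor_conj_andreadakis_1) auto
  next
    case (mult \<phi> \<psi>)
    then show ?case by (intro A.m_closed)
  qed
qed

section \<open>The lower central series of I_n inside the Andreadakis filtration\<close>

lemma subgroup_partial_inner: "subgroup (partial_inner n) (Aut_F n)"
  by (simp add: partial_inner_eq subgroup_partial_inner_upto)

lemma group_partial_inner_group: "group (partial_inner_group n)"
  unfolding partial_inner_group_def
  by (rule subgroup.subgroup_is_group[OF subgroup_partial_inner group_Aut_F])

lemma partial_inner_group_simps [simp]:
  "carrier (partial_inner_group n) = partial_inner n"
  "\<phi> \<otimes>\<^bsub>partial_inner_group n\<^esub> \<psi> = \<phi> \<otimes>\<^bsub>Aut_F n\<^esub> \<psi>"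
  "\<one>\<^bsub>partial_inner_group n\<^esub> = \<one>\<^bsub>Aut_F n\<^esub>"
  by (simp_all add: partial_inner_group_def)

lemma gcomm_partial_inner_group:
  assumes "\<phi> \<in> partial_inner n" "\<psi> \<in> partial_inner n"
  shows "gcomm (partial_inner_group n) \<phi> \<psi> = gcomm (Aut_F n) \<phi> \<psi>"
  using assms Aut.m_inv_consistent[OF subgroup_partial_inner]
  by (simp add: gcomm_def) (simp add: partial_inner_group_def)

text \<open>As I_n lies in A_n(1), \<open>gcomm_andreadakis\<close> raises the index by one on each
  generating commutator, and the right-hand side is a subgroup.\<close>

lemma lcs_partial_inner_andreadakis:
  "1 \<le> k \<Longrightarrow> lcs (partial_inner_group n) k \<subseteq> andreadakis n k \<inter> partial_inner n"
proof (induction k rule: dec_induct)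
  case base
  then show ?case using partial_inner_upto_andreadakis_1[of n] by (auto simp: partial_inner_eq)
next
  case (step k)
  interpret I: group "partial_inner_group n" by (rule group_partial_inner_group)
  let ?H = "andreadakis n (Suc k) \<inter> partial_inner n"
  have "subgroup ?H (Aut_F n)"
    by (rule Aut.subgroups_Inter_pair[OF subgroup_andreadakis subgroup_partial_inner])
  then have H: "subgroup ?H (partial_inner_group n)"
    unfolding partial_inner_group_def by (rule Aut.subgroup_incl[OF _ subgroup_partial_inner]) simp
  have "gcomm (partial_inner_group n) a b \<in> ?H"
    if a: "a \<in> lcs (partial_inner_group n) k" and b: "b \<in> carrier (partial_inner_group n)" for a b
  proof -
    have a': "a \<in> andreadakis n k" "a \<in> partial_inner n" using step.IH a by auto
    have b': "b \<in> andreadakis n 1" "b \<in> partial_inner n"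
      using b partial_inner_upto_andreadakis_1[of n] by (auto simp: partial_inner_eq)
    have "gcomm (partial_inner_group n) a b \<in> carrier (partial_inner_group n)"
      using a' b by (intro I.gcomm_closed) simp_all
    then show ?thesis
      using gcomm_andreadakis[OF step.hyps(1) a'(1) b'(1)] gcomm_partial_inner_group[OF a'(2) b'(2)] by simp
  qed
  then show ?case
    unfolding I.lcs_Suc[OF step.hyps(1)] by (intro I.generate_subgroup_incl[OF _ H]) blast
qed

end

section \<open>Centralisers of generators\<close>

definition supported :: "nat set \<Rightarrow> ncs \<Rightarrow> bool" where
  "supported P f \<longleftrightarrow> (\<forall>w. \<not> set w \<subseteq> P \<longrightarrow> coeff f w = 0)"

lemma conv_supported:
  assumes "\<And>w. \<not> set w \<subseteq> P \<Longrightarrow> f w = 0" "\<And>w. \<not> set w \<subseteq> P \<Longrightarrow> g w = 0" "\<not> set w \<subseteq> P"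
  shows "conv f g w = 0"
  using assms
proof (induction w arbitrary: f)
  case (Cons a w)
  have "conv (\<lambda>v. f (a # v)) g w = 0"
  proof (cases "a \<in> P")
    case True
    then show ?thesis using Cons.prems by (intro Cons.IH) auto
  next
    case False
    then have "(\<lambda>v. f (a # v)) = (\<lambda>v. 0)" using Cons.prems(1) by auto
    then show ?thesis by (simp add: conv_zero_left)
  qed
  then show ?case using Cons.prems(2,3) by simp
qed simp

lemma supported_mult: "supported P f \<Longrightarrow> supported P g \<Longrightarrow> supported P (f * g)"
  unfolding supported_def coeff_mult using conv_supported by blast

lemma supported_magnus:
  assumes "fst ` set w \<subseteq> P" shows "supported P (magnus w)"
  using assms
proof (induction w)
  case Nil
  then show ?case by (simp add: supported_def magnus_def)
next
  case (Cons a w)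
  have "supported P (magnus_letter a)"
    using Cons.prems by (auto simp: supported_def magnus_letter_def coeff_var coeff_geom)
  then show ?case using Cons by (auto simp: magnus_Cons intro: supported_mult)
qed

lemma conv_replicate_cong:
  assumes "\<And>j. f (replicate j p) = f' (replicate j p)" "\<And>j. g (replicate j p) = g' (replicate j p)"
  shows "conv f g (replicate j p) = conv f' g' (replicate j p)"
  using assms(1)
proof (induction j arbitrary: f f')
  case 0
  then show ?case using 0[of 0] assms(2)[of 0] by simp
next
  case (Suc j)
  have "conv (\<lambda>v. f (p # v)) g (replicate j p) = conv (\<lambda>v. f' (p # v)) g' (replicate j p)"
  proof (rule Suc.IH)
    show "f (p # replicate j p) = f' (p # replicate j p)" for j using Suc.prems[of "Suc j"] by simp
  qed
  then show ?case using Suc.prems[of 0] assms(2)[of "Suc j"] by simp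
qed

text \<open>Equality after setting every variable except X_p to 0. It respects products because the
  pieces of a power of \<open>p\<close> are again powers of \<open>p\<close>.\<close>

definition agree_on_powers :: "nat \<Rightarrow> ncs \<Rightarrow> ncs \<Rightarrow> bool" where
  "agree_on_powers p f g \<longleftrightarrow> (\<forall>j. coeff f (replicate j p) = coeff g (replicate j p))"

lemma agree_on_powers_mult:
  "agree_on_powers p f f' \<Longrightarrow> agree_on_powers p g g' \<Longrightarrow> agree_on_powers p (f * g) (f' * g')"
  unfolding agree_on_powers_def coeff_mult by (blast intro: conv_replicate_cong)

lemma agree_on_powers_refl: "agree_on_powers p f f"
  by (simp add: agree_on_powers_def)

text \<open>The coefficients of \<open>f\<close> are invariant under moving a leading \<open>p\<close> to the end of the word,
  and vanish when the first letter is not \<open>p\<close>.\<close>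

lemma coeff_commuting_var:
  assumes com: "low (Suc k) (f * ncs_var p - ncs_var p * f)"
    and "length v < k" "\<not> set v \<subseteq> {p}"
  shows "coeff f v = 0"
proof -
  \<comment> \<open>Coefficients are compared at \<open>w @ [p]\<close>, of length at most
    \<open>k\<close>; thus order \<open>Suc k\<close> of the commutator yields information on
    \<open>f\<close> only at lengths below \<open>k\<close>.\<close>
  have step: "coeff f w = coeff (ncs_var p * f) (w @ [p])" if "length w < k" for w
  proof -
    have "coeff (f * ncs_var p - ncs_var p * f) (w @ [p]) = 0"
      using com that by (simp add: low_def)
    then show ?thesis by (simp add: coeff_mult_var_snoc)
  qed
  have rot: "coeff f (replicate a p @ q # w) = 0"
    if "q \<noteq> p" "length (replicate a p @ q # w) < k" for a q w
    using that
  proof (induction a arbitrary: w)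
    case 0
    then show ?case using step[of "q # w"] by (simp add: coeff_var_mult_Cons)
  next
    case (Suc a)
    then show ?case
      using step[of "replicate (Suc a) p @ q # w"] Suc.IH[of "w @ [p]"]
      by (simp add: coeff_var_mult_Cons)
  qed
  obtain a q w where v: "v = replicate a p @ q # w" "q \<noteq> p"
    using assms(3)
  proof (induction v arbitrary: thesis)
    case (Cons b v)
    show ?case
    proof (cases "b = p")
      case True
      then have "\<not> set v \<subseteq> {p}" using Cons.prems by auto
      then obtain a q w where "v = replicate a p @ q # w" "q \<noteq> p" using Cons.IH by blast
      then show ?thesis using True Cons.prems(1)[of "Suc a" q w] by simp
    next
      case False
      then show ?thesis using Cons.prems(1)[of 0 b v] by simp
    qed
  qed simp
  then show ?thesis using rot[OF v(2)] assms(2) by blast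
qed

context
  fixes n :: nat
begin

interpretation F: group "free_group n" by (rule group_free_group)

text \<open>Setting the other variables to 0 sends the other generators to 1, so only a power of x_p
  survives, with the exponent sum of x_p in \<open>g\<close> as exponent.\<close>

lemma magnus_pow_agree:
  assumes p: "p \<in> {1..n}" and g: "g \<in> carrier (free_group n)"
  shows "\<exists>m::int. agree_on_powers p (magnus g) (magnus (fgen p [^]\<^bsub>free_group n\<^esub> m))"
  using g
proof (induction rule: free_group_induct)
  case one
  show ?case by (rule exI[of _ 0]) (simp add: agree_on_powers_refl)
next
  case (gen k g)
  then obtain m :: int where m: "agree_on_powers p (magnus g) (magnus (fgen p [^]\<^bsub>free_group n\<^esub> m))" by blast
  have fp: "fgen p \<in> carrier (free_group n)" by (rule fgen_closed[OF p])
  show ?case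
  proof (cases "k = p")
    case True
    have "fgen p [^]\<^bsub>free_group n\<^esub> (1 + m) = fgen p \<otimes>\<^bsub>free_group n\<^esub> fgen p [^]\<^bsub>free_group n\<^esub> m"
      using fp by (simp add: F.int_pow_mult)
    then show ?thesis using m True
      by (intro exI[of _ "1 + m"]) (simp add: magnus_mult agree_on_powers_mult agree_on_powers_refl)
  next
    case False
    have "replicate j p \<noteq> [k]" for j
      using False by (cases j) auto
    then have "agree_on_powers p (magnus (fgen k)) 1"
      by (simp add: agree_on_powers_def magnus_fgen coeff_var)
    from agree_on_powers_mult[OF this m] show ?thesis by (auto simp: magnus_mult)
  qed
next
  case (inv k g)
  then obtain m :: int where m: "agree_on_powers p (magnus g) (magnus (fgen p [^]\<^bsub>free_group n\<^esub> m))" by blast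
  have fp: "fgen p \<in> carrier (free_group n)" by (rule fgen_closed[OF p])
  show ?case
  proof (cases "k = p")
    case True
    have "fgen p [^]\<^bsub>free_group n\<^esub> (- 1 + m) = inv\<^bsub>free_group n\<^esub> (fgen p) \<otimes>\<^bsub>free_group n\<^esub> fgen p [^]\<^bsub>free_group n\<^esub> m"
      using fp by (simp only: F.int_pow_mult F.int_pow_neg F.int_pow_1)
    then show ?thesis using m True
      by (intro exI[of _ "- 1 + m"]) (simp add: magnus_mult agree_on_powers_mult agree_on_powers_refl)
  next
    case False
    have "magnus (inv\<^bsub>free_group n\<^esub> (fgen k)) = ncs_geom k"
      using inv_fgen[OF inv(1)] by (simp add: magnus_def magnus_letter_def)
    then have "agree_on_powers p (magnus (inv\<^bsub>free_group n\<^esub> (fgen k))) 1"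
      using False by (auto simp: agree_on_powers_def coeff_geom set_replicate_conv_if split: if_splits)
    from agree_on_powers_mult[OF this m] show ?thesis by (auto simp: magnus_mult)
  qed
qed

lemma supported_pow:
  fixes m :: int
  assumes p: "p \<in> {1..n}"
  shows "supported {p} (magnus (fgen p [^]\<^bsub>free_group n\<^esub> m))"
proof (induction m rule: int_induct[of _ 0])
  case base
  show ?case by (simp add: supported_def magnus_one)
next
  case (step1 m)
  have "fgen p [^]\<^bsub>free_group n\<^esub> (m + 1) = fgen p [^]\<^bsub>free_group n\<^esub> m \<otimes>\<^bsub>free_group n\<^esub> fgen p"
    using fgen_closed[OF p] by (simp add: F.int_pow_mult)
  then show ?case using step1 supported_magnus[of "fgen p" "{p}"]
    by (simp add: magnus_mult supported_mult fgen_def)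
next
  case (step2 m)
  have "fgen p [^]\<^bsub>free_group n\<^esub> (m - 1) = fgen p [^]\<^bsub>free_group n\<^esub> m \<otimes>\<^bsub>free_group n\<^esub> inv\<^bsub>free_group n\<^esub> (fgen p)"
    using fgen_closed[OF p] by (simp add: F.int_pow_diff)
  then show ?case using step2 supported_magnus[of "[(p, False)]" "{p}"]
    by (simp add: magnus_mult supported_mult inv_fgen[OF p])
qed

lemma coeff_magnus_pow:
  fixes m :: int
  assumes p: "p \<in> {1..n}"
  shows "coeff (magnus (fgen p [^]\<^bsub>free_group n\<^esub> m)) [p] = m"
proof -
  have "leads 1 (fgen p) (ncs_var p)"
    by (simp add: leads_def magnus_fgen homogeneous_var[simplified])
  from leads_pow[OF fgen_closed[OF p] order_refl this, of m]
  have "low 2 (magnus (fgen p [^]\<^bsub>free_group n\<^esub> m) - 1 - of_int m * ncs_var p)"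
    by (simp add: leads_def numeral_2_eq_2)
  then have "coeff (magnus (fgen p [^]\<^bsub>free_group n\<^esub> m) - 1 - of_int m * ncs_var p) [p] = 0"
    unfolding low_def by (elim allE[of _ "[p]"]) simp
  then show ?thesis by (simp add: coeff_var)
qed

lemma pow_commute:
  fixes m :: int
  assumes "x \<in> carrier (free_group n)"
  shows "x [^]\<^bsub>free_group n\<^esub> m \<otimes>\<^bsub>free_group n\<^esub> x = x \<otimes>\<^bsub>free_group n\<^esub> x [^]\<^bsub>free_group n\<^esub> m"
  using F.int_pow_mult[OF assms, of m 1] F.int_pow_mult[OF assms, of 1 m] assms
  by (simp add: add.commute)

text \<open>Dividing \<open>g\<close> by a suitable power of x_p gives \<open>h\<close>, which still
  commutes with x_p modulo Gamma_(k+1). Below degree \<open>k\<close> its coefficients at words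
  other than powers of \<open>p\<close> vanish by \<open>coeff_commuting_var\<close>; at powers of
  \<open>p\<close> they agree with those of 1 by the choice of \<open>m\<close>. The degree
  criterion then applies.\<close>

lemma centraliser_mod_lcs:
  assumes p: "p \<in> {1..n}" and g: "g \<in> carrier (free_group n)"
    and com: "inv\<^bsub>free_group n\<^esub> (fgen p) \<otimes>\<^bsub>free_group n\<^esub>
      (g \<otimes>\<^bsub>free_group n\<^esub> fgen p \<otimes>\<^bsub>free_group n\<^esub> inv\<^bsub>free_group n\<^esub> g) \<in> lcs (free_group n) (Suc k)"
  shows "\<exists>h\<in>lcs (free_group n) k. \<exists>m::int. g = h \<otimes>\<^bsub>free_group n\<^esub> fgen p [^]\<^bsub>free_group n\<^esub> m"
proof -
  let ?x = "fgen p"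
  have x: "?x \<in> carrier (free_group n)" by (rule fgen_closed[OF p])
  obtain m :: int where m: "agree_on_powers p (magnus g) (magnus (?x [^]\<^bsub>free_group n\<^esub> m))"
    using magnus_pow_agree[OF p g] by blast
  define h where "h = g \<otimes>\<^bsub>free_group n\<^esub> ?x [^]\<^bsub>free_group n\<^esub> (- m)"
  have h: "h \<in> carrier (free_group n)" using g x by (simp add: h_def)
  have gh: "g = h \<otimes>\<^bsub>free_group n\<^esub> ?x [^]\<^bsub>free_group n\<^esub> m"
    using g x by (simp add: h_def F.int_pow_neg F.m_assoc)
  define t where "t = inv\<^bsub>free_group n\<^esub> ?x \<otimes>\<^bsub>free_group n\<^esub> (g \<otimes>\<^bsub>free_group n\<^esub> ?x \<otimes>\<^bsub>free_group n\<^esub> inv\<^bsub>free_group n\<^esub> g)"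
  have t: "low (Suc k) (magnus t - 1)" using com lcs_low_magnus by (simp only: t_def)
  have "g \<otimes>\<^bsub>free_group n\<^esub> ?x \<otimes>\<^bsub>free_group n\<^esub> inv\<^bsub>free_group n\<^esub> g = h \<otimes>\<^bsub>free_group n\<^esub>
      (?x [^]\<^bsub>free_group n\<^esub> m \<otimes>\<^bsub>free_group n\<^esub> ?x) \<otimes>\<^bsub>free_group n\<^esub>
      inv\<^bsub>free_group n\<^esub> (?x [^]\<^bsub>free_group n\<^esub> m) \<otimes>\<^bsub>free_group n\<^esub> inv\<^bsub>free_group n\<^esub> h"
    using h x by (simp add: gh F.group_word_simps)
  also have "\<dots> = h \<otimes>\<^bsub>free_group n\<^esub> ?x \<otimes>\<^bsub>free_group n\<^esub> inv\<^bsub>free_group n\<^esub> h"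
    unfolding pow_commute[OF x] using h x by (simp add: F.group_word_simps)
  finally have "h \<otimes>\<^bsub>free_group n\<^esub> ?x = ?x \<otimes>\<^bsub>free_group n\<^esub> t \<otimes>\<^bsub>free_group n\<^esub> h"
    using h x by (simp add: t_def F.group_word_simps)
  \<comment> \<open>Subtracting \<open>(1 + ncs_var p) * magnus h\<close> leaves the ring commutator
    of \<open>magnus h\<close> with \<open>ncs_var p\<close> on the left and a multiple of
    \<open>magnus t - 1\<close> on the right, which supplies the order.\<close>
  then have "magnus h * (1 + ncs_var p) = (1 + ncs_var p) * magnus t * magnus h"
    by (metis magnus_fgen magnus_mult)
  then have "magnus h * ncs_var p - ncs_var p * magnus h = (1 + ncs_var p) * ((magnus t - 1) * magnus h)"
    by (simp add: algebra_simps)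
  moreover have "low (Suc k) ((1 + ncs_var p) * ((magnus t - 1) * magnus h))"
    by (intro low_mult_left low_mult_right t)
  ultimately have com_h: "low (Suc k) (magnus h * ncs_var p - ncs_var p * magnus h)" by simp
  have "agree_on_powers p (magnus h) (magnus (?x [^]\<^bsub>free_group n\<^esub> m) * magnus (?x [^]\<^bsub>free_group n\<^esub> (- m)))"
    unfolding h_def magnus_mult by (intro agree_on_powers_mult m agree_on_powers_refl)
  then have pows: "agree_on_powers p (magnus h) 1"
    using x by (simp flip: magnus_mult[of n] add: F.int_pow_neg magnus_one)
  have "low k (magnus h - 1)"
    unfolding low_def
  proof (intro allI impI)
    fix v :: "nat list" assume v: "length v < k"
    show "coeff (magnus h - 1) v = 0"
    proof (cases "set v \<subseteq> {p}")
      case True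
      then have "v = replicate (length v) p" by (intro replicate_eqI) auto
      then show ?thesis using pows by (metis agree_on_powers_def coeff_simps(4) diff_self)
    next
      case False
      then show ?thesis using coeff_commuting_var[OF com_h v False] by auto
    qed
  qed
  then have "h \<in> lcs (free_group n) k" using lcs_iff_low_magnus[OF h] by simp
  then show ?thesis using gh by blast
qed

end

section \<open>The exponent of x_p and the induction along the tower\<close>

lemma coeff_mult_single: "coeff (f * g) [a] = coeff f [] * coeff g [a] + coeff f [a] * coeff g []"
  by (simp add: coeff_mult)

lemma coeff_mult_pair: "coeff (f * g) [a, b] =
    coeff f [] * coeff g [a, b] + coeff f [a] * coeff g [b] + coeff f [a, b] * coeff g []"
  by (simp add: coeff_mult)

context
  fixes n :: nat
begin

interpretation F: group "free_group n" by (rule group_free_group)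
interpretation Aut: group "Aut_F n" by (rule group_Aut_F)
interpretation I: group "partial_inner_group n" by (rule group_partial_inner_group)

text \<open>The coefficient of \<open>X\<^sub>p X\<^sub>1\<close> in the image of \<open>x\<^sub>1\<close> detects the exponent of \<open>x\<^sub>p\<close>.\<close>

lemma factor_conj_pow_exponent:
  fixes m :: int
  assumes p: "2 \<le> p" "p \<le> n" and s: "s \<in> carrier (free_group (p - 1))"
    and disp: "inv\<^bsub>free_group n\<^esub> (fgen 1) \<otimes>\<^bsub>free_group n\<^esub> (fgen p [^]\<^bsub>free_group n\<^esub> m \<otimes>\<^bsub>free_group n\<^esub> s
      \<otimes>\<^bsub>free_group n\<^esub> inv\<^bsub>free_group n\<^esub> (fgen p [^]\<^bsub>free_group n\<^esub> m)) \<in> lcs (free_group n) 3"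
  shows "m = 0"
proof -
  let ?x = "fgen 1" and ?y = "fgen p [^]\<^bsub>free_group n\<^esub> m"
  have pn: "p \<in> {1..n}" and p1: "p \<noteq> 1" using p by auto
  have c: "?x \<in> carrier (free_group n)" "?y \<in> carrier (free_group n)" "s \<in> carrier (free_group n)"
  proof -
    have "p - 1 \<le> n" "1 \<in> {1..n}" using p by auto
    then show "?x \<in> carrier (free_group n)" "s \<in> carrier (free_group n)"
      using s free_group_mono fgen_closed by blast+
    show "?y \<in> carrier (free_group n)" using fgen_closed[OF pn] by simp
  qed
  define t where "t = inv\<^bsub>free_group n\<^esub> ?x \<otimes>\<^bsub>free_group n\<^esub> (?y \<otimes>\<^bsub>free_group n\<^esub> s \<otimes>\<^bsub>free_group n\<^esub> inv\<^bsub>free_group n\<^esub> ?y)"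
  have "low 3 (magnus t - 1)" using disp lcs_low_magnus by (simp only: t_def)
  then have "coeff (magnus t - 1) [a] = 0" "coeff (magnus t - 1) [a, b] = 0" for a b
    by (simp_all add: low_def)
  then have T: "coeff (magnus t) [a] = 0" "coeff (magnus t) [a, b] = 0" for a b
    by simp_all
  \<comment> \<open>Clearing the inverses leaves products of two or three expansions, whose
    coefficients in degrees 1 and 2 are explicit.\<close>
  have "?x \<otimes>\<^bsub>free_group n\<^esub> (t \<otimes>\<^bsub>free_group n\<^esub> ?y) = ?y \<otimes>\<^bsub>free_group n\<^esub> s"
    using c by (simp add: t_def F.group_word_simps)
  then have "magnus (?x \<otimes>\<^bsub>free_group n\<^esub> (t \<otimes>\<^bsub>free_group n\<^esub> ?y)) = magnus (?y \<otimes>\<^bsub>free_group n\<^esub> s)"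
    by simp
  then have eq: "(1 + ncs_var 1) * (magnus t * magnus ?y) = magnus ?y * magnus s"
    by (simp only: magnus_mult magnus_fgen)
  have y: "coeff (magnus ?y) [1] = 0" "coeff (magnus ?y) [p, 1] = 0"
    using supported_pow[OF pn, of m] p1 by (auto simp: supported_def)
  have ym: "coeff (magnus ?y) [p] = m" by (rule coeff_magnus_pow[OF pn])
  have "fst ` set s \<subseteq> {1..p - 1}" using s by (auto simp: carrier_free_group)
  from supported_magnus[OF this] have s0: "coeff (magnus s) [p, 1] = 0"
    using p by (auto simp: supported_def)
  \<comment> \<open>Degree 1 shows that \<open>s\<close> has coefficient 1 at X_1. At X_p X_1 the
    left side of \<open>eq\<close> then gives 0 and the right side \<open>m\<close>:
    \<open>t\<close> has no terms of degree 1 or 2, the power of x_p involves only X_p, and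
    \<open>s\<close> does not involve X_p.\<close>
  have "coeff (magnus s) [1] = 1"
    using arg_cong[OF eq, of "\<lambda>f. coeff f [1]"] y T by (simp add: coeff_mult_single coeff_var)
  then show ?thesis
    using arg_cong[OF eq, of "\<lambda>f. coeff f [p, 1]"] y ym T s0 p1
    by (simp add: coeff_mult_pair coeff_mult_single coeff_var)
qed

text \<open>The target series is that of I_n and not of Aut(F_n), so \<open>factor_conj n p\<close>
  is read as a homomorphism into \<open>partial_inner_group n\<close>.\<close>

lemma factor_conj_lcs:
  assumes p: "2 \<le> p" "p \<le> n" and h: "h \<in> lcs (free_group p) k"
  shows "factor_conj n p h \<in> lcs (partial_inner_group n) k"
proof -
  interpret C: group_hom "free_group p" "Aut_F n" "factor_conj n p"
    by (rule factor_conj_group_hom[OF p(2)])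
  have "factor_conj n p \<in> hom (free_group p) (partial_inner_group n)"
    using p by (intro homI) (simp_all add: factor_conj_partial_inner partial_inner_eq)
  then interpret CI: group_hom "free_group p" "partial_inner_group n" "factor_conj n p"
    by (simp add: group_hom_def group_hom_axioms_def group_free_group group_partial_inner_group)
  show ?thesis by (rule CI.hom_lcs[OF h])
qed

text \<open>\<open>magnus\<close> does not depend on the rank, so the degree criteria in F_n and in
  F_p are the same condition.\<close>

lemma lcs_free_factor:
  assumes "p \<le> n" "h \<in> lcs (free_group n) k" "h \<in> carrier (free_group p)"
  shows "h \<in> lcs (free_group p) k"
  using assms lcs_low_magnus lcs_iff_low_magnus[OF assms(3)] by blast

lemma andreadakis_partial_inner_upto_lcs:
  assumes k: "2 \<le> k"
  shows "\<lbrakk>1 \<le> p; p \<le> n; \<phi> \<in> partial_inner_upto n p; \<phi> \<in> andreadakis n k\<rbrakk> \<Longrightarrow>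
    \<phi> \<in> lcs (partial_inner_group n) k"
proof (induction p arbitrary: \<phi> rule: dec_induct)
  case base
  have "\<phi> \<in> generate (Aut_F n) {}"
  proof -
    \<comment> \<open>Generators have \<open>2 \<le> p\<close>, so the first stage of the tower is
      the trivial group.\<close>
    have none: "{nu n p i | p i. 2 \<le> p \<and> p \<le> 1 \<and> 1 \<le> i \<and> i \<le> p} = {}" by auto
    show ?thesis using base.prems(2) unfolding partial_inner_upto_def none .
  qed
  then have "\<phi> = \<one>\<^bsub>partial_inner_group n\<^esub>" by (simp add: Aut.generate_empty)
  then show ?case using I.lcs_closed(3) by simp
next
  case (step q)
  let ?p = "Suc q"
  have p: "2 \<le> ?p" "?p \<le> n" and qn: "q \<le> n" and pn: "?p \<in> {1..n}" using step by auto
  interpret P: group "free_group ?p" by (rule group_free_group)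
  interpret C: group_hom "free_group ?p" "Aut_F n" "factor_conj n ?p"
    by (rule factor_conj_group_hom[OF p(2)])
  interpret A: subgroup "andreadakis n k" "Aut_F n" by (rule subgroup_andreadakis)
  obtain g \<psi> where g: "g \<in> carrier (free_group ?p)" and \<psi>: "\<psi> \<in> partial_inner_upto n q"
    and \<phi>: "\<phi> = factor_conj n ?p g \<otimes>\<^bsub>Aut_F n\<^esub> \<psi>"
    using partial_inner_upto_decompose[OF step.prems(2) step.hyps(1) p(2)] by blast
  have gn: "g \<in> carrier (free_group n)" using g p(2) free_group_mono by blast
  have \<psi>A: "\<psi> \<in> carrier (Aut_F n)"
    using \<psi> subgroup.mem_carrier[OF subgroup_partial_inner_upto[OF qn]] by blast
  let ?x = "fgen ?p"
  have x: "?x \<in> carrier (free_group n)" "?x \<in> carrier (free_group ?p)"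
    using pn by (auto intro!: fgen_closed)
  have "\<phi> ?x = g \<otimes>\<^bsub>free_group n\<^esub> ?x \<otimes>\<^bsub>free_group n\<^esub> inv\<^bsub>free_group n\<^esub> g"
    using partial_inner_upto_fgen[OF \<psi> qn lessI p(2)] x \<psi>A factor_conj_Aut[OF p(2) g]
    by (simp add: \<phi> mult_Aut_F_apply factor_conj_fgen[OF gn pn])
  with andreadakisD(2)[OF step.prems(3) x(1)]
  have "inv\<^bsub>free_group n\<^esub> ?x \<otimes>\<^bsub>free_group n\<^esub> (g \<otimes>\<^bsub>free_group n\<^esub> ?x \<otimes>\<^bsub>free_group n\<^esub> inv\<^bsub>free_group n\<^esub> g)
      \<in> lcs (free_group n) (Suc k)" by (simp only:)
  from centraliser_mod_lcs[OF pn gn this] obtain h and m :: int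
    where h: "h \<in> lcs (free_group n) k" and ghm: "g = h \<otimes>\<^bsub>free_group n\<^esub> ?x [^]\<^bsub>free_group n\<^esub> m"
    by blast
  let ?y = "?x [^]\<^bsub>free_group n\<^esub> m"
  have hn: "h \<in> carrier (free_group n)" by (rule F.lcs_closed(4)[OF h])
  have factor: "subgroup (carrier (free_group ?p)) (free_group n)"
  proof (rule F.subgroupI)
    show "carrier (free_group ?p) \<subseteq> carrier (free_group n)" by (rule free_group_mono[OF p(2)])
    show "carrier (free_group ?p) \<noteq> {}" using x(2) by blast
    show "inv\<^bsub>free_group n\<^esub> a \<in> carrier (free_group ?p)" if "a \<in> carrier (free_group ?p)" for a
      using inv_free_group_cong[OF p(2) that] that by simp
    show "a \<otimes>\<^bsub>free_group n\<^esub> b \<in> carrier (free_group ?p)"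
      if "a \<in> carrier (free_group ?p)" "b \<in> carrier (free_group ?p)" for a b
      using P.m_closed[OF that] by (simp only: mult_free_group)
  qed
  have yp: "?y \<in> carrier (free_group ?p)" by (rule F.subgroup_int_pow_closed[OF factor x(2)])
  \<comment> \<open>The centraliser was computed in F_n; that \<open>h\<close> lies in the factor
    follows because both \<open>g\<close> and the power of the last generator do.\<close>
  have "h = g \<otimes>\<^bsub>free_group n\<^esub> inv\<^bsub>free_group n\<^esub> ?y"
    using hn x by (simp add: ghm F.m_assoc)
  then have hp: "h \<in> carrier (free_group ?p)"
    using subgroup.m_closed[OF factor g subgroup.m_inv_closed[OF factor yp]] by simp
  have hI: "factor_conj n ?p h \<in> lcs (partial_inner_group n) k"
    by (rule factor_conj_lcs[OF p lcs_free_factor[OF p(2) h hp]])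
  \<comment> \<open>The inclusion already proved puts the conjugation by \<open>h\<close> into the
    Andreadakis group, so it can be split off and the remaining \<open>\<phi>'\<close> still has
    index \<open>k\<close>.\<close>
  then have hA: "factor_conj n ?p h \<in> andreadakis n k"
    using lcs_partial_inner_andreadakis[of k] k by auto
  define \<phi>' where "\<phi>' = factor_conj n ?p ?y \<otimes>\<^bsub>Aut_F n\<^esub> \<psi>"
  have yA: "factor_conj n ?p ?y \<in> carrier (Aut_F n)" by (rule factor_conj_Aut[OF p(2) yp])
  have \<phi>'A: "\<phi>' \<in> carrier (Aut_F n)" using yA \<psi>A by (simp add: \<phi>'_def)
  have "factor_conj n ?p g = factor_conj n ?p h \<otimes>\<^bsub>Aut_F n\<^esub> factor_conj n ?p ?y"
    unfolding ghm mult_free_group_cong[of n h ?y ?p] by (rule C.hom_mult[OF hp yp])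
  then have \<phi>h: "\<phi> = factor_conj n ?p h \<otimes>\<^bsub>Aut_F n\<^esub> \<phi>'"
    unfolding \<phi> \<phi>'_def using yA \<psi>A factor_conj_Aut[OF p(2) hp] by (simp add: Aut.m_assoc)
  then have "\<phi>' = inv\<^bsub>Aut_F n\<^esub> (factor_conj n ?p h) \<otimes>\<^bsub>Aut_F n\<^esub> \<phi>"
    using \<phi>'A factor_conj_Aut[OF p(2) hp] by (simp add: Aut.inv_mult_cancel)
  then have \<phi>'k: "\<phi>' \<in> andreadakis n k"
    using A.m_closed[OF A.m_inv_closed[OF hA] step.prems(3)] by simp
  have f1: "fgen 1 \<in> carrier (free_group n)" "fgen 1 \<in> carrier (free_group q)"
    using step.hyps(1) qn by (auto intro!: fgen_closed)
  have s: "\<psi> (fgen 1) \<in> carrier (free_group q)"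
    by (rule partial_inner_upto_commute(1)[OF \<psi> order_refl qn f1(2)])
  have sp: "\<psi> (fgen 1) \<in> carrier (free_group ?p)" using s free_group_mono[of q ?p] by auto
  have yn: "?y \<in> carrier (free_group n)" using x by simp
  have "\<phi>' (fgen 1) = ?y \<otimes>\<^bsub>free_group n\<^esub> \<psi> (fgen 1) \<otimes>\<^bsub>free_group n\<^esub> inv\<^bsub>free_group n\<^esub> ?y"
    unfolding \<phi>'_def mult_Aut_F_apply[OF yA \<psi>A f1(1)] by (rule factor_conj_factor[OF p(2) yn sp])
  \<comment> \<open>Here \<open>2 \<le> k\<close> enters: Gamma_(k+1) lies in Gamma_3, deep enough
    to detect the exponent \<open>m\<close>.\<close>
  with andreadakisD(2)[OF \<phi>'k f1(1)] F.lcs_antimono[of 3 "Suc k"] k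
  have "inv\<^bsub>free_group n\<^esub> (fgen 1) \<otimes>\<^bsub>free_group n\<^esub> (?y \<otimes>\<^bsub>free_group n\<^esub> \<psi> (fgen 1) \<otimes>\<^bsub>free_group n\<^esub>
      inv\<^bsub>free_group n\<^esub> ?y) \<in> lcs (free_group n) 3" by auto
  from factor_conj_pow_exponent[OF p _ this] s have "m = 0" by simp
  then have "\<phi>' = \<psi>"
    using C.hom_one \<psi>A by (simp add: \<phi>'_def one_free_group)
  then have "\<psi> \<in> lcs (partial_inner_group n) k"
    using step.IH[OF qn \<psi>] \<phi>'k by simp
  then show ?case
    using I.lcs_closed(1)[OF hI] \<phi>h \<open>\<phi>' = \<psi>\<close> by simp
qed

end

theorem theorem3p3p7:
  fixes n k :: nat
  assumes "n \<ge> 2" and "k \<ge> 1"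
  shows "andreadakis n k \<inter> partial_inner n = lcs (partial_inner_group n) k"
proof
  show "andreadakis n k \<inter> partial_inner n \<subseteq> lcs (partial_inner_group n) k"
  \<comment> \<open>For \<open>k = 1\<close> the term of the lower central series is all of I_n; the
    exponent argument needs \<open>2 \<le> k\<close>.\<close>
  proof (cases "k = 1")
    case False
    then have "2 \<le> k" using assms(2) by simp
    then show ?thesis
      using andreadakis_partial_inner_upto_lcs[of k n n] assms(1) by (auto simp: partial_inner_eq)
  qed (simp add: partial_inner_group_def)
  show "lcs (partial_inner_group n) k \<subseteq> andreadakis n k \<inter> partial_inner n"
    by (rule lcs_partial_inner_andreadakis[OF assms(2)])
qed

end
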